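(* Assume the sub-Gaussian sampling model with $\mu_4\le 3$. There exist constants $c_0,C_2>0$ such that if $m>c_0 r\log^{10}n$, then with probability at least $1-1/n^2$ the following holds simultaneously for all positive semidefinite Toeplitz matrices $\Sigma\in\mathbb{R}^{n\times n}$ of rank at most $r$, all $\epsilon_2\ge0$ and all $\eta\in\mathbb{R}^m$ with $\|\eta\|_2\le\epsilon_2$: letting $y=\mathcal A(\Sigma)+\eta$, any minimizer $\hat\Sigma$ of $$\min_M\ \operatorname{Tr}(M)\quad\text{subject to}\quad M\succeq0,\ \ \|y-\mathcal A(M)\|_2\le\epsilon_2,\ \ M\text{ is Toeplitz}$$ satisfies $\|\hat\Sigma-\Sigma\|_{\mathrm F}\le C_2\,\epsilon_2/\sqrt m$.
   Context: Sub-Gaussian sampling model: the sensing vectors $a_1,\dots,a_m\in\mathbb{R}^n$ are i.i.d. copies of a random vector $z=(z_1,\dots,z_n)^\top$ whose entries are i.i.d. sub-Gaussian random variables with $\mathbb{E}[z_j]=0$, $\mathbb{E}[z_j^2]=1$ and $\mu_4:=\mathbb{E}[z_j^4]>1$. $\mathcal A(M)=(a_i^\top M a_i)_{i=1}^m$. A matrix is Toeplitz if its entries are constant along each diagonal. *)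

theory Defs
  imports "HOL-Probability.Probability" "Jordan_Normal_Form.DL_Rank"
begin

text \<open>Real n x n matrices are represented as functions nat => nat => real;
  only the entries with indices below n are meaningful.\<close>

definition sym_matrix :: "nat \<Rightarrow> (nat \<Rightarrow> nat \<Rightarrow> real) \<Rightarrow> bool" where
  "sym_matrix n M \<longleftrightarrow> (\<forall>i<n. \<forall>j<n. M i j = M j i)"

definition psd :: "nat \<Rightarrow> (nat \<Rightarrow> nat \<Rightarrow> real) \<Rightarrow> bool" where
  "psd n M \<longleftrightarrow> sym_matrix n M \<and>
     (\<forall>x :: nat \<Rightarrow> real. 0 \<le> (\<Sum>i<n. \<Sum>j<n. x i * M i j * x j))"

definition toeplitz :: "nat \<Rightarrow> (nat \<Rightarrow> nat \<Rightarrow> real) \<Rightarrow> bool" where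
  "toeplitz n M \<longleftrightarrow> (\<forall>i j. Suc i < n \<and> Suc j < n \<longrightarrow> M (Suc i) (Suc j) = M i j)"

definition to_mat :: "nat \<Rightarrow> (nat \<Rightarrow> nat \<Rightarrow> real) \<Rightarrow> real mat" where
  "to_mat n M = mat n n (\<lambda>(i, j). M i j)"

definition mrank :: "nat \<Rightarrow> (nat \<Rightarrow> nat \<Rightarrow> real) \<Rightarrow> nat" where
  "mrank n M = vec_space.rank n (to_mat n M)"

definition mtrace :: "nat \<Rightarrow> (nat \<Rightarrow> nat \<Rightarrow> real) \<Rightarrow> real" where
  "mtrace n M = (\<Sum>i<n. M i i)"

definition frob_norm :: "nat \<Rightarrow> (nat \<Rightarrow> nat \<Rightarrow> real) \<Rightarrow> real" where
  "frob_norm n M = sqrt (\<Sum>i<n. \<Sum>j<n. (M i j)\<^sup>2)"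

definition vnorm :: "nat \<Rightarrow> (nat \<Rightarrow> real) \<Rightarrow> real" where
  "vnorm m v = sqrt (\<Sum>i<m. (v i)\<^sup>2)"

definition meas_op :: "nat \<Rightarrow> (nat \<Rightarrow> nat \<Rightarrow> real) \<Rightarrow> (nat \<Rightarrow> nat \<Rightarrow> real) \<Rightarrow> nat \<Rightarrow> real" where
  "meas_op n a M k = (\<Sum>i<n. \<Sum>j<n. a k i * M i j * a k j)"

text \<open>Sub-Gaussian real distribution (psi_2-norm finite).\<close>
definition subgaussian :: "real measure \<Rightarrow> bool" where
  "subgaussian D \<longleftrightarrow> (\<exists>K>0. integrable D (\<lambda>x. exp (x\<^sup>2 / K\<^sup>2)) \<and>
                          (\<integral>x. exp (x\<^sup>2 / K\<^sup>2) \<partial>D) \<le> 2)"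

definition sample_space :: "real measure \<Rightarrow> nat \<Rightarrow> nat \<Rightarrow> (nat \<times> nat \<Rightarrow> real) measure" where
  "sample_space D m n = PiM ({..<m} \<times> {..<n}) (\<lambda>_. D)"

definition trace_min :: "nat \<Rightarrow> nat \<Rightarrow> (nat \<Rightarrow> nat \<Rightarrow> real) \<Rightarrow> (nat \<Rightarrow> real) \<Rightarrow> real
    \<Rightarrow> (nat \<Rightarrow> nat \<Rightarrow> real) \<Rightarrow> bool" where
  "trace_min n m a y eps Mh \<longleftrightarrow>
     (let feasible = (\<lambda>M. psd n M \<and> vnorm m (\<lambda>k. y k - meas_op n a M k) \<le> eps \<and> toeplitz n M)
      in feasible Mh \<and> (\<forall>M. feasible M \<longrightarrow> mtrace n Mh \<le> mtrace n M))"

end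

theory Submission
  imports Defs "Jordan_Normal_Form.Gram_Schmidt"
begin

text \<open>
  Let \<open>H\<close> be the difference of a minimizer and \<open>\<Sigma>\<close>. Optimality gives a nonpositive trace, and the
  compression of \<open>H\<close> to the kernel of \<open>\<Sigma>\<close> is psd. Embedding Toeplitz matrices into circulants of
  size \<open>2 n\<close>, the \<open>l\<^sup>1\<close> norm of the values of \<open>H\<close> at the \<open>2 n\<close> frequencies (a surrogate of the
  nuclear norm) is then at most \<open>6 \<surd>r \<parallel>H\<parallel>\<^sub>F\<close>. Moreover \<open>a\<^sup>T H a\<close> is the pairing of these values with
  the symbol of the Toeplitz projection of \<open>a a\<^sup>T\<close>, and with high probability this symbol is bounded
  by a power of \<open>log n\<close>, because the weights \<open>1 / (n - \<bar>i - k\<bar>)\<close> have Frobenius norm of order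
  \<open>\<surd>log n\<close>.

  Only a lower bound on the measurements is needed. For a single \<open>H\<close> the Paley-Zygmund inequality
  bounds \<open>\<bar>a\<^sup>T H a\<bar>\<close> from below with constant probability. For uniformity, Maurey's empirical method
  approximates \<open>H\<close>, in the average over the samples and over the law of \<open>a\<close>, by one of
  \<open>(6 n)\<^bsup>q\<^esup>\<close> combinations of frequencies with \<open>q\<close> of order \<open>r log\<^sup>4 n\<close>, and Hoeffding's inequality
  with a union bound over this net concludes.
\<close>

subsection \<open>Toeplitz matrices in the Fourier domain\<close>

text \<open>The values of the form \<open>H\<close> at the rows are differences of two residuals of
  length at most \<open>eps2\<close>, so their l2 norm is at most \<open>2 * eps2\<close>;
  Cauchy-Schwarz against the all-ones vector turns a lower bound of order m on the sum of absolute
  values into the claim. Two obstacles shape the uniform bound. The seminorm in which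
  \<open>H\<close> has to be approximated depends on the drawn rows, whereas Hoeffding and the union
  bound need a net fixed beforehand; Maurey's candidates are only signed atoms and do not depend on
  the seminorm. Maurey also needs bounded atoms, while the symbol of a row is bounded only with high
  probability; rows with a large symbol are therefore counted as 0. Count of logarithms: the symbol
  is at most of order \<open>(ln n)^2\<close>, the Maurey error involves its square, so q is of
  order \<open>r (ln n)^4\<close>; the logarithm of the net size adds one more power, and
  \<open>r (ln n)^5\<close> lies within the assumed \<open>r (ln n)^10\<close>.\<close>

lemma sum_swap3:
  "(\<Sum>j\<in>A. \<Sum>i\<in>B. \<Sum>k\<in>C. f j i k) = (\<Sum>i\<in>B. \<Sum>k\<in>C. \<Sum>j\<in>A. f j i k)"
  by (rule trans[OF sum.swap]) (intro sum.cong refl, rule sum.swap)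

text \<open>Each summand times 2 sin (x/2) is a difference of sines at consecutive half-integer
  multiples of x, so the sum telescopes to a Dirichlet kernel. Keeping the factor on the left avoids
  dividing by a sine that may vanish.\<close>

lemma sum_cos_mult_sin_half:
  fixes x :: real
  shows "2 * sin (x / 2) * (\<Sum>j<N. cos (real j * x)) = sin ((real N - 1 / 2) * x) + sin (x / 2)"
proof (induction N)
  case 0
  show ?case by (simp add: field_simps)
next
  case (Suc N)
  have "2 * sin (x / 2) * cos (real N * x) = sin (real N * x + x / 2) - sin (real N * x - x / 2)"
    by (simp add: sin_add sin_diff)
  then show ?case
    using Suc by (simp add: algebra_simps)
qed

text \<open>After 2 n terms the endpoint (2 n - 1/2) x of the telescoped sum is - x/2 modulo 2 pi,
  so the two sines cancel. The bounds on l guarantee that sin (x/2) is nonzero: otherwise 2 n would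
  divide l.\<close>

lemma sum_cos_eq_0:
  fixes l :: int
  assumes "0 < n" "l \<noteq> 0" "\<bar>l\<bar> < 2 * int n"
  shows "(\<Sum>j<2 * n. cos (pi * real j * real_of_int l / real n)) = 0"
proof -
  define x where "x = pi * real_of_int l / real n"
  have "sin (x / 2) \<noteq> 0"
  proof
    assume "sin (x / 2) = 0"
    then obtain k :: int where k: "x / 2 = real_of_int k * pi"
      by (auto simp: sin_zero_iff_int2)
    then have "real_of_int l = real_of_int (2 * int n * k)"
      using assms(1) by (simp add: x_def field_simps)
    then have "l = 2 * int n * k" by linarith
    with assms(2,3) have "k \<noteq> 0" "2 * int n * \<bar>k\<bar> < 2 * int n * 1"
      by (auto simp: abs_mult)
    then show False
      using assms(1) by (subst (asm) mult_less_cancel_left_pos) auto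
  qed
  moreover have "sin ((real (2 * n) - 1 / 2) * x) = - sin (x / 2)"
  proof -
    have "(real (2 * n) - 1 / 2) * x = of_int l * (2 * pi) - x / 2"
      using assms(1) by (simp add: x_def field_simps)
    then show ?thesis
      by (simp add: sin_diff mult.commute[of "of_int l"] del: times_divide_eq_left)
  qed
  ultimately have "(\<Sum>j<2 * n. cos (real j * x)) = 0"
    using sum_cos_mult_sin_half[of x "2 * n"] by simp
  then show ?thesis
    by (simp add: x_def mult_ac)
qed

lemma sum_cos_diff:
  fixes i k :: nat
  assumes "i < n" "k < n"
  shows "(\<Sum>j<2 * n. cos (pi * real j * (real i - real k) / real n)) = (if i = k then 2 * real n else 0)"
  using sum_cos_eq_0[of n "int i - int k"] assms by auto

text \<open>Product-to-sum leads to the frequencies l - l' and l + l', both below 2 n in modulus;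
  this is what the size 2 n of the circulant buys. Both terms survive for l = l' = 0, hence a sum of
  two indicators.\<close>

lemma sum_cos_mult_cos:
  fixes l l' :: int
  assumes "0 < n" "\<bar>l\<bar> < int n" "\<bar>l'\<bar> < int n"
  shows "(\<Sum>j<2 * n. cos (pi * real j * of_int l / real n) * cos (pi * real j * of_int l' / real n))
       = real n * ((if l' = l then 1 else 0) + (if l' = - l then 1 else 0))"
proof -
  have *: "(\<Sum>j<2 * n. cos (pi * real j * of_int k / real n)) = (if k = 0 then 2 * real n else 0)"
    if "\<bar>k\<bar> < 2 * int n" for k
    using sum_cos_eq_0[OF assms(1) _ that] by auto
  have "(\<Sum>j<2 * n. cos (pi * real j * of_int l / real n) * cos (pi * real j * of_int l' / real n))
      = (\<Sum>j<2 * n. (cos (pi * real j * of_int (l - l') / real n)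
                      + cos (pi * real j * of_int (l + l') / real n)) / 2)"
    by (intro sum.cong refl) (simp add: cos_times_cos diff_divide_distrib add_divide_distrib algebra_simps)
  also have "\<dots> = ((\<Sum>j<2 * n. cos (pi * real j * of_int (l - l') / real n))
                      + (\<Sum>j<2 * n. cos (pi * real j * of_int (l + l') / real n))) / 2"
    by (simp add: sum_divide_distrib sum.distrib add_divide_distrib)
  also have "\<dots> = real n * ((if l' = l then 1 else 0) + (if l' = - l then 1 else 0))"
    using assms by (subst *; (subst *)?) (auto simp: algebra_simps)
  finally show ?thesis .
qed

section \<open>Diagonals of Toeplitz matrices and the symbol\<close>

lemma toeplitz_shift:
  assumes "toeplitz n M" "i + p < n" "k + p < n"
  shows "M (i + p) (k + p) = M i k"
  using assms(2,3)
proof (induction p)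
  case (Suc p)
  then have "M (Suc (i + p)) (Suc (k + p)) = M (i + p) (k + p)"
    using assms(1) by (auto simp: toeplitz_def)
  with Suc show ?case by simp
qed simp

lemma toeplitz_eq:
  assumes "toeplitz n M" "i < n" "k < n" "i' < n" "k' < n" "int i' - int k' = int i - int k"
  shows "M i' k' = M i k"
proof (cases "i \<le> i'")
  case True
  then have "i' = i + (i' - i)" "k' = k + (i' - i)" using assms(6) by auto
  then show ?thesis using toeplitz_shift[OF assms(1), of i "i' - i" k] assms by metis
next
  case False
  then have "i = i' + (i - i')" "k = k' + (i - i')" using assms(6) by auto
  then show ?thesis using toeplitz_shift[OF assms(1), of i' "i - i'" k'] assms by metis
qed

lemma card_diagonal:
  assumes "\<bar>l\<bar> < int n"
  shows "real (card {(i, k). i < n \<and> k < n \<and> int i - int k = l}) = real n - \<bar>real_of_int l\<bar>"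
proof (cases "0 \<le> l")
  case True
  define d where "d = nat l"
  have l: "l = int d" using True by (simp add: d_def)
  have "{(i, k). i < n \<and> k < n \<and> int i - int k = l} = (\<lambda>p. (p + d, p)) ` {..<n - d}"
    by (auto simp: l image_iff)
  moreover have "inj_on (\<lambda>p. (p + d, p)) {..<n - d}" by (auto simp: inj_on_def)
  ultimately show ?thesis using assms by (simp add: card_image l)
next
  case False
  define d where "d = nat (- l)"
  have l: "l = - int d" using False by (simp add: d_def)
  have "{(i, k). i < n \<and> k < n \<and> int i - int k = l} = (\<lambda>p. (p, p + d)) ` {..<n - d}"
    by (auto simp: l image_iff)
  moreover have "inj_on (\<lambda>p. (p, p + d)) {..<n - d}" by (auto simp: inj_on_def)
  ultimately show ?thesis using assms by (simp add: card_image l)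
qed

lemma toeplitz_diagonal_sum:
  assumes "toeplitz n M" "i < n" "k < n"
  shows "(\<Sum>i'<n. \<Sum>k'<n. if int i' - int k' = int i - int k then M i' k' else 0)
       = (real n - \<bar>real i - real k\<bar>) * M i k"
proof -
  let ?S = "{(i', k'). i' < n \<and> k' < n \<and> int i' - int k' = int i - int k}"
  have "(\<Sum>i'<n. \<Sum>k'<n. if int i' - int k' = int i - int k then M i' k' else 0)
      = (\<Sum>(i', k')\<in>{..<n} \<times> {..<n}. if int i' - int k' = int i - int k then M i k else 0)"
    unfolding sum.cartesian_product
    using assms by (intro sum.cong refl) (auto intro: toeplitz_eq[OF assms(1)])
  also have "\<dots> = (\<Sum>p\<in>{..<n} \<times> {..<n}. if p \<in> ?S then M i k else 0)"
    by (intro sum.cong refl) (simp add: case_prod_beta mem_Times_iff)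
  also have "\<dots> = (\<Sum>p\<in>{p \<in> {..<n} \<times> {..<n}. p \<in> ?S}. M i k)"
    by (rule sum.inter_filter[symmetric]) simp
  also have "{p \<in> {..<n} \<times> {..<n}. p \<in> ?S} = ?S" by auto
  also have "(\<Sum>p\<in>?S. M i k) = real (card ?S) * M i k" by simp
  also have "real (card ?S) = real n - \<bar>real_of_int (int i - int k)\<bar>"
    using assms by (intro card_diagonal) auto
  finally show ?thesis by simp
qed

definition qform :: "nat \<Rightarrow> (nat \<Rightarrow> nat \<Rightarrow> real) \<Rightarrow> (nat \<Rightarrow> real) \<Rightarrow> real" where
  "qform n M x = (\<Sum>i<n. \<Sum>j<n. x i * M i j * x j)"

text \<open>The Frobenius pairing with the cosine matrix of frequency pi j / n, so each diagonal of
  a Toeplitz matrix counts with its length. The absolute sum of these values is the surrogate of the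
  nuclear norm.\<close>

definition symbol_test :: "nat \<Rightarrow> (nat \<Rightarrow> nat \<Rightarrow> real) \<Rightarrow> nat \<Rightarrow> real" where
  "symbol_test n M j = (\<Sum>i<n. \<Sum>k<n. M i k * cos (pi * real j * (real i - real k) / real n))"

text \<open>The orthogonal projection of \<open>a a\<^sup>T\<close> onto Toeplitz matrices has the average of \<open>a\<^sub>i a\<^sub>k\<close> along
  each diagonal as entries; this is its symbol at the frequency \<open>\<pi> j / n\<close>.\<close>

definition autocorr :: "nat \<Rightarrow> nat \<Rightarrow> (nat \<Rightarrow> real) \<Rightarrow> real" where
  "autocorr n j a = (\<Sum>i<n. \<Sum>k<n. a i * a k *
     (cos (pi * real j * (real i - real k) / real n) / (real n - \<bar>real i - real k\<bar>)))"

text \<open>Cosine orthogonality and the symmetry of \<open>M\<close> turn the sum over j into 2 n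
  (n - |i - k|) M i k, and the weight inside \<open>autocorr\<close> removes the diagonal length.
  The form becomes a combination of 2 n fixed functions of \<open>a\<close> with coefficients
  depending only on \<open>M\<close>, the shape that Maurey's method requires.\<close>

lemma qform_toeplitz_eq:
  assumes "0 < n" "toeplitz n M" "sym_matrix n M"
  shows "qform n M a = (\<Sum>j<2 * n. symbol_test n M j / (2 * real n) * autocorr n j a)"
proof -
  let ?c = "\<lambda>j i k. cos (pi * real j * (real i - real k) / real n)"
  have inner: "(\<Sum>j<2 * n. symbol_test n M j * ?c j i k) = 2 * real n * ((real n - \<bar>real i - real k\<bar>) * M i k)"
    if "i < n" "k < n" for i k
  proof -
    have "(\<Sum>j<2 * n. symbol_test n M j * ?c j i k)
        = (\<Sum>j<2 * n. \<Sum>i'<n. \<Sum>k'<n. M i' k' * (?c j i k * ?c j i' k'))"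
      by (simp add: symbol_test_def sum_distrib_right sum_distrib_left mult_ac)
    also have "\<dots> = (\<Sum>i'<n. \<Sum>k'<n. \<Sum>j<2 * n. M i' k' * (?c j i k * ?c j i' k'))"
      by (rule sum_swap3)
    also have "\<dots> = (\<Sum>i'<n. \<Sum>k'<n. M i' k' * (real n * ((if int i' - int k' = int i - int k then 1 else 0)
        + (if int i' - int k' = int k - int i then 1 else 0))))"
    proof (intro sum.cong refl)
      fix i' k' assume "i' \<in> {..<n}" "k' \<in> {..<n}"
      then show "(\<Sum>j<2 * n. M i' k' * (?c j i k * ?c j i' k')) = M i' k' * (real n *
        ((if int i' - int k' = int i - int k then 1 else 0) + (if int i' - int k' = int k - int i then 1 else 0)))"
        using sum_cos_mult_cos[of n "int i - int k" "int i' - int k'"] assms(1) that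
        by (simp add: sum_distrib_left[symmetric])
    qed
    also have "\<dots> = real n * ((\<Sum>i'<n. \<Sum>k'<n. if int i' - int k' = int i - int k then M i' k' else 0)
        + (\<Sum>i'<n. \<Sum>k'<n. if int i' - int k' = int k - int i then M i' k' else 0))"
      unfolding sum.distrib[symmetric] sum_distrib_left by (intro sum.cong refl) auto
    also have "\<dots> = real n * ((real n - \<bar>real i - real k\<bar>) * M i k + (real n - \<bar>real k - real i\<bar>) * M k i)"
      using that by (simp add: toeplitz_diagonal_sum[OF assms(2)])
    also have "M k i = M i k" using assms(3) that by (simp add: sym_matrix_def)
    finally show ?thesis by (simp add: abs_minus_commute algebra_simps)
  qed
  have "(\<Sum>j<2 * n. symbol_test n M j / (2 * real n) * autocorr n j a)
      = (\<Sum>j<2 * n. \<Sum>i<n. \<Sum>k<n. a i * a k / (real n - \<bar>real i - real k\<bar>) / (2 * real n)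
           * (symbol_test n M j * ?c j i k))"
    by (simp add: autocorr_def sum_distrib_left mult_ac)
  also have "\<dots> = (\<Sum>i<n. \<Sum>k<n. \<Sum>j<2 * n. a i * a k / (real n - \<bar>real i - real k\<bar>) / (2 * real n)
           * (symbol_test n M j * ?c j i k))"
    by (rule sum_swap3)
  also have "\<dots> = (\<Sum>i<n. \<Sum>k<n. a i * M i k * a k)"
  proof (intro sum.cong refl)
    fix i k assume "i \<in> {..<n}" "k \<in> {..<n}"
    then have ik: "i < n" "k < n" and "real n - \<bar>real i - real k\<bar> \<noteq> 0" by auto
    then show "(\<Sum>j<2 * n. a i * a k / (real n - \<bar>real i - real k\<bar>) / (2 * real n)
           * (symbol_test n M j * ?c j i k)) = a i * M i k * a k"
      unfolding sum_distrib_left[symmetric] inner[OF ik] using assms(1) by simp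
  qed
  finally show ?thesis by (simp add: qform_def)
qed

section \<open>A real Fourier frame\<close>

definition freq_vec :: "nat \<Rightarrow> nat \<times> bool \<Rightarrow> nat \<Rightarrow> real" where
  "freq_vec n \<alpha> i = (if snd \<alpha> then cos (pi * real (fst \<alpha>) * real i / real n)
                     else sin (pi * real (fst \<alpha>) * real i / real n))"

definition freqs :: "nat \<Rightarrow> (nat \<times> bool) set" where
  "freqs n = {..<2 * n} \<times> UNIV"

lemma finite_freqs [simp]: "finite (freqs n)"
  by (simp add: freqs_def)

lemma sum_freqs: "(\<Sum>\<alpha>\<in>freqs n. f \<alpha>) = (\<Sum>j<2 * n. f (j, True) + f (j, False))"
  by (simp add: freqs_def sum.cartesian_product' UNIV_bool add.commute)

text \<open>The addition formula merges the cosine and the sine vector of one frequency, so the 4 n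
  vectors form a tight frame with constant 2 n. Real vectors stand in for complex exponentials,
  which keeps all quadratic forms real.\<close>

lemma freq_vec_frame:
  assumes "i < n" "k < n"
  shows "(\<Sum>\<alpha>\<in>freqs n. freq_vec n \<alpha> i * freq_vec n \<alpha> k) = (if i = k then 2 * real n else 0)"
  using sum_cos_diff[OF assms]
  by (simp add: sum_freqs freq_vec_def cos_diff[symmetric] diff_divide_distrib[symmetric] right_diff_distrib[symmetric])

lemma freq_vec_parseval:
  "(\<Sum>\<alpha>\<in>freqs n. (\<Sum>i<n. v i * freq_vec n \<alpha> i)\<^sup>2) = 2 * real n * (\<Sum>i<n. (v i)\<^sup>2)"
proof -
  have "(\<Sum>\<alpha>\<in>freqs n. (\<Sum>i<n. v i * freq_vec n \<alpha> i)\<^sup>2)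
      = (\<Sum>\<alpha>\<in>freqs n. \<Sum>i<n. \<Sum>k<n. v i * v k * (freq_vec n \<alpha> i * freq_vec n \<alpha> k))"
    by (simp add: power2_eq_square sum_product mult_ac)
  also have "\<dots> = (\<Sum>i<n. \<Sum>k<n. v i * v k * (\<Sum>\<alpha>\<in>freqs n. freq_vec n \<alpha> i * freq_vec n \<alpha> k))"
    unfolding sum_distrib_left by (rule sum_swap3)
  also have "\<dots> = (\<Sum>i<n. \<Sum>k<n. if i = k then 2 * real n * (v i)\<^sup>2 else 0)"
    by (intro sum.cong refl) (simp add: freq_vec_frame power2_eq_square)
  also have "\<dots> = 2 * real n * (\<Sum>i<n. (v i)\<^sup>2)" by (simp add: sum_distrib_left)
  finally show ?thesis .
qed

lemma sum_qform_freq_vec: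
  "(\<Sum>\<alpha>\<in>freqs n. qform n M (freq_vec n \<alpha>)) = 2 * real n * mtrace n M"
proof -
  have "(\<Sum>\<alpha>\<in>freqs n. qform n M (freq_vec n \<alpha>))
      = (\<Sum>\<alpha>\<in>freqs n. \<Sum>i<n. \<Sum>k<n. M i k * (freq_vec n \<alpha> i * freq_vec n \<alpha> k))"
    by (simp add: qform_def mult_ac)
  also have "\<dots> = (\<Sum>i<n. \<Sum>k<n. M i k * (\<Sum>\<alpha>\<in>freqs n. freq_vec n \<alpha> i * freq_vec n \<alpha> k))"
    unfolding sum_distrib_left by (rule sum_swap3)
  also have "\<dots> = (\<Sum>i<n. \<Sum>k<n. if i = k then 2 * real n * M i i else 0)"
    by (intro sum.cong refl) (simp add: freq_vec_frame)
  finally show ?thesis by (simp add: mtrace_def sum_distrib_left)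
qed

text \<open>The cosine matrix is the sum of the two rank-one matrices of the cosine and the sine
  vector; hence a bound on the forms at the frame vectors is a bound on the symbol.\<close>

lemma symbol_test_eq_qform:
  "symbol_test n M j = qform n M (freq_vec n (j, True)) + qform n M (freq_vec n (j, False))"
proof -
  have "cos (pi * real j * (real i - real k) / real n)
      = freq_vec n (j, True) i * freq_vec n (j, True) k + freq_vec n (j, False) i * freq_vec n (j, False) k" for i k
    by (simp add: freq_vec_def right_diff_distrib diff_divide_distrib cos_diff)
  then show ?thesis
    unfolding symbol_test_def qform_def sum.distrib[symmetric]
    by (intro sum.cong refl) (simp add: algebra_simps)
qed

section \<open>The cone inequality for the error matrix\<close>

lemma sum_mult_le_sqrt:
  fixes f g :: "'a \<Rightarrow> real"
  shows "(\<Sum>x\<in>A. \<bar>f x * g x\<bar>) \<le> sqrt (\<Sum>x\<in>A. (f x)\<^sup>2) * sqrt (\<Sum>x\<in>A. (g x)\<^sup>2)"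
  using Cauchy_Schwarz_ineq_sum[of "\<lambda>x. \<bar>f x\<bar>" "\<lambda>x. \<bar>g x\<bar>" A]
  by (simp add: abs_mult real_le_rsqrt real_sqrt_mult[symmetric])

lemma abs_sum_inner_le:
  fixes f g :: "'a \<Rightarrow> 'b \<Rightarrow> real"
  assumes "finite B"
  shows "(\<Sum>x\<in>A. \<bar>\<Sum>y\<in>B. f x y * g x y\<bar>)
       \<le> sqrt (\<Sum>x\<in>A. \<Sum>y\<in>B. (f x y)\<^sup>2) * sqrt (\<Sum>x\<in>A. \<Sum>y\<in>B. (g x y)\<^sup>2)"
proof -
  have "(\<Sum>x\<in>A. \<bar>\<Sum>y\<in>B. f x y * g x y\<bar>) \<le> (\<Sum>x\<in>A. \<Sum>y\<in>B. \<bar>f x y * g x y\<bar>)"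
    by (intro sum_mono) auto
  also have "\<dots> = (\<Sum>(x, y)\<in>A \<times> B. \<bar>f x y * g x y\<bar>)" by (simp add: sum.cartesian_product)
  also have "\<dots> \<le> sqrt (\<Sum>(x, y)\<in>A \<times> B. (f x y)\<^sup>2) * sqrt (\<Sum>(x, y)\<in>A \<times> B. (g x y)\<^sup>2)"
    using sum_mult_le_sqrt[of "\<lambda>(x, y). f x y" "\<lambda>(x, y). g x y" "A \<times> B"]
    by (simp add: case_prod_beta')
  finally show ?thesis by (simp add: sum.cartesian_product)
qed

text \<open>\<open>P\<close> stands for the orthogonal projection onto the range of \<open>\<Sigma>\<close>. On the complement of that range
  \<open>H\<close> agrees with the psd matrix \<open>Sh\<close>, so a negative value of the form at a frequency vector \<open>f\<close> is
  controlled by \<open>P f\<close>; summing with Parseval costs only \<open>\<parallel>P\<parallel>\<^sub>F\<close>, the square root of the rank.\<close>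

lemma sum_qform_freq_vec_cone:
  fixes \<Sigma> Sh P :: "nat \<Rightarrow> nat \<Rightarrow> real"
  assumes sym: "sym_matrix n \<Sigma>" and psd: "psd n Sh"
    and tr: "mtrace n Sh \<le> mtrace n \<Sigma>"
    and Psym: "\<And>i k. P i k = P k i"
    and Pnorm: "(\<Sum>i<n. \<Sum>k<n. (P i k)\<^sup>2) \<le> real r"
    and Pid: "\<And>i j. i < n \<Longrightarrow> j < n \<Longrightarrow> (\<Sum>k<n. P i k * \<Sigma> k j) = \<Sigma> i j"
    and Pcontr: "\<And>v. (\<Sum>k<n. (\<Sum>i<n. v i * P i k)\<^sup>2) \<le> (\<Sum>i<n. (v i)\<^sup>2)"
  defines "H \<equiv> \<lambda>i j. Sh i j - \<Sigma> i j"
  shows "(\<Sum>\<alpha>\<in>freqs n. \<bar>qform n H (freq_vec n \<alpha>)\<bar>) \<le> 2 * real n * (6 * sqrt (real r) * frob_norm n H)"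
proof -
  have Hsym: "H i j = H j i" if "i < n" "j < n" for i j
    using sym psd that by (simp add: H_def sym_matrix_def psd_def)
  define u where "u \<alpha> i = (\<Sum>k<n. P i k * freq_vec n \<alpha> k)" for \<alpha> i
  define w where "w \<alpha> i = (\<Sum>k<n. H i k * freq_vec n \<alpha> k)" for \<alpha> i
  define HP where "HP i k = (\<Sum>l<n. H i l * P l k)" for i k
  define z where "z \<alpha> i = (\<Sum>k<n. HP i k * freq_vec n \<alpha> k)" for \<alpha> i
  have pt: "\<bar>qform n H (freq_vec n \<alpha>)\<bar> \<le> qform n H (freq_vec n \<alpha>)
      + 2 * (2 * \<bar>\<Sum>i<n. u \<alpha> i * w \<alpha> i\<bar> + \<bar>\<Sum>i<n. u \<alpha> i * z \<alpha> i\<bar>)" for \<alpha>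
  proof -
    let ?f = "freq_vec n \<alpha>"
    define g where "g i = ?f i - u \<alpha> i" for i
    have z: "z \<alpha> i = (\<Sum>l<n. H i l * u \<alpha> l)" for i
      unfolding z_def HP_def u_def sum_distrib_left sum_distrib_right
      by (subst sum.swap) (simp add: mult_ac)
    \<comment> \<open>\<open>P\<close> is symmetric and fixes the columns of \<Sigma>, which is
      symmetric too; so \<Sigma> P = \<Sigma> and g = f - P f lies in the kernel of
      \<Sigma>.\<close>
    have Sg: "(\<Sum>j<n. \<Sigma> i j * g j) = 0" if "i < n" for i
    proof -
      have "(\<Sum>j<n. \<Sigma> i j * u \<alpha> j) = (\<Sum>j<n. \<Sum>k<n. \<Sigma> i j * P j k * ?f k)"
        by (simp add: u_def sum_distrib_left mult_ac)
      also have "\<dots> = (\<Sum>k<n. (\<Sum>j<n. P k j * \<Sigma> j i) * ?f k)"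
        unfolding sum_distrib_right using sym that
        by (subst sum.swap) (intro sum.cong refl, simp add: sym_matrix_def Psym mult_ac)
      also have "\<dots> = (\<Sum>k<n. \<Sigma> i k * ?f k)"
        using sym that by (intro sum.cong refl) (simp add: Pid sym_matrix_def)
      finally show ?thesis by (simp add: g_def right_diff_distrib sum_subtractf)
    qed
    have "qform n \<Sigma> g = (\<Sum>i<n. g i * (\<Sum>j<n. \<Sigma> i j * g j))"
      by (simp add: qform_def sum_distrib_left mult_ac)
    also have "\<dots> = 0" by (simp add: Sg)
    finally have "qform n H g = qform n Sh g"
      by (simp add: qform_def H_def algebra_simps sum_subtractf)
    then have pos: "0 \<le> qform n H g" using psd by (simp add: psd_def qform_def)
    have "(\<Sum>i<n. \<Sum>j<n. ?f i * H i j * u \<alpha> j) = (\<Sum>i<n. \<Sum>j<n. u \<alpha> i * H i j * ?f j)"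
      by (subst sum.swap) (intro sum.cong refl, simp add: Hsym mult_ac)
    then have "qform n H g = qform n H ?f - 2 * (\<Sum>i<n. \<Sum>j<n. u \<alpha> i * H i j * ?f j)
        + (\<Sum>i<n. \<Sum>j<n. u \<alpha> i * H i j * u \<alpha> j)"
      by (simp add: qform_def g_def algebra_simps sum_subtractf sum.distrib)
    also have "(\<Sum>i<n. \<Sum>j<n. u \<alpha> i * H i j * ?f j) = (\<Sum>i<n. u \<alpha> i * w \<alpha> i)"
      by (simp add: w_def sum_distrib_left mult_ac)
    also have "(\<Sum>i<n. \<Sum>j<n. u \<alpha> i * H i j * u \<alpha> j) = (\<Sum>i<n. u \<alpha> i * z \<alpha> i)"
      by (simp add: z sum_distrib_left mult_ac)
    finally have "0 \<le> qform n H ?f - 2 * (\<Sum>i<n. u \<alpha> i * w \<alpha> i) + (\<Sum>i<n. u \<alpha> i * z \<alpha> i)"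
      using pos by simp
    \<comment> \<open>Here |q| is q plus twice its negative part, and that part is at most 2 |b| +
      |c|. Three inner products, doubled, are the origin of the factor 6.\<close>
    moreover have "\<bar>q\<bar> \<le> q + 2 * (2 * \<bar>b\<bar> + \<bar>c\<bar>)" if "0 \<le> q - 2 * b + c" for q b c :: real
      using that by (auto simp: abs_if)
    ultimately show ?thesis by blast
  qed
  have "(\<Sum>\<alpha>\<in>freqs n. \<bar>qform n H (freq_vec n \<alpha>)\<bar>)
      \<le> (\<Sum>\<alpha>\<in>freqs n. qform n H (freq_vec n \<alpha>))
        + 2 * (2 * (\<Sum>\<alpha>\<in>freqs n. \<bar>\<Sum>i<n. u \<alpha> i * w \<alpha> i\<bar>) + (\<Sum>\<alpha>\<in>freqs n. \<bar>\<Sum>i<n. u \<alpha> i * z \<alpha> i\<bar>))"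
    unfolding sum_distrib_left sum.distrib[symmetric] by (intro sum_mono pt)
  \<comment> \<open>The frame sums the signed forms to 2 n times the trace, which optimality makes
    nonpositive; only the bounds on the negative parts remain.\<close>
  moreover have "mtrace n H \<le> 0" using tr by (simp add: mtrace_def H_def sum_subtractf)
  then have "(\<Sum>\<alpha>\<in>freqs n. qform n H (freq_vec n \<alpha>)) \<le> 0"
    by (simp add: sum_qform_freq_vec mult_nonneg_nonpos)
  moreover
  let ?F = "\<Sum>i<n. \<Sum>k<n. (H i k)\<^sup>2"
  have parseval: "(\<Sum>\<alpha>\<in>freqs n. \<Sum>i<n. (\<Sum>k<n. M i k * freq_vec n \<alpha> k)\<^sup>2)
      = 2 * real n * (\<Sum>i<n. \<Sum>k<n. (M i k)\<^sup>2)" for M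
    by (subst sum.swap) (simp add: freq_vec_parseval sum_distrib_left)
  have u: "(\<Sum>\<alpha>\<in>freqs n. \<Sum>i<n. (u \<alpha> i)\<^sup>2) \<le> 2 * real n * real r"
    unfolding u_def parseval using Pnorm by (intro mult_left_mono) auto
  have w: "(\<Sum>\<alpha>\<in>freqs n. \<Sum>i<n. (w \<alpha> i)\<^sup>2) \<le> 2 * real n * ?F"
    unfolding w_def parseval ..
  \<comment> \<open>A row of \<open>HP\<close> is a row of \<open>H\<close> multiplied by the
    projection, which does not increase its length.\<close>
  have z: "(\<Sum>\<alpha>\<in>freqs n. \<Sum>i<n. (z \<alpha> i)\<^sup>2) \<le> 2 * real n * ?F"
    unfolding z_def parseval HP_def by (intro mult_left_mono sum_mono Pcontr) auto
  have bound: "(\<Sum>\<alpha>\<in>freqs n. \<bar>\<Sum>i<n. u \<alpha> i * y \<alpha> i\<bar>) \<le> 2 * real n * (sqrt (real r) * sqrt ?F)"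
    if "(\<Sum>\<alpha>\<in>freqs n. \<Sum>i<n. (y \<alpha> i)\<^sup>2) \<le> 2 * real n * ?F" for y
  proof -
    have "(\<Sum>\<alpha>\<in>freqs n. \<bar>\<Sum>i<n. u \<alpha> i * y \<alpha> i\<bar>)
        \<le> sqrt (\<Sum>\<alpha>\<in>freqs n. \<Sum>i<n. (u \<alpha> i)\<^sup>2) * sqrt (\<Sum>\<alpha>\<in>freqs n. \<Sum>i<n. (y \<alpha> i)\<^sup>2)"
      by (rule abs_sum_inner_le) simp
    also have "\<dots> \<le> sqrt (2 * real n * real r) * sqrt (2 * real n * ?F)"
      using u that by (intro mult_mono real_sqrt_le_mono) (auto intro!: sum_nonneg)
    also have "\<dots> = (sqrt (2 * real n) * sqrt (2 * real n)) * (sqrt (real r) * sqrt ?F)"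
      by (simp only: real_sqrt_mult mult_ac)
    finally show ?thesis by simp
  qed
  ultimately show ?thesis
    using bound[OF w] bound[OF z] by (simp add: frob_norm_def algebra_simps)
qed

subsection \<open>Projection onto the range of a low-rank matrix\<close>

lemma sum_mult_sum_orthonormal:
  fixes e :: "nat \<Rightarrow> nat \<Rightarrow> real"
  assumes orth: "\<And>p q. p < d \<Longrightarrow> q < d \<Longrightarrow> (\<Sum>i<n. e p i * e q i) = (if p = q then 1 else 0)"
  shows "(\<Sum>i<n. (\<Sum>p<d. b p * e p i) * (\<Sum>q<d. c q * e q i)) = (\<Sum>p<d. b p * c p)"
proof -
  have "(\<Sum>i<n. (\<Sum>p<d. b p * e p i) * (\<Sum>q<d. c q * e q i))
      = (\<Sum>i<n. \<Sum>p<d. \<Sum>q<d. b p * c q * (e p i * e q i))"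
    by (simp add: sum_product mult_ac)
  also have "\<dots> = (\<Sum>p<d. \<Sum>q<d. b p * c q * (\<Sum>i<n. e p i * e q i))"
    unfolding sum_distrib_left by (rule sum_swap3)
  also have "\<dots> = (\<Sum>p<d. \<Sum>q<d. if p = q then b p * c p else 0)"
    by (intro sum.cong refl) (simp add: orth)
  finally show ?thesis by simp
qed

text \<open>The squared Frobenius norm of an orthogonal projection is its trace, hence its dimension
  d. The last claim is Bessel's inequality, read off from the nonnegativity of |v - P v|^2.\<close>

lemma orthonormal_projection:
  fixes e :: "nat \<Rightarrow> nat \<Rightarrow> real"
  assumes orth: "\<And>p q. p < d \<Longrightarrow> q < d \<Longrightarrow> (\<Sum>i<n. e p i * e q i) = (if p = q then 1 else 0)"
  defines "P \<equiv> \<lambda>i k. \<Sum>p<d. e p i * e p k"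
  shows "(\<Sum>i<n. \<Sum>k<n. (P i k)\<^sup>2) = real d"
    and "(\<Sum>k<n. P i k * (\<Sum>p<d. c p * e p k)) = (\<Sum>p<d. c p * e p i)"
    and "(\<Sum>k<n. (\<Sum>i<n. v i * P i k)\<^sup>2) \<le> (\<Sum>i<n. (v i)\<^sup>2)"
proof -
  have inner: "(\<Sum>i<n. (\<Sum>p<d. b p * e p i) * (\<Sum>q<d. c q * e q i)) = (\<Sum>p<d. b p * c p)" for b c
    using orth by (rule sum_mult_sum_orthonormal)
  show "(\<Sum>k<n. P i k * (\<Sum>p<d. c p * e p k)) = (\<Sum>p<d. c p * e p i)" for i c
    using inner[of "\<lambda>p. e p i" c] by (simp add: P_def mult_ac)
  have "(\<Sum>k<n. (P i k)\<^sup>2) = (\<Sum>p<d. e p i * e p i)" for i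
    using inner[of "\<lambda>p. e p i" "\<lambda>p. e p i"] by (simp add: P_def power2_eq_square)
  then have "(\<Sum>i<n. \<Sum>k<n. (P i k)\<^sup>2) = (\<Sum>p<d. \<Sum>i<n. e p i * e p i)"
    by (simp add: sum.swap[of _ "{..<d}"])
  then show "(\<Sum>i<n. \<Sum>k<n. (P i k)\<^sup>2) = real d" by (simp add: orth)
  define c where "c p = (\<Sum>i<n. v i * e p i)" for p
  have vP: "(\<Sum>i<n. v i * P i k) = (\<Sum>p<d. c p * e p k)" for k
    unfolding P_def c_def sum_distrib_left sum_distrib_right
    by (subst sum.swap) (simp add: mult_ac)
  have sq: "(\<Sum>k<n. (\<Sum>p<d. c p * e p k)\<^sup>2) = (\<Sum>p<d. (c p)\<^sup>2)"
    using inner[of c c] by (simp add: power2_eq_square)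
  have cross: "(\<Sum>k<n. v k * (\<Sum>p<d. c p * e p k)) = (\<Sum>p<d. (c p)\<^sup>2)"
    unfolding sum_distrib_left
    by (subst sum.swap) (simp add: c_def power2_eq_square sum_distrib_left mult_ac)
  have "0 \<le> (\<Sum>k<n. (v k - (\<Sum>p<d. c p * e p k))\<^sup>2)" by (intro sum_nonneg) simp
  also have "\<dots> = (\<Sum>k<n. (v k)\<^sup>2) - 2 * (\<Sum>k<n. v k * (\<Sum>p<d. c p * e p k)) + (\<Sum>k<n. (\<Sum>p<d. c p * e p k)\<^sup>2)"
    by (simp add: power2_diff sum.distrib sum_subtractf sum_distrib_left mult_ac)
  finally show "(\<Sum>k<n. (\<Sum>i<n. v i * P i k)\<^sup>2) \<le> (\<Sum>i<n. (v i)\<^sup>2)"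
    by (simp add: vP sq cross)
qed

text \<open>A maximal independent set of columns has as many elements as the rank and spans all
  columns, and Gram-Schmidt keeps the span. The vectors are not normalised; that they are nonzero is
  the case p = q of the equivalence.\<close>

lemma orthogonal_basis_columns:
  fixes \<Sigma> :: "nat \<Rightarrow> nat \<Rightarrow> real"
  obtains us :: "real vec list" and c :: "nat \<Rightarrow> nat \<Rightarrow> real"
  where "length us = mrank n \<Sigma>"
    and "\<And>p. p < length us \<Longrightarrow> dim_vec (us ! p) = n"
    and "\<And>p q. p < length us \<Longrightarrow> q < length us \<Longrightarrow> (scalar_prod (us ! p) (us ! q) = 0) = (p \<noteq> q)"
    and "\<And>i j. i < n \<Longrightarrow> j < n \<Longrightarrow> \<Sigma> i j = (\<Sum>p<length us. c j p * us ! p $ i)"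
proof -
  interpret cof_vec_space n "TYPE(real)" .
  let ?A = "to_mat n \<Sigma>"
  have A: "?A \<in> carrier_mat n n" by (simp add: to_mat_def)
  have colsA: "set (cols ?A) \<subseteq> carrier_vec n" using cols_dim[of ?A] A by simp
  obtain S where S: "maximal S (\<lambda>T. T \<subseteq> set (cols ?A) \<and> lin_indpt T)" "finite S"
    using maximal_exists_superset[of "set (cols ?A)" "\<lambda>T. T \<subseteq> set (cols ?A) \<and> lin_indpt T" "{}"]
    by (auto simp: lin_dep_def)
  have SA: "S \<subseteq> set (cols ?A)" and Sind: "lin_indpt S" using S by (auto simp: maximal_def)
  have card: "rank ?A = card S" using rank_card_indpt[OF A S(1)] .
  have Scarr: "S \<subseteq> carrier_vec n" using SA colsA by blast
  have span: "s \<in> span S" if s: "s \<in> set (cols ?A)" for s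
  proof (rule ccontr)
    assume ns: "s \<notin> span S"
    have "s \<in> carrier_vec n" using s colsA by blast
    then have "lin_indpt (S \<union> {s})"
      using lin_dep_iff_in_span[OF Scarr Sind] ns span_mem[OF Scarr] by auto
    then have "S \<union> {s} \<subseteq> S"
      using S(1) s SA unfolding maximal_def by blast
    then show False using ns span_mem[OF Scarr] by auto
  qed
  obtain ws where ws: "set ws = S" "distinct ws" using finite_distinct_list[OF S(2)] by blast
  define us where "us = gram_schmidt n ws"
  note gs = gram_schmidt_result[of ws us, unfolded ws(1), OF Scarr ws(2) Sind us_def]
  have len: "length us = mrank n \<Sigma>"
    using gs(4) ws card distinct_card[of ws] by (simp add: mrank_def)
  have uscarr: "us ! p \<in> carrier_vec n" if "p < length us" for p
    using gs(3) that by auto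
  have dims: "dim_vec (us ! p) = n" if "p < length us" for p
    using uscarr[OF that] by simp
  have conj_id: "conjugate v = v" for v :: "real vec" by (intro eq_vecI) auto
  have orth: "(scalar_prod (us ! p) (us ! q) = 0) = (p \<noteq> q)" if "p < length us" "q < length us" for p q
    using corthogonalD[OF gs(2) that] by (simp add: conj_id)
  have "\<exists>c. \<forall>i<n. \<Sigma> i j = (\<Sum>p<length us. c p * us ! p $ i)" if j: "j < n" for j
  proof -
    have "col ?A j \<in> set (cols ?A)" using A j by (auto simp: cols_def)
    then have "col ?A j \<in> span (set us)" using span gs(1) by blast
    then obtain b where b: "col ?A j = lincomb b (set us)"
      using finite_in_span[OF finite_set gs(3)] by metis
    have "\<Sigma> i j = (\<Sum>p<length us. b (us ! p) * us ! p $ i)" if i: "i < n" for i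
    proof -
      have "\<Sigma> i j = col ?A j $ i" using i j by (simp add: to_mat_def)
      also have "\<dots> = (\<Sum>x\<in>set us. b x * x $ i)"
        unfolding b by (rule lincomb_index[OF i gs(3)])
      also have "\<dots> = (\<Sum>p<length us. b (us ! p) * us ! p $ i)"
        by (rule sum.reindex_bij_betw[symmetric])
           (use bij_betw_nth[OF gs(5) refl refl] in simp)
      finally show ?thesis .
    qed
    then show ?thesis by (intro exI[of _ "\<lambda>p. b (us ! p)"]) simp
  qed
  then obtain c where "\<And>i j. i < n \<Longrightarrow> j < n \<Longrightarrow> \<Sigma> i j = (\<Sum>p<length us. c j p * us ! p $ i)"
    by metis
  then show thesis using that[OF len dims orth] by blast
qed

lemma rank_projection:
  fixes \<Sigma> :: "nat \<Rightarrow> nat \<Rightarrow> real"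
  obtains P :: "nat \<Rightarrow> nat \<Rightarrow> real" where
    "\<And>i k. P i k = P k i"
    "(\<Sum>i<n. \<Sum>k<n. (P i k)\<^sup>2) = real (mrank n \<Sigma>)"
    "\<And>i j. i < n \<Longrightarrow> j < n \<Longrightarrow> (\<Sum>k<n. P i k * \<Sigma> k j) = \<Sigma> i j"
    "\<And>v. (\<Sum>k<n. (\<Sum>i<n. v i * P i k)\<^sup>2) \<le> (\<Sum>i<n. (v i)\<^sup>2)"
proof -
  obtain us c where len: "length us = mrank n \<Sigma>"
    and dims: "\<And>p. p < length us \<Longrightarrow> dim_vec (us ! p) = n"
    and us: "\<And>p q. p < length us \<Longrightarrow> q < length us \<Longrightarrow> (scalar_prod (us ! p) (us ! q) = 0) = (p \<noteq> q)"
    and c: "\<And>i j. i < n \<Longrightarrow> j < n \<Longrightarrow> \<Sigma> i j = (\<Sum>p<length us. c j p * us ! p $ i)"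
    using orthogonal_basis_columns by blast
  let ?d = "length us"
  have sp: "scalar_prod (us ! p) (us ! q) = (\<Sum>i<n. us ! p $ i * us ! q $ i)" if "q < ?d" for p q
    using that by (simp add: scalar_prod_def dims atLeast0LessThan)
  define N where "N p = sqrt (scalar_prod (us ! p) (us ! p))" for p
  have Npos: "N p > 0" and Nsq: "N p * N p = scalar_prod (us ! p) (us ! p)" if "p < ?d" for p
  proof -
    have "0 \<le> scalar_prod (us ! p) (us ! p)" unfolding sp[OF that] by (intro sum_nonneg) simp
    moreover have "scalar_prod (us ! p) (us ! p) \<noteq> 0" using us[OF that that] by simp
    ultimately show "N p > 0" "N p * N p = scalar_prod (us ! p) (us ! p)" by (simp_all add: N_def)
  qed
  define e where "e p i = us ! p $ i / N p" for p i
  have orth: "(\<Sum>i<n. e p i * e q i) = (if p = q then 1 else 0)" if "p < ?d" "q < ?d" for p q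
  proof -
    have "(\<Sum>i<n. e p i * e q i) = (scalar_prod (us ! p) (us ! q)) / (N p * N q)"
      using that by (simp add: e_def sp sum_divide_distrib)
    then show ?thesis using us[OF that] Nsq[OF that(1)] Npos[OF that(1)] by auto
  qed
  have \<Sigma>: "\<Sigma> k j = (\<Sum>p<?d. (c j p * N p) * e p k)" if "k < n" "j < n" for k j
    unfolding c[OF that] e_def using Npos by (intro sum.cong refl) (auto simp: less_imp_neq[THEN not_sym])
  let ?P = "\<lambda>i k. \<Sum>p<?d. e p i * e p k"
  show thesis
  proof (rule that[of ?P])
    show "(\<Sum>i<n. \<Sum>k<n. (?P i k)\<^sup>2) = real (mrank n \<Sigma>)"
      using orthonormal_projection(1)[of ?d e n, OF orth] len by simp
    show "(\<Sum>k<n. ?P i k * \<Sigma> k j) = \<Sigma> i j" if "i < n" "j < n" for i j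
      using orthonormal_projection(2)[of ?d e n i "\<lambda>p. c j p * N p", OF orth] that by (simp add: \<Sigma>)
    show "(\<Sum>k<n. (\<Sum>i<n. v i * ?P i k)\<^sup>2) \<le> (\<Sum>i<n. (v i)\<^sup>2)" for v
      using orthonormal_projection(3)[of ?d e n v, OF orth] by simp
  qed (simp add: mult.commute)
qed

lemma sum_abs_symbol_test_le:
  fixes \<Sigma> Sh :: "nat \<Rightarrow> nat \<Rightarrow> real"
  assumes "sym_matrix n \<Sigma>" "psd n Sh" "mtrace n Sh \<le> mtrace n \<Sigma>" "mrank n \<Sigma> \<le> r"
  defines "H \<equiv> \<lambda>i j. Sh i j - \<Sigma> i j"
  shows "(\<Sum>j<2 * n. \<bar>symbol_test n H j\<bar>) \<le> 2 * real n * (6 * sqrt (real r) * frob_norm n H)"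
proof -
  obtain P where P: "\<And>i k. P i k = P k i"
    "(\<Sum>i<n. \<Sum>k<n. (P i k)\<^sup>2) = real (mrank n \<Sigma>)"
    "\<And>i j. i < n \<Longrightarrow> j < n \<Longrightarrow> (\<Sum>k<n. P i k * \<Sigma> k j) = \<Sigma> i j"
    "\<And>v. (\<Sum>k<n. (\<Sum>i<n. v i * P i k)\<^sup>2) \<le> (\<Sum>i<n. (v i)\<^sup>2)"
    using rank_projection[of n \<Sigma>] by blast
  have "(\<Sum>j<2 * n. \<bar>symbol_test n H j\<bar>) \<le> (\<Sum>\<alpha>\<in>freqs n. \<bar>qform n H (freq_vec n \<alpha>)\<bar>)"
    unfolding sum_freqs symbol_test_eq_qform by (intro sum_mono abs_triangle_ineq)
  also have "\<dots> \<le> 2 * real n * (6 * sqrt (real r) * frob_norm n H)"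
    unfolding H_def using assms(4) P(2)
    by (intro sum_qform_freq_vec_cone[OF assms(1-3) P(1) _ P(3,4)]) auto
  finally show ?thesis .
qed

subsection \<open>Sub-Gaussian martingale tails\<close>

text \<open>Under a centred law the linear term integrates to 0 and only an exponential moment of
  the square is left. For u \<le> 1 the bound passes through 1 + u + u^2, for larger u through u
  \<le> u^2.\<close>

lemma exp_le_add_exp_square:
  fixes u :: real
  shows "exp u \<le> u + exp (u\<^sup>2)"
proof (cases "u \<le> 1")
  case True
  have "exp u \<le> 1 + u + u\<^sup>2"
  proof (cases "0 \<le> u")
    case True
    with \<open>u \<le> 1\<close> show ?thesis by (intro exp_bound) auto
  next
    case False
    define w where "w = - u"
    have w: "0 \<le> w" using False by (simp add: w_def)
    have q: "0 < 1 + w + w\<^sup>2 / 2" using w by (intro add_pos_nonneg) auto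
    have e: "1 + w + w\<^sup>2 / 2 \<le> exp w" using exp_lower_Taylor_quadratic[OF w] .
    have "exp u = 1 / exp w" by (simp add: w_def exp_minus field_simps)
    also have "\<dots> \<le> 1 / (1 + w + w\<^sup>2 / 2)" using e q by (intro divide_left_mono) auto
    also have "\<dots> \<le> 1 - w + w\<^sup>2"
    proof -
      have "(1 - w + w\<^sup>2) * (1 + w + w\<^sup>2 / 2) = 1 + w\<^sup>2 / 2 + w ^ 3 / 2 + w ^ 4 / 2"
        by (simp add: field_simps power2_eq_square power3_eq_cube power4_eq_xxxx)
      then have "1 \<le> (1 - w + w\<^sup>2) * (1 + w + w\<^sup>2 / 2)" using w by simp
      then show ?thesis using q by (simp add: divide_le_eq)
    qed
    finally show ?thesis by (simp add: w_def)
  qed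
  also have "\<dots> \<le> u + exp (u\<^sup>2)" using exp_ge_add_one_self[of "u\<^sup>2"] by linarith
  finally show ?thesis .
next
  case False
  then have "u * 1 \<le> u * u" by (intro mult_left_mono) auto
  then have "exp u \<le> exp (u\<^sup>2)" by (subst exp_le_cancel_iff) (simp add: power2_eq_square)
  with False show ?thesis by linarith
qed

lemma exp_mult_le_affine:
  fixes t \<theta> :: real
  assumes "0 \<le> \<theta>" "\<theta> \<le> 1"
  shows "exp (\<theta> * t) \<le> 1 + \<theta> * (exp t - 1)"
  using convex_onD[OF convex_on_exp[of 1], of \<theta> 0 t] assms by (simp add: algebra_simps)

locale unit_subgaussian = prob_space D for D :: "real measure" +
  fixes K :: real
  assumes sets_D [measurable_cong]: "sets D = sets borel"
    and K_pos: "0 < K"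
    and integrable_exp: "integrable D (\<lambda>x. exp (x\<^sup>2 / K\<^sup>2))"
    and integral_exp_le: "(\<integral>x. exp (x\<^sup>2 / K\<^sup>2) \<partial>D) \<le> 2"
    and integrable_id: "integrable D (\<lambda>x. x)" and mean_0: "(\<integral>x. x \<partial>D) = 0"
    and integrable_sq: "integrable D (\<lambda>x. x\<^sup>2)" and variance_1: "(\<integral>x. x\<^sup>2 \<partial>D) = 1"
    and integrable_4: "integrable D (\<lambda>x. x ^ 4)" and fourth_le: "(\<integral>x. x ^ 4 \<partial>D) \<le> 3"
begin

text \<open>For |s| K \<le> 1 the linear term drops by centring, and convexity scales the moment at
  K down to the factor \<theta> = (s K)^2. For larger s, completing the square gives s x \<le> x^2 /
  K^2 + (s K)^2 / 4, and the constant 2 is absorbed because exp (3/4) \<ge> 2.\<close>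

lemma mgf_le: "(\<integral>\<^sup>+x. exp (s * x) \<partial>D) \<le> exp (K\<^sup>2 * s\<^sup>2)"
proof (cases "(s * K)\<^sup>2 \<le> 1")
  case True
  define \<theta> where "\<theta> = (s * K)\<^sup>2"
  have th: "0 \<le> \<theta>" "\<theta> \<le> 1" using True by (auto simp: \<theta>_def)
  let ?g = "\<lambda>x. s * x + (1 + \<theta> * (exp (x\<^sup>2 / K\<^sup>2) - 1))"
  have g: "exp (s * x) \<le> ?g x" for x
  proof -
    have "exp (s * x) \<le> s * x + exp ((s * x)\<^sup>2)" by (rule exp_le_add_exp_square)
    also have "(s * x)\<^sup>2 = \<theta> * (x\<^sup>2 / K\<^sup>2)"
      using K_pos by (simp add: \<theta>_def power_mult_distrib)
    also have "exp (\<theta> * (x\<^sup>2 / K\<^sup>2)) \<le> 1 + \<theta> * (exp (x\<^sup>2 / K\<^sup>2) - 1)"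
      using th by (rule exp_mult_le_affine)
    finally show ?thesis by simp
  qed
  have g0: "0 \<le> ?g x" for x using g[of x] exp_ge_zero[of "s * x"] by linarith
  have gi: "integrable D ?g"
    using integrable_exp integrable_id by simp
  have "(\<integral>\<^sup>+x. exp (s * x) \<partial>D) \<le> (\<integral>\<^sup>+x. ?g x \<partial>D)"
    using g by (intro nn_integral_mono ennreal_leI)
  also have "\<dots> = ennreal (\<integral>x. ?g x \<partial>D)"
    using gi g0 by (intro nn_integral_eq_integral) auto
  also have "\<dots> \<le> ennreal (exp \<theta>)"
  proof (intro ennreal_leI)
    have "(\<integral>x. ?g x \<partial>D) = 1 + \<theta> * ((\<integral>x. exp (x\<^sup>2 / K\<^sup>2) \<partial>D) - 1)"
      using integrable_exp integrable_id by (simp add: mean_0 prob_space)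
    also have "\<dots> \<le> 1 + \<theta> * 1"
      using integral_exp_le th by (intro add_left_mono mult_left_mono) auto
    also have "\<dots> \<le> exp \<theta>" using exp_ge_add_one_self[of \<theta>] by simp
    finally show "(\<integral>x. ?g x \<partial>D) \<le> exp \<theta>" .
  qed
  finally show ?thesis by (simp add: \<theta>_def power_mult_distrib mult.commute)
next
  case False
  define y where "y = (s * K)\<^sup>2"
  have y: "1 \<le> y" using False by (simp add: y_def)
  let ?g = "\<lambda>x. exp (y / 4) * exp (x\<^sup>2 / K\<^sup>2)"
  have g: "exp (s * x) \<le> ?g x" for x
  proof -
    have "0 \<le> (x / K - s * K / 2)\<^sup>2" by simp
    also have "(x / K - s * K / 2)\<^sup>2 = x\<^sup>2 / K\<^sup>2 + y / 4 - s * x"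
      using K_pos by (simp add: y_def power2_diff power_mult_distrib power_divide)
    finally show ?thesis by (simp add: exp_add[symmetric])
  qed
  have "(\<integral>\<^sup>+x. exp (s * x) \<partial>D) \<le> (\<integral>\<^sup>+x. ?g x \<partial>D)"
    using g by (intro nn_integral_mono ennreal_leI)
  also have "\<dots> = ennreal (\<integral>x. ?g x \<partial>D)"
    using integrable_exp by (intro nn_integral_eq_integral) auto
  also have "\<dots> \<le> ennreal (exp (y / 4) * 2)"
    using integral_exp_le by (intro ennreal_leI) simp
  also have "\<dots> \<le> ennreal (exp (y / 4) * exp (3 * y / 4))"
  proof (intro ennreal_leI mult_left_mono)
    have "(2::real) \<le> 1 + 3 / 4 + (3 / 4)\<^sup>2 / 2" by (simp add: power2_eq_square)
    also have "\<dots> \<le> exp (3 / 4)" by (rule exp_lower_Taylor_quadratic) simp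
    also have "\<dots> \<le> exp (3 * y / 4)" using y by simp
    finally show "2 \<le> exp (3 * y / 4)" .
  qed simp
  also have "exp (y / 4) * exp (3 * y / 4) = exp y" by (simp add: exp_add[symmetric])
  finally show ?thesis by (simp add: y_def power_mult_distrib mult.commute)
qed

definition row_law :: "nat \<Rightarrow> (nat \<Rightarrow> real) measure" where
  "row_law n = PiM {..<n} (\<lambda>_. D)"

sublocale prod: product_sigma_finite "\<lambda>_ :: nat. D" ..

lemma prob_space_row_law: "prob_space (row_law n)"
  unfolding row_law_def by (intro prob_space_PiM prob_space_axioms)

lemma coord_measurable: "i < n \<Longrightarrow> (\<lambda>x. x i) \<in> borel_measurable (row_law n)"
  unfolding row_law_def using measurable_component_singleton[of i "{..<n}" "\<lambda>_. D"]
  by (simp add: measurable_cong_sets[OF refl sets_D])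

text \<open>Integrating out the last coordinate first is the induction step of the martingale and
  moment bounds below.\<close>

lemma nn_integral_row_law_Suc:
  assumes "f \<in> borel_measurable (row_law (Suc n))"
  shows "(\<integral>\<^sup>+x. f x \<partial>row_law (Suc n)) = (\<integral>\<^sup>+x. (\<integral>\<^sup>+y. f (x(n := y)) \<partial>D) \<partial>row_law n)"
  using prod.product_nn_integral_insert[of "{..<n}" n f] assms
  by (simp add: row_law_def lessThan_Suc)

text \<open>\<open>L k\<close> depends only on the coordinates below \<open>k\<close>, so \<open>x k * L k x\<close> is a martingale difference.\<close>

lemma martingale_exp_le_1:
  assumes meas: "\<And>k N. k \<le> N \<Longrightarrow> L k \<in> borel_measurable (row_law N)"
    and dep: "\<And>k x y. (\<And>i. i < k \<Longrightarrow> x i = y i) \<Longrightarrow> L k x = L k y"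
  shows "(\<integral>\<^sup>+x. exp (\<Sum>k<n. x k * L k x - K\<^sup>2 * (L k x)\<^sup>2) \<partial>row_law n) \<le> 1"
proof (induction n)
  case 0
  interpret R: prob_space "row_law 0" by (rule prob_space_row_law)
  show ?case by (simp add: R.emeasure_space_1)
next
  case (Suc n)
  let ?F = "\<lambda>n x. exp (\<Sum>k<n. x k * L k x - K\<^sup>2 * (L k x)\<^sup>2)"
  have [measurable]: "(\<lambda>x. \<Sum>k<Suc n. x k * L k x - K\<^sup>2 * (L k x)\<^sup>2) \<in> borel_measurable (row_law (Suc n))"
    by (intro borel_measurable_sum borel_measurable_diff borel_measurable_times borel_measurable_power borel_measurable_const
          meas coord_measurable) auto
  have "(\<lambda>x. ennreal (?F (Suc n) x)) \<in> borel_measurable (row_law (Suc n))" by measurable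
  then have "(\<integral>\<^sup>+x. ?F (Suc n) x \<partial>row_law (Suc n)) = (\<integral>\<^sup>+x. (\<integral>\<^sup>+y. ?F (Suc n) (x(n := y)) \<partial>D) \<partial>row_law n)"
    by (rule nn_integral_row_law_Suc)
  also have "\<dots> \<le> (\<integral>\<^sup>+x. ?F n x \<partial>row_law n)"
  proof (intro nn_integral_mono)
    fix x
    have L: "L k (x(n := y)) = L k x" if "k \<le> n" for k y
      by (rule dep) (use that in auto)
    have "?F (Suc n) (x(n := y)) = (?F n x * exp (- (K\<^sup>2 * (L n x)\<^sup>2))) * exp (L n x * y)" for y
    proof -
      have "(\<Sum>k<n. (x(n := y)) k * L k (x(n := y)) - K\<^sup>2 * (L k (x(n := y)))\<^sup>2)
          = (\<Sum>k<n. x k * L k x - K\<^sup>2 * (L k x)\<^sup>2)"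
        by (intro sum.cong refl) (simp add: L)
      then show ?thesis
        by (simp add: L exp_add[symmetric] exp_minus[symmetric] mult_ac)
    qed
    then have "(\<integral>\<^sup>+y. ?F (Suc n) (x(n := y)) \<partial>D)
        = (\<integral>\<^sup>+y. ennreal (?F n x * exp (- (K\<^sup>2 * (L n x)\<^sup>2))) * ennreal (exp (L n x * y)) \<partial>D)"
      by (simp add: ennreal_mult)
    also have "\<dots> = ennreal (?F n x * exp (- (K\<^sup>2 * (L n x)\<^sup>2))) * (\<integral>\<^sup>+y. exp (L n x * y) \<partial>D)"
      by (rule nn_integral_cmult) measurable
    also have "\<dots> \<le> ennreal (?F n x * exp (- (K\<^sup>2 * (L n x)\<^sup>2))) * ennreal (exp (K\<^sup>2 * (L n x)\<^sup>2))"
      by (intro mult_left_mono mgf_le) simp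
    also have "\<dots> = ennreal (?F n x)"
      by (simp add: ennreal_mult[symmetric] exp_minus field_simps)
    finally show "(\<integral>\<^sup>+y. ?F (Suc n) (x(n := y)) \<partial>D) \<le> ennreal (?F n x)" .
  qed
  finally show ?case using Suc by (rule order_trans)
qed

text \<open>A Freedman-type bound: the sum of squares of the coefficients is random and is
  controlled only on the event itself. On that event the exponential supermartingale with parameter
  \<open>lam\<close> is at least exp (lam t - K^2 lam^2 v).\<close>

lemma martingale_tail:
  assumes meas: "\<And>k N. k \<le> N \<Longrightarrow> L k \<in> borel_measurable (row_law N)"
    and dep: "\<And>k x y. (\<And>i. i < k \<Longrightarrow> x i = y i) \<Longrightarrow> L k x = L k y"
    and "0 < v" "0 \<le> t"
  shows "measure (row_law n) {x \<in> space (row_law n). t \<le> (\<Sum>k<n. x k * L k x) \<and> (\<Sum>k<n. (L k x)\<^sup>2) \<le> v}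
       \<le> exp (- t\<^sup>2 / (4 * K\<^sup>2 * v))" (is "measure _ ?A \<le> _")
proof -
  interpret R: prob_space "row_law n" by (rule prob_space_row_law)
  \<comment> \<open>The minimiser of K^2 lam^2 v - lam t.\<close>
  define lam where "lam = t / (2 * K\<^sup>2 * v)"
  have lam0: "0 \<le> lam" using assms K_pos by (simp add: lam_def)
  let ?G = "\<lambda>x. \<Sum>k<n. x k * (lam * L k x) - K\<^sup>2 * (lam * L k x)\<^sup>2"
  let ?c = "lam * t - K\<^sup>2 * lam\<^sup>2 * v"
  have G: "?G x = lam * (\<Sum>k<n. x k * L k x) - K\<^sup>2 * lam\<^sup>2 * (\<Sum>k<n. (L k x)\<^sup>2)" for x
    by (simp add: sum_subtractf sum_distrib_left power_mult_distrib mult_ac)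
  have Gmeas: "?G \<in> borel_measurable (row_law n)"
    by (intro borel_measurable_sum borel_measurable_diff borel_measurable_times borel_measurable_power
          borel_measurable_const meas coord_measurable) auto
  have "emeasure (row_law n) ?A \<le> (\<integral>\<^sup>+x. ennreal (exp (- ?c)) * ennreal (exp (?G x)) \<partial>row_law n)"
  \<comment> \<open>A set outside the sigma-algebra has \<open>emeasure\<close> 0, so the bound
    holds for it as well.\<close>
  proof (cases "?A \<in> sets (row_law n)")
    case True
    have "emeasure (row_law n) ?A = (\<integral>\<^sup>+x. indicator ?A x \<partial>row_law n)" using True by simp
    also have "\<dots> \<le> (\<integral>\<^sup>+x. ennreal (exp (- ?c)) * ennreal (exp (?G x)) \<partial>row_law n)"
    proof (intro nn_integral_mono)
      fix x
      show "indicator ?A x \<le> ennreal (exp (- ?c)) * ennreal (exp (?G x))"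
      proof (cases "x \<in> ?A")
        case True
        then have "lam * t \<le> lam * (\<Sum>k<n. x k * L k x)"
          "K\<^sup>2 * lam\<^sup>2 * (\<Sum>k<n. (L k x)\<^sup>2) \<le> K\<^sup>2 * lam\<^sup>2 * v"
          using lam0 by (auto intro!: mult_left_mono)
        then have "0 \<le> - ?c + ?G x" unfolding G by linarith
        then have "1 \<le> exp (- ?c + ?G x)" by simp
        then show ?thesis using True by (simp add: ennreal_mult[symmetric] exp_add)
      qed simp
    qed
    finally show ?thesis .
  qed (simp add: emeasure_notin_sets)
  also have "\<dots> = ennreal (exp (- ?c)) * (\<integral>\<^sup>+x. exp (?G x) \<partial>row_law n)"
    using Gmeas by (intro nn_integral_cmult) auto
  also have "\<dots> \<le> ennreal (exp (- ?c)) * 1"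
  proof (intro mult_left_mono)
    show "(\<integral>\<^sup>+x. exp (?G x) \<partial>row_law n) \<le> 1"
    proof (rule martingale_exp_le_1[of "\<lambda>k x. lam * L k x"])
      show "(\<lambda>x. lam * L k x) \<in> borel_measurable (row_law N)" if "k \<le> N" for k N
        using meas[OF that] by simp
      show "lam * L k x = lam * L k y" if "\<And>i. i < k \<Longrightarrow> x i = y i" for k x y
        using dep[OF that] by simp
    qed
  qed simp
  also have "?c = t\<^sup>2 / (4 * K\<^sup>2 * v)"
    using K_pos assms(3) by (simp add: lam_def field_simps power2_eq_square)
  finally show ?thesis by (simp add: R.emeasure_eq_measure)
qed

lemma martingale_tail_abs:
  assumes meas: "\<And>k N. k \<le> N \<Longrightarrow> L k \<in> borel_measurable (row_law N)"
    and dep: "\<And>k x y. (\<And>i. i < k \<Longrightarrow> x i = y i) \<Longrightarrow> L k x = L k y"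
    and "0 < v" "0 \<le> t"
  shows "measure (row_law n) {x \<in> space (row_law n). t \<le> \<bar>\<Sum>k<n. x k * L k x\<bar> \<and> (\<Sum>k<n. (L k x)\<^sup>2) \<le> v}
       \<le> 2 * exp (- t\<^sup>2 / (4 * K\<^sup>2 * v))" (is "measure _ ?A \<le> _")
proof -
  interpret R: prob_space "row_law n" by (rule prob_space_row_law)
  let ?B = "\<lambda>s. {x \<in> space (row_law n). t \<le> (\<Sum>k<n. x k * (s * L k x)) \<and> (\<Sum>k<n. (s * L k x)\<^sup>2) \<le> v}"
  have B: "?B s \<in> sets (row_law n)" for s
    by (intro sets.sets_Collect_conj borel_measurable_le borel_measurable_const borel_measurable_sum
          borel_measurable_times borel_measurable_power meas coord_measurable) auto
  have tail: "measure (row_law n) (?B s) \<le> exp (- t\<^sup>2 / (4 * K\<^sup>2 * v))" for s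
  proof (rule martingale_tail[OF _ _ assms(3,4), of "\<lambda>k x. s * L k x"])
    show "(\<lambda>x. s * L k x) \<in> borel_measurable (row_law N)" if "k \<le> N" for k N
      using meas[OF that] by simp
    show "s * L k x = s * L k y" if "\<And>i. i < k \<Longrightarrow> x i = y i" for k x y
      using dep[OF that] by simp
  qed
  have "?A \<subseteq> ?B 1 \<union> ?B (- 1)"
    by (auto simp: sum_negf abs_if split: if_splits)
  then have "measure (row_law n) ?A \<le> measure (row_law n) (?B 1 \<union> ?B (- 1))"
    by (intro R.finite_measure_mono sets.Un B)
  also have "\<dots> \<le> measure (row_law n) (?B 1) + measure (row_law n) (?B (- 1))"
    by (intro measure_Un_le B)
  also have "\<dots> \<le> 2 * exp (- t\<^sup>2 / (4 * K\<^sup>2 * v))"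
    using tail[of 1] tail[of "- 1"] by linarith
  finally show ?thesis .
qed

lemma linear_tail:
  assumes "(\<Sum>i<n. (c i)\<^sup>2) \<le> v" "0 < v" "0 \<le> t"
  shows "measure (row_law n) {x \<in> space (row_law n). t \<le> \<bar>\<Sum>i<n. c i * x i\<bar>} \<le> 2 * exp (- t\<^sup>2 / (4 * K\<^sup>2 * v))"
  using martingale_tail_abs[of "\<lambda>k _. c k" v t n] assms by (simp add: mult.commute)

lemma coord_integral:
  fixes f :: "real \<Rightarrow> real"
  assumes "i < n" "integrable D f"
  shows "integrable (row_law n) (\<lambda>x. f (x i))" and "(\<integral>x. f (x i) \<partial>row_law n) = (\<integral>x. f x \<partial>D)"
proof -
  have d: "distr (row_law n) D (\<lambda>x. x i) = D"
    unfolding row_law_def using assms(1) by (intro distr_PiM_component prob_space_axioms) auto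
  have m: "(\<lambda>x. x i) \<in> measurable (row_law n) D"
    unfolding row_law_def using assms(1) by (intro measurable_component_singleton) auto
  have f: "f \<in> borel_measurable D" using assms(2) by auto
  show "integrable (row_law n) (\<lambda>x. f (x i))"
    using assms(2) integrable_distr_eq[OF m f] by (simp add: d)
  show "(\<integral>x. f (x i) \<partial>row_law n) = (\<integral>x. f x \<partial>D)"
    using integral_distr[OF m f] by (simp add: d)
qed

end

subsection \<open>The symbol of a sample\<close>

lemma sum_symmetric_split:
  fixes f :: "nat \<Rightarrow> nat \<Rightarrow> real"
  assumes "\<And>i k. i < n \<Longrightarrow> k < n \<Longrightarrow> f i k = f k i"
  shows "(\<Sum>i<n. \<Sum>k<n. f i k) = (\<Sum>k<n. f k k) + 2 * (\<Sum>k<n. \<Sum>i<k. f k i)"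
  using assms
proof (induction n)
  case (Suc n)
  have "(\<Sum>i<n. f i n) = (\<Sum>i<n. f n i)" by (intro sum.cong refl) (simp add: Suc.prems)
  then show ?case using Suc by (simp add: sum.distrib)
qed simp

text \<open>The off-diagonal part of \<open>autocorr\<close>, collected by its larger index: this is
  the factor of \<open>a k\<close>. It reads only coordinates below k, and the 2 counts both orders
  of a pair.\<close>

definition autocorr_lin :: "nat \<Rightarrow> nat \<Rightarrow> nat \<Rightarrow> (nat \<Rightarrow> real) \<Rightarrow> real" where
  "autocorr_lin n j k a =
     (\<Sum>i<k. 2 * (cos (pi * real j * (real k - real i) / real n) / (real n - \<bar>real k - real i\<bar>)) * a i)"

lemma autocorr_eq:
  "autocorr n j a = (\<Sum>i<n. (a i)\<^sup>2) / real n + (\<Sum>k<n. a k * autocorr_lin n j k a)"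
proof -
  let ?f = "\<lambda>i k. a i * a k *
     (cos (pi * real j * (real i - real k) / real n) / (real n - \<bar>real i - real k\<bar>))"
  have cos: "cos (pi * real j * (real i - real k) / real n) = cos (pi * real j * (real k - real i) / real n)" for i k
    using cos_minus[of "pi * real j * (real i - real k) / real n"] by (simp add: algebra_simps minus_divide_left)
  have "?f i k = ?f k i" for i k
    by (simp only: cos[of i k] abs_minus_commute[of "real i"] mult.commute[of "a i"])
  then have "autocorr n j a = (\<Sum>k<n. ?f k k) + 2 * (\<Sum>k<n. \<Sum>i<k. ?f k i)"
    unfolding autocorr_def by (rule sum_symmetric_split)
  also have "(\<Sum>k<n. ?f k k) = (\<Sum>i<n. (a i)\<^sup>2) / real n"
    by (simp add: sum_divide_distrib power2_eq_square)
  also have "2 * (\<Sum>k<n. \<Sum>i<k. ?f k i) = (\<Sum>k<n. a k * autocorr_lin n j k a)"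
    by (simp add: autocorr_lin_def sum_distrib_left mult_ac)
  finally show ?thesis .
qed

lemma autocorr_lin_coeff:
  assumes "k < n"
  shows "(\<Sum>i<k. (2 * (cos (pi * real j * (real k - real i) / real n) / (real n - \<bar>real k - real i\<bar>)))\<^sup>2)
       \<le> 4 * (\<Sum>l\<le>k. 1 / (real n - real l)\<^sup>2)"
proof -
  have "(\<Sum>i<k. (2 * (cos (pi * real j * (real k - real i) / real n) / (real n - \<bar>real k - real i\<bar>)))\<^sup>2)
      \<le> (\<Sum>i<k. 4 * (1 / (real n - real (k - i))\<^sup>2))"
  proof (intro sum_mono)
    fix i assume "i \<in> {..<k}"
    then have i: "i < k" by simp
    let ?c = "cos (pi * real j * (real k - real i) / real n)"
    have "?c\<^sup>2 \<le> 1" using abs_cos_le_one abs_square_le_1 by blast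
    then have "4 * (?c\<^sup>2 / (real n - real (k - i))\<^sup>2) \<le> 4 * (1 / (real n - real (k - i))\<^sup>2)"
      by (intro mult_left_mono divide_right_mono) auto
    then show "(2 * (?c / (real n - \<bar>real k - real i\<bar>)))\<^sup>2 \<le> 4 * (1 / (real n - real (k - i))\<^sup>2)"
      using i by (simp add: power_mult_distrib power_divide of_nat_diff)
  qed
  \<comment> \<open>The added term i = k keeps the variance proxy positive even for k = 0, where the
    original sum is empty.\<close>
  also have "\<dots> \<le> (\<Sum>i\<le>k. 4 * (1 / (real n - real (k - i))\<^sup>2))"
    by (intro sum_mono2) auto
  also have "\<dots> = (\<Sum>l\<le>k. 4 * (1 / (real n - real l)\<^sup>2))"
    by (rule sum.reindex_bij_witness[where i = "\<lambda>l. k - l" and j = "\<lambda>l. k - l"]) auto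
  finally show ?thesis by (simp add: sum_distrib_left)
qed

lemma sum_sum_atMost:
  fixes f :: "nat \<Rightarrow> real"
  shows "(\<Sum>k<N. \<Sum>l\<le>k. f l) = (\<Sum>l<N. (real N - real l) * f l)"
proof (induction N)
  case (Suc N)
  have "(\<Sum>l<Suc N. (real (Suc N) - real l) * f l) = (\<Sum>l<N. (real N - real l) * f l) + (\<Sum>l<N. f l) + f N"
    by (simp add: algebra_simps sum.distrib sum_subtractf)
  then show ?case using Suc by (simp add: lessThan_Suc_atMost[symmetric])
qed simp

lemma harm_le_1_add_ln: "0 < n \<Longrightarrow> harm n \<le> 1 + ln (real n)"
  using decseqD[OF decseq_harm_diff_ln, of 0 "n - 1"] by (simp add: harm_def)

text \<open>The term of index l is counted n - l times, which cancels one factor of its squared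
  weight and leaves a harmonic number. Thus dividing by the diagonal lengths costs only a logarithm,
  although the corner weights are of order one.\<close>

lemma autocorr_lin_coeff_sum:
  assumes "0 < n"
  shows "(\<Sum>k<n. 4 * (\<Sum>l\<le>k. 1 / (real n - real l)\<^sup>2)) \<le> 4 * (1 + ln (real n))"
proof -
  have "(\<Sum>k<n. \<Sum>l\<le>k. 1 / (real n - real l)\<^sup>2) = (\<Sum>l<n. (real n - real l) * (1 / (real n - real l)\<^sup>2))"
    by (rule sum_sum_atMost)
  also have "\<dots> = (\<Sum>l<n. inverse (real (n - l)))"
    by (intro sum.cong refl) (simp add: power2_eq_square of_nat_diff inverse_eq_divide)
  also have "\<dots> = (\<Sum>k=1..n. inverse (real k))"
    by (rule sum.reindex_bij_witness[where i = "\<lambda>k. n - k" and j = "\<lambda>l. n - l"]) auto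
  also have "\<dots> = harm n" by (simp add: harm_def)
  also have "\<dots> \<le> 1 + ln (real n)" using assms by (rule harm_le_1_add_ln)
  finally show ?thesis by (simp add: sum_distrib_left[symmetric])
qed

context unit_subgaussian
begin

lemma autocorr_lin_measurable: "k \<le> N \<Longrightarrow> autocorr_lin n j k \<in> borel_measurable (row_law N)"
  unfolding autocorr_lin_def
  by (intro borel_measurable_sum borel_measurable_times borel_measurable_const coord_measurable) auto

lemma autocorr_measurable: "autocorr n j \<in> borel_measurable (row_law n)"
  unfolding autocorr_def
  by (intro borel_measurable_sum borel_measurable_times borel_measurable_const coord_measurable) auto

lemma autocorr_lin_cong: "(\<And>i. i < k \<Longrightarrow> x i = y i) \<Longrightarrow> autocorr_lin n j k x = autocorr_lin n j k y"
  unfolding autocorr_lin_def by (intro sum.cong refl) simp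

lemma autocorr_lin_tail:
  assumes "k < n" "0 \<le> t"
  shows "measure (row_law n) {x \<in> space (row_law n). t \<le> \<bar>autocorr_lin n j k x\<bar>}
       \<le> 2 * exp (- t\<^sup>2 / (4 * K\<^sup>2 * (4 * (\<Sum>l\<le>k. 1 / (real n - real l)\<^sup>2))))"
proof -
  define c where "c i = (if i < k then 2 * (cos (pi * real j * (real k - real i) / real n)
      / (real n - \<bar>real k - real i\<bar>)) else 0)" for i
  have restrict: "(\<Sum>i<n. if i < k then f i else 0) = (\<Sum>i<k. f i)" for f :: "nat \<Rightarrow> real"
    using assms(1) by (subst sum.inter_filter[symmetric]) (auto intro!: sum.cong)
  have lin: "(\<Sum>i<n. c i * x i) = autocorr_lin n j k x" for x
    unfolding autocorr_lin_def restrict[symmetric] by (intro sum.cong refl) (simp add: c_def)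
  have "(\<Sum>i<n. (c i)\<^sup>2) = (\<Sum>i<k. (2 * (cos (pi * real j * (real k - real i) / real n)
      / (real n - \<bar>real k - real i\<bar>)))\<^sup>2)"
    unfolding restrict[symmetric] by (intro sum.cong refl) (simp add: c_def)
  also have "\<dots> \<le> 4 * (\<Sum>l\<le>k. 1 / (real n - real l)\<^sup>2)" using assms(1) by (rule autocorr_lin_coeff)
  finally have "(\<Sum>i<n. (c i)\<^sup>2) \<le> 4 * (\<Sum>l\<le>k. 1 / (real n - real l)\<^sup>2)" .
  moreover have "0 < (\<Sum>l\<le>k. 1 / (real n - real l)\<^sup>2)"
    using assms(1) by (intro sum_pos) auto
  ultimately show ?thesis
    using linear_tail[of c n "4 * (\<Sum>l\<le>k. 1 / (real n - real l)\<^sup>2)" t] assms(2) by (simp add: lin)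
qed

lemma energy_tail:
  assumes "0 < \<beta>" "0 < n"
  shows "measure (row_law n) {x \<in> space (row_law n). \<beta> \<le> (\<Sum>i<n. (x i)\<^sup>2) / real n} \<le> 1 / \<beta>"
proof -
  interpret R: prob_space "row_law n" by (rule prob_space_row_law)
  let ?S = "\<lambda>x. (\<Sum>i<n. (x i)\<^sup>2) / real n"
  have int: "integrable (row_law n) ?S"
    using coord_integral(1)[OF _ integrable_sq] by (intro integrable_divide integrable_sum) auto
  have "(\<integral>x. ?S x \<partial>row_law n) = (\<Sum>i<n. (\<integral>x. (x i)\<^sup>2 \<partial>row_law n)) / real n"
    using coord_integral(1)[OF _ integrable_sq] by (simp add: Bochner_Integration.integral_sum)
  also have "\<dots> = 1" using assms(2) by (simp add: coord_integral(2)[OF _ integrable_sq] variance_1)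
  finally have E: "(\<integral>x. ?S x \<partial>row_law n) = 1" .
  have "measure (row_law n) {x \<in> space (row_law n). \<beta> \<le> ?S x} \<le> (\<integral>x. ?S x \<partial>row_law n) / \<beta>"
    using int assms(1)
    by (intro integral_Markov_inequality_measure[where A = "{}"]) (auto intro!: AE_I2 divide_nonneg_nonneg sum_nonneg)
  then show ?thesis unfolding E .
qed

text \<open>The diagonal is handled by Markov's inequality (\<open>E0\<close>), the rest in two
  layers: off \<open>E1\<close> all linear coefficients are small, which bounds the quadratic
  variation, and off \<open>E2\<close> the martingale with that variation is small. The constant
  depends on p and \<open>K\<close> but not on n.\<close>

lemma autocorr_bounded_whp:
  assumes p: "0 < p" "p \<le> 1"
  obtains B where "0 < B"
    "\<And>n. 0 < n \<Longrightarrow> measure (row_law n) {x \<in> space (row_law n). \<exists>j<2 * n. B * (1 + ln (real n))\<^sup>2 < \<bar>autocorr n j x\<bar>} \<le> p"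
proof
  let ?B = "2 / p + 8 * K\<^sup>2 * (ln (16 / p) + 2)"
  have lnp: "0 \<le> ln (16 / p)" using p by (intro ln_ge_zero) (simp add: field_simps)
  show "0 < ?B" using p lnp by (intro add_pos_nonneg mult_nonneg_nonneg) auto
  fix n :: nat assume n: "0 < n"
  interpret R: prob_space "row_law n" by (rule prob_space_row_law)
  let ?M = "row_law n" and ?S = "space (row_law n)"
  define ell where "ell = 1 + ln (real n)"
  have l1: "1 \<le> ell" using n by (simp add: ell_def)
  \<comment> \<open>Chosen so that exp (- w / (4 K^2)) = p / (16 n^2), which survives a union over
    all pairs (j, k) and all j.\<close>
  define w where "w = 4 * K\<^sup>2 * (ln (16 / p) + 2 * ln (real n))"
  have w0: "0 < w"
  proof -
    have "0 < ln (16 / p)" using p by (intro ln_gt_zero) (simp add: field_simps)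
    then show ?thesis using K_pos n by (simp add: w_def add_pos_nonneg)
  qed
  define u where "u = sqrt w"
  have u: "0 < u" "u\<^sup>2 = w" using w0 by (auto simp: u_def)
  define vk where "vk k = 4 * (\<Sum>l\<le>k. 1 / (real n - real l)\<^sup>2)" for k :: nat
  have vk: "0 < vk k" if "k < n" for k
    using that unfolding vk_def by (intro mult_pos_pos sum_pos) auto
  define v where "v = w * (4 * ell)"
  have v: "0 < v" using w0 l1 by (simp add: v_def)
  have ex: "exp (- w / (4 * K\<^sup>2)) = p / (16 * (real n)\<^sup>2)"
  proof -
    have "- w / (4 * K\<^sup>2) = - (ln (16 / p) + ln ((real n)\<^sup>2))"
      using K_pos n by (simp add: w_def ln_realpow)
    then have "exp (- w / (4 * K\<^sup>2)) = inverse (exp (ln (16 / p)) * exp (ln ((real n)\<^sup>2)))"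
      by (simp only: exp_minus exp_add)
    then show ?thesis using p n by simp
  qed
  define E0 where "E0 = {x \<in> ?S. 2 / p \<le> (\<Sum>i<n. (x i)\<^sup>2) / real n}"
  define E1 where "E1 = (\<lambda>(j, k). {x \<in> ?S. u * sqrt (vk k) \<le> \<bar>autocorr_lin n j k x\<bar>})"
  define E2 where "E2 j = {x \<in> ?S. u * sqrt v \<le> \<bar>\<Sum>k<n. x k * autocorr_lin n j k x\<bar>
      \<and> (\<Sum>k<n. (autocorr_lin n j k x)\<^sup>2) \<le> v}" for j
  let ?I = "{..<2 * n} \<times> {..<n}"
  have E0m: "E0 \<in> sets ?M" unfolding E0_def
    by (intro borel_measurable_le borel_measurable_const borel_measurable_divide borel_measurable_sum
         borel_measurable_power coord_measurable) auto
  have E1m: "E1 jk \<in> sets ?M" if "jk \<in> ?I" for jk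
    using that autocorr_lin_measurable[of "snd jk" n n "fst jk"]
    unfolding E1_def by (auto simp: case_prod_beta intro!: borel_measurable_le borel_measurable_const borel_measurable_abs)
  have E2m: "E2 j \<in> sets ?M" for j unfolding E2_def
    by (intro sets.sets_Collect_conj borel_measurable_le borel_measurable_const borel_measurable_abs
         borel_measurable_sum borel_measurable_times borel_measurable_power coord_measurable autocorr_lin_measurable) auto
  have P0: "measure ?M E0 \<le> p / 2"
    unfolding E0_def using energy_tail[of "2 / p" n] p n by simp
  have P1: "measure ?M (E1 jk) \<le> p / (8 * (real n)\<^sup>2)" if "jk \<in> ?I" for jk
  proof -
    obtain j k where jk: "jk = (j, k)" by fastforce
    then have k: "k < n" using that by simp
    have "measure ?M (E1 jk) \<le> 2 * exp (- (u * sqrt (vk k))\<^sup>2 / (4 * K\<^sup>2 * vk k))"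
      unfolding E1_def jk vk_def using autocorr_lin_tail[OF k, of "u * sqrt (vk k)" j] u(1) vk[OF k]
      by (simp add: vk_def)
    also have "- (u * sqrt (vk k))\<^sup>2 / (4 * K\<^sup>2 * vk k) = - w / (4 * K\<^sup>2)"
      using vk[OF k] by (simp add: power_mult_distrib u(2))
    finally show ?thesis unfolding ex by simp
  qed
  have P2: "measure ?M (E2 j) \<le> p / (8 * (real n)\<^sup>2)" for j
  proof -
    have "measure ?M (E2 j) \<le> 2 * exp (- (u * sqrt v)\<^sup>2 / (4 * K\<^sup>2 * v))"
      unfolding E2_def using u(1) v
      by (intro martingale_tail_abs autocorr_lin_measurable autocorr_lin_cong) auto
    also have "- (u * sqrt v)\<^sup>2 / (4 * K\<^sup>2 * v) = - w / (4 * K\<^sup>2)"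
      using v by (simp add: power_mult_distrib u(2))
    finally show ?thesis unfolding ex by simp
  qed
  have sub: "{x \<in> ?S. \<exists>j<2 * n. ?B * (1 + ln (real n))\<^sup>2 < \<bar>autocorr n j x\<bar>}
      \<subseteq> E0 \<union> ((\<Union>jk\<in>?I. E1 jk) \<union> (\<Union>j\<in>{..<2 * n}. E2 j))"
  proof (rule ccontr)
    assume "\<not> ?thesis"
    then obtain x j where x: "x \<in> ?S" "x \<notin> E0" "\<And>jk. jk \<in> ?I \<Longrightarrow> x \<notin> E1 jk"
        "\<And>j. j < 2 * n \<Longrightarrow> x \<notin> E2 j" and j: "j < 2 * n" and big: "?B * ell\<^sup>2 < \<bar>autocorr n j x\<bar>"
      unfolding ell_def by blast
    have e0: "(\<Sum>i<n. (x i)\<^sup>2) / real n < 2 / p" using x(1,2) by (simp add: E0_def)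
    have "(\<Sum>k<n. (autocorr_lin n j k x)\<^sup>2) \<le> (\<Sum>k<n. w * vk k)"
    proof (intro sum_mono)
      fix k assume "k \<in> {..<n}"
      then have k: "k < n" by simp
      then have "\<bar>autocorr_lin n j k x\<bar> \<le> u * sqrt (vk k)"
        using x(3)[of "(j, k)"] j x(1) by (simp add: E1_def)
      then have "\<bar>autocorr_lin n j k x\<bar>\<^sup>2 \<le> (u * sqrt (vk k))\<^sup>2" by (intro power_mono) auto
      then show "(autocorr_lin n j k x)\<^sup>2 \<le> w * vk k"
        using vk[OF k] by (simp add: power_mult_distrib u(2))
    qed
    also have "\<dots> = w * (\<Sum>k<n. vk k)" by (simp add: sum_distrib_left)
    also have "\<dots> \<le> v"
      unfolding v_def ell_def vk_def by (rule mult_left_mono[OF autocorr_lin_coeff_sum[OF n]]) (use w0 in simp)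
    finally have "\<bar>\<Sum>k<n. x k * autocorr_lin n j k x\<bar> < u * sqrt v"
      using x(4)[OF j] x(1) by (simp add: E2_def)
    also have "u * sqrt v = 2 * w * sqrt ell"
      unfolding v_def u_def using w0 by (simp add: real_sqrt_mult)
    \<comment> \<open>The two deviations contribute a factor w, of order ell, and the harmonic sum
      contributes the square root of ell; the power 3/2 is rounded up to 2.\<close>
    also have "\<dots> \<le> 2 * w * ell"
      using w0 l1 by (intro mult_left_mono) (auto intro!: real_le_lsqrt simp: power2_eq_square)
    also have "\<dots> \<le> 2 * (4 * K\<^sup>2 * (ln (16 / p) + 2) * ell) * ell"
    proof -
      have "ln (16 / p) * 1 \<le> ln (16 / p) * ell" using lnp l1 by (intro mult_left_mono) auto
      then have "ln (16 / p) + 2 * ln (real n) \<le> (ln (16 / p) + 2) * ell"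
        by (simp add: ell_def algebra_simps)
      then have "w \<le> 4 * K\<^sup>2 * ((ln (16 / p) + 2) * ell)"
        unfolding w_def by (intro mult_left_mono) auto
      then show ?thesis using l1 by (intro mult_right_mono) (auto simp: mult_ac)
    qed
    finally have off: "\<bar>\<Sum>k<n. x k * autocorr_lin n j k x\<bar> \<le> 8 * K\<^sup>2 * (ln (16 / p) + 2) * ell\<^sup>2"
      by (simp add: power2_eq_square)
    have "2 / p * 1 \<le> 2 / p * ell\<^sup>2" using p l1 by (intro mult_left_mono) auto
    moreover have "\<bar>autocorr n j x\<bar> \<le> (\<Sum>i<n. (x i)\<^sup>2) / real n + \<bar>\<Sum>k<n. x k * autocorr_lin n j k x\<bar>"
    proof -
      have "0 \<le> (\<Sum>i<n. (x i)\<^sup>2) / real n" by (intro divide_nonneg_nonneg sum_nonneg) auto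
      then show ?thesis unfolding autocorr_eq by linarith
    qed
    moreover have "?B * ell\<^sup>2 = 2 / p * ell\<^sup>2 + 8 * K\<^sup>2 * (ln (16 / p) + 2) * ell\<^sup>2" by (rule distrib_right)
    ultimately show False using e0 off big by linarith
  qed
  have U1: "(\<Union>jk\<in>?I. E1 jk) \<in> sets ?M" using E1m by blast
  have U2: "(\<Union>j\<in>{..<2 * n}. E2 j) \<in> sets ?M" using E2m by blast
  have "measure ?M {x \<in> ?S. \<exists>j<2 * n. ?B * (1 + ln (real n))\<^sup>2 < \<bar>autocorr n j x\<bar>}
      \<le> measure ?M (E0 \<union> ((\<Union>jk\<in>?I. E1 jk) \<union> (\<Union>j\<in>{..<2 * n}. E2 j)))"
    using sub E0m U1 U2 by (intro R.finite_measure_mono) auto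
  also have "\<dots> \<le> measure ?M E0 + (measure ?M (\<Union>jk\<in>?I. E1 jk) + measure ?M (\<Union>j\<in>{..<2 * n}. E2 j))"
    using E0m U1 U2 by (intro order_trans[OF measure_Un_le] add_left_mono measure_Un_le sets.Un)
  \<comment> \<open>There are 2 n^2 + 2 n events of probability at most p / (8 n^2), together at
    most p / 2.\<close>
  also have "\<dots> \<le> p / 2 + ((\<Sum>jk\<in>?I. p / (8 * (real n)\<^sup>2)) + (\<Sum>j<2 * n. p / (8 * (real n)\<^sup>2)))"
    using E1m E2m
    by (intro add_mono P0 order_trans[OF measure_UNION_le] sum_mono P1 P2) auto
  also have "\<dots> = p / 2 + p * (2 * (real n)\<^sup>2 + 2 * real n) / (8 * (real n)\<^sup>2)"
    by (simp add: field_simps power2_eq_square)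
  also have "\<dots> \<le> p / 2 + p * (4 * (real n)\<^sup>2) / (8 * (real n)\<^sup>2)"
    using p n by (intro add_left_mono divide_right_mono mult_left_mono) (auto simp: power2_eq_square)
  also have "\<dots> = p" using n by simp
  finally show "measure ?M {x \<in> ?S. \<exists>j<2 * n. ?B * (1 + ln (real n))\<^sup>2 < \<bar>autocorr n j x\<bar>} \<le> p" .
qed

end

subsection \<open>Fourth moments of quadratic chaos\<close>

definition linform :: "nat \<Rightarrow> (nat \<Rightarrow> real) \<Rightarrow> (nat \<Rightarrow> real) \<Rightarrow> real" where
  "linform n c x = (\<Sum>i<n. c i * x i)"

text \<open>A quadratic form without diagonal, in martingale order: \<open>x k\<close> multiplies a
  linear form in the earlier coordinates, so only the entries \<open>c k i\<close> with i < k
  enter.\<close>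

definition chaos :: "nat \<Rightarrow> (nat \<Rightarrow> nat \<Rightarrow> real) \<Rightarrow> (nat \<Rightarrow> real) \<Rightarrow> real" where
  "chaos n c x = (\<Sum>k<n. x k * linform k (c k) x)"

definition chaos_var :: "nat \<Rightarrow> (nat \<Rightarrow> nat \<Rightarrow> real) \<Rightarrow> real" where
  "chaos_var n c = (\<Sum>k<n. \<Sum>i<k. (c k i)\<^sup>2)"

lemma chaos_var_nonneg: "0 \<le> chaos_var n c"
  unfolding chaos_var_def by (intro sum_nonneg) auto

lemma linform_cong: "(\<And>i. i < k \<Longrightarrow> x i = y i) \<Longrightarrow> linform k c x = linform k c y"
  unfolding linform_def by (intro sum.cong refl) simp

lemma linform_upd [simp]: "k \<le> n \<Longrightarrow> linform k c (x(n := y)) = linform k c x"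
  by (rule linform_cong) auto

lemma chaos_upd [simp]: "chaos n c (x(n := y)) = chaos n c x"
  unfolding chaos_def by (intro sum.cong refl) simp

text \<open>The cubic term 4 a (y b)^3 would bring in the third moment of the law. Adding 2 (y b)^2
  (a - y b)^2 trades it for even powers and raises the coefficients 6 and 1 to 8 and 3.\<close>

lemma quartic_le:
  fixes a b y :: real
  shows "(a + y * b) ^ 4 \<le> a ^ 4 + 4 * a ^ 3 * b * y + 8 * a\<^sup>2 * b\<^sup>2 * y\<^sup>2 + 3 * b ^ 4 * y ^ 4"
proof -
  have "0 \<le> 2 * (y * b)\<^sup>2 * (a - y * b)\<^sup>2" by simp
  also have "\<dots> = a ^ 4 + 4 * a ^ 3 * b * y + 8 * a\<^sup>2 * b\<^sup>2 * y\<^sup>2 + 3 * b ^ 4 * y ^ 4 - (a + y * b) ^ 4"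
    by (simp add: power2_eq_square power3_eq_cube power4_eq_xxxx algebra_simps)
  finally show ?thesis by simp
qed

lemma sum_power4_le:
  fixes y :: "nat \<Rightarrow> real"
  shows "(\<Sum>i<n. y i) ^ 4 \<le> real n ^ 3 * (\<Sum>i<n. y i ^ 4)"
proof -
  have cs: "(\<Sum>i<n. f i)\<^sup>2 \<le> real n * (\<Sum>i<n. (f i)\<^sup>2)" for f :: "nat \<Rightarrow> real"
    using Cauchy_Schwarz_ineq_sum[of "\<lambda>_. 1" f "{..<n}"] by simp
  have "(\<Sum>i<n. y i) ^ 4 = ((\<Sum>i<n. y i)\<^sup>2)\<^sup>2" by simp
  also have "\<dots> \<le> (real n * (\<Sum>i<n. (y i)\<^sup>2))\<^sup>2" by (intro power_mono cs) auto
  also have "\<dots> = (real n)\<^sup>2 * (\<Sum>i<n. (y i)\<^sup>2)\<^sup>2" by (simp add: power_mult_distrib)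
  also have "\<dots> \<le> (real n)\<^sup>2 * (real n * (\<Sum>i<n. ((y i)\<^sup>2)\<^sup>2))" by (intro mult_left_mono cs) auto
  finally show ?thesis by (simp add: power3_eq_cube power2_eq_square[of "real n"] mult_ac)
qed

lemma power4_le_exp:
  fixes t :: real
  assumes "0 \<le> t"
  shows "t ^ 4 \<le> 256 * exp t"
proof -
  have "(t / 4) ^ 4 \<le> exp (t / 4) ^ 4"
    using assms exp_ge_add_one_self[of "t / 4"] by (intro power_mono) linarith+
  also have "\<dots> = exp t" by (simp add: exp_of_nat_mult[symmetric])
  finally show ?thesis by (simp add: power_divide)
qed

lemma ennreal_power2_le_imp_le:
  assumes "x\<^sup>2 \<le> (ennreal a)\<^sup>2" "0 \<le> a"
  shows "x \<le> ennreal a"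
proof (cases x rule: ennreal_cases)
  case (real r)
  then have "r\<^sup>2 \<le> a\<^sup>2" using assms by (simp add: ennreal_power)
  then have "r \<le> a" using assms(2) by (rule power2_le_imp_le)
  then show ?thesis using real by (simp add: ennreal_leI)
next
  case top
  then have "x\<^sup>2 = \<top>" by (simp add: power2_eq_square)
  moreover have "(ennreal a)\<^sup>2 = ennreal (a\<^sup>2)" using assms(2) by (rule ennreal_power)
  ultimately show ?thesis using assms(1) ennreal_less_top[of "a\<^sup>2"] by (metis leD)
qed

context unit_subgaussian
begin

lemma linform_measurable: "k \<le> n \<Longrightarrow> linform k c \<in> borel_measurable (row_law n)"
  unfolding linform_def
  by (intro borel_measurable_sum borel_measurable_times borel_measurable_const coord_measurable) auto

lemma chaos_measurable: "k \<le> n \<Longrightarrow> chaos k c \<in> borel_measurable (row_law n)"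
  unfolding chaos_def
  by (intro borel_measurable_sum borel_measurable_times coord_measurable linform_measurable) auto

lemma nn_integral_affine_square: "(\<integral>\<^sup>+y. ennreal ((a + y * b)\<^sup>2) \<partial>D) = ennreal (a\<^sup>2 + b\<^sup>2)"
proof -
  have eq: "(a + y * b)\<^sup>2 = a\<^sup>2 + (2 * a * b) * y + b\<^sup>2 * y\<^sup>2" for y
    by (simp add: power2_eq_square algebra_simps)
  have "integrable D (\<lambda>y. (a + y * b)\<^sup>2)"
    unfolding eq using integrable_id integrable_sq by simp
  then have "(\<integral>\<^sup>+y. ennreal ((a + y * b)\<^sup>2) \<partial>D) = ennreal (\<integral>y. (a + y * b)\<^sup>2 \<partial>D)"
    by (intro nn_integral_eq_integral) auto
  also have "(\<integral>y. (a + y * b)\<^sup>2 \<partial>D) = a\<^sup>2 + b\<^sup>2"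
    unfolding eq using integrable_id integrable_sq by (simp add: mean_0 variance_1 prob_space)
  finally show ?thesis .
qed

lemma nn_integral_affine_quartic:
  "(\<integral>\<^sup>+y. ennreal ((a + y * b) ^ 4) \<partial>D) \<le> ennreal (a ^ 4 + 8 * a\<^sup>2 * b\<^sup>2 + 9 * b ^ 4)"
proof -
  let ?g = "\<lambda>y. a ^ 4 + (4 * a ^ 3 * b) * y + (8 * a\<^sup>2 * b\<^sup>2) * y\<^sup>2 + (3 * b ^ 4) * y ^ 4"
  have g: "(a + y * b) ^ 4 \<le> ?g y" for y using quartic_le[of a y b] by simp
  have g0: "0 \<le> ?g y" for y
    by (rule order_trans[OF _ g]) simp
  have gi: "integrable D ?g" using integrable_id integrable_sq integrable_4 by simp
  have "(\<integral>\<^sup>+y. ennreal ((a + y * b) ^ 4) \<partial>D) \<le> (\<integral>\<^sup>+y. ennreal (?g y) \<partial>D)"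
    using g by (intro nn_integral_mono ennreal_leI)
  also have "\<dots> = ennreal (\<integral>y. ?g y \<partial>D)"
    using gi g0 by (intro nn_integral_eq_integral) auto
  also have "(\<integral>y. ?g y \<partial>D) = a ^ 4 + 8 * a\<^sup>2 * b\<^sup>2 + 3 * b ^ 4 * (\<integral>y. y ^ 4 \<partial>D)"
    using integrable_id integrable_sq integrable_4 by (simp add: mean_0 variance_1 prob_space)
  also have "ennreal \<dots> \<le> ennreal (a ^ 4 + 8 * a\<^sup>2 * b\<^sup>2 + 9 * b ^ 4)"
  proof (intro ennreal_leI add_left_mono)
    have "3 * b ^ 4 * (\<integral>y. y ^ 4 \<partial>D) \<le> 3 * b ^ 4 * 3" using fourth_le by (intro mult_left_mono) auto
    then show "3 * b ^ 4 * (\<integral>y. y ^ 4 \<partial>D) \<le> 9 * b ^ 4" by simp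
  qed
  finally show ?thesis .
qed

lemma nn_integral_linform_square:
  "(\<integral>\<^sup>+x. ennreal ((linform n c x)\<^sup>2) \<partial>row_law n) = ennreal (\<Sum>i<n. (c i)\<^sup>2)"
proof (induction n)
  case 0
  show ?case by (simp add: linform_def)
next
  case (Suc n)
  have m: "(\<lambda>x. ennreal ((linform (Suc n) c x)\<^sup>2)) \<in> borel_measurable (row_law (Suc n))"
    using linform_measurable[of "Suc n" "Suc n" c] by simp
  have s: "linform (Suc n) c (x(n := y)) = linform n c x + y * c n" for x y
    using linform_upd[of n n c x y] by (simp add: linform_def)
  interpret R: prob_space "row_law n" by (rule prob_space_row_law)
  have "(\<integral>\<^sup>+x. ennreal ((linform (Suc n) c x)\<^sup>2) \<partial>row_law (Suc n))
      = (\<integral>\<^sup>+x. ennreal ((linform n c x)\<^sup>2) + ennreal ((c n)\<^sup>2) \<partial>row_law n)"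
    unfolding nn_integral_row_law_Suc[OF m] s nn_integral_affine_square by simp
  also have "\<dots> = ennreal (\<Sum>i<n. (c i)\<^sup>2) + ennreal ((c n)\<^sup>2)"
    using linform_measurable[of n n c] by (subst nn_integral_add) (auto simp: Suc R.emeasure_space_1)
  also have "\<dots> = ennreal (\<Sum>i<Suc n. (c i)\<^sup>2)"
    by (simp add: sum_nonneg ennreal_plus[symmetric] del: ennreal_plus)
  finally show ?case .
qed

text \<open>With s the variance so far and t the new squared coefficient, the induction needs 9 s^2
  + 8 s t + 9 t^2 \<le> 9 (s + t)^2. The constant 9 is the coefficient 3 of
  \<open>quartic_le\<close> times the bound 3 on the fourth moment.\<close>

lemma nn_integral_linform_quartic:
  "(\<integral>\<^sup>+x. ennreal ((linform n c x) ^ 4) \<partial>row_law n) \<le> ennreal (9 * (\<Sum>i<n. (c i)\<^sup>2)\<^sup>2)"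
proof (induction n)
  case 0
  show ?case by (simp add: linform_def)
next
  case (Suc n)
  let ?s = "\<Sum>i<n. (c i)\<^sup>2"
  have s0: "0 \<le> ?s" by (intro sum_nonneg) auto
  have m: "(\<lambda>x. ennreal ((linform (Suc n) c x) ^ 4)) \<in> borel_measurable (row_law (Suc n))"
    using linform_measurable[of "Suc n" "Suc n" c] by simp
  have s: "linform (Suc n) c (x(n := y)) = linform n c x + y * c n" for x y
    using linform_upd[of n n c x y] by (simp add: linform_def)
  interpret R: prob_space "row_law n" by (rule prob_space_row_law)
  have [measurable]: "linform n c \<in> borel_measurable (row_law n)" by (rule linform_measurable) simp
  have "(\<integral>\<^sup>+x. ennreal ((linform (Suc n) c x) ^ 4) \<partial>row_law (Suc n))
      \<le> (\<integral>\<^sup>+x. ennreal ((linform n c x) ^ 4 + 8 * (linform n c x)\<^sup>2 * (c n)\<^sup>2 + 9 * (c n) ^ 4) \<partial>row_law n)"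
    unfolding nn_integral_row_law_Suc[OF m] s by (intro nn_integral_mono nn_integral_affine_quartic)
  also have "\<dots> = (\<integral>\<^sup>+x. ennreal ((linform n c x) ^ 4) + ennreal (8 * (c n)\<^sup>2) * ennreal ((linform n c x)\<^sup>2)
      + ennreal (9 * (c n) ^ 4) \<partial>row_law n)"
    by (intro nn_integral_cong) (simp add: ennreal_plus[symmetric] ennreal_mult[symmetric] mult_ac del: ennreal_plus)
  also have "\<dots> = (\<integral>\<^sup>+x. ennreal ((linform n c x) ^ 4) \<partial>row_law n)
      + ennreal (8 * (c n)\<^sup>2) * (\<integral>\<^sup>+x. ennreal ((linform n c x)\<^sup>2) \<partial>row_law n) + ennreal (9 * (c n) ^ 4)"
    by (simp add: nn_integral_add nn_integral_cmult R.emeasure_space_1)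
  also have "\<dots> \<le> ennreal (9 * ?s\<^sup>2) + ennreal (8 * (c n)\<^sup>2) * ennreal ?s + ennreal (9 * (c n) ^ 4)"
    unfolding nn_integral_linform_square by (intro add_mono Suc order_refl)
  also have "\<dots> = ennreal (9 * ?s\<^sup>2 + 8 * (c n)\<^sup>2 * ?s + 9 * (c n) ^ 4)"
    using s0 by (simp add: ennreal_plus[symmetric] ennreal_mult[symmetric] del: ennreal_plus)
  also have "\<dots> \<le> ennreal (9 * (?s + (c n)\<^sup>2)\<^sup>2)"
  proof (intro ennreal_leI)
    have "0 \<le> 10 * ((c n)\<^sup>2 * ?s)" using s0 by simp
    moreover have "9 * (?s + (c n)\<^sup>2)\<^sup>2 = 9 * ?s\<^sup>2 + 18 * ((c n)\<^sup>2 * ?s) + 9 * (c n) ^ 4"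
      by (simp add: power2_eq_square[of "_ + _"] power2_eq_square[of ?s] power4_eq_xxxx power2_eq_square[of "c n"] algebra_simps)
    ultimately show "9 * ?s\<^sup>2 + 8 * (c n)\<^sup>2 * ?s + 9 * (c n) ^ 4 \<le> 9 * (?s + (c n)\<^sup>2)\<^sup>2" by linarith
  qed
  finally show ?case by simp
qed

lemma chaos_Suc_upd: "chaos (Suc n) c (x(n := y)) = chaos n c x + y * linform n (c n) x"
  using chaos_upd[of n c x y] by (simp add: chaos_def)

lemma nn_integral_chaos_square:
  "(\<integral>\<^sup>+x. ennreal ((chaos n c x)\<^sup>2) \<partial>row_law n) = ennreal (chaos_var n c)"
proof (induction n)
  case 0
  show ?case by (simp add: chaos_def chaos_var_def)
next
  case (Suc n)
  have m: "(\<lambda>x. ennreal ((chaos (Suc n) c x)\<^sup>2)) \<in> borel_measurable (row_law (Suc n))"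
    using chaos_measurable[of "Suc n" "Suc n" c] by simp
  have [measurable]: "linform n (c n) \<in> borel_measurable (row_law n)" "chaos n c \<in> borel_measurable (row_law n)"
    by (rule linform_measurable chaos_measurable, simp)+
  have "(\<integral>\<^sup>+x. ennreal ((chaos (Suc n) c x)\<^sup>2) \<partial>row_law (Suc n))
      = (\<integral>\<^sup>+x. ennreal ((chaos n c x)\<^sup>2) + ennreal ((linform n (c n) x)\<^sup>2) \<partial>row_law n)"
    unfolding nn_integral_row_law_Suc[OF m] chaos_Suc_upd nn_integral_affine_square by simp
  also have "\<dots> = ennreal (chaos_var n c) + ennreal (\<Sum>i<n. (c n i)\<^sup>2)"
    by (subst nn_integral_add) (auto simp: Suc nn_integral_linform_square)
  also have "\<dots> = ennreal (chaos_var (Suc n) c)"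
    by (simp add: chaos_var_def sum_nonneg ennreal_plus[symmetric] del: ennreal_plus)
  finally show ?case .
qed

text \<open>The chaos so far and the new linear form share coordinates, so their mixed moment is
  bounded by Cauchy-Schwarz. With constant C the induction needs 8 sqrt (9 C) \<le> 2 C, and C = 144
  is the least solution.\<close>

lemma nn_integral_chaos_quartic:
  "(\<integral>\<^sup>+x. ennreal ((chaos n c x) ^ 4) \<partial>row_law n) \<le> ennreal (144 * (chaos_var n c)\<^sup>2)"
proof (induction n)
  case 0
  show ?case by (simp add: chaos_def chaos_var_def)
next
  case (Suc n)
  let ?Y = "chaos n c" and ?L = "linform n (c n)"
  define A where "A = chaos_var n c"
  define B where "B = (\<Sum>i<n. (c n i)\<^sup>2)"
  have A0: "0 \<le> A" unfolding A_def by (rule chaos_var_nonneg)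
  have B0: "0 \<le> B" unfolding B_def by (intro sum_nonneg) auto
  have m: "(\<lambda>x. ennreal ((chaos (Suc n) c x) ^ 4)) \<in> borel_measurable (row_law (Suc n))"
    using chaos_measurable[of "Suc n" "Suc n" c] by simp
  have [measurable]: "?L \<in> borel_measurable (row_law n)" "?Y \<in> borel_measurable (row_law n)"
    by (rule linform_measurable chaos_measurable, simp)+
  have cs: "(\<integral>\<^sup>+x. ennreal ((?Y x)\<^sup>2 * (?L x)\<^sup>2) \<partial>row_law n) \<le> ennreal (36 * A * B)"
  proof -
    let ?I = "\<integral>\<^sup>+x. ennreal ((?Y x)\<^sup>2 * (?L x)\<^sup>2) \<partial>row_law n"
    have "?I\<^sup>2 = (\<integral>\<^sup>+x. ennreal ((?Y x)\<^sup>2) * ennreal ((?L x)\<^sup>2) \<partial>row_law n)\<^sup>2"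
      by (simp add: ennreal_mult)
    also have "\<dots> \<le> (\<integral>\<^sup>+x. (ennreal ((?Y x)\<^sup>2))\<^sup>2 \<partial>row_law n) * (\<integral>\<^sup>+x. (ennreal ((?L x)\<^sup>2))\<^sup>2 \<partial>row_law n)"
      by (rule Cauchy_Schwarz_nn_integral) measurable
    also have "\<dots> = (\<integral>\<^sup>+x. ennreal ((?Y x) ^ 4) \<partial>row_law n) * (\<integral>\<^sup>+x. ennreal ((?L x) ^ 4) \<partial>row_law n)"
      by (simp add: ennreal_power)
    also have "\<dots> \<le> ennreal (144 * A\<^sup>2) * ennreal (9 * B\<^sup>2)"
      unfolding A_def B_def by (intro mult_mono Suc nn_integral_linform_quartic) auto
    also have "\<dots> = ennreal ((36 * A * B)\<^sup>2)"
      by (simp add: ennreal_mult[symmetric] power_mult_distrib)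
    also have "\<dots> = (ennreal (36 * A * B))\<^sup>2" using A0 B0 by (simp add: ennreal_power)
    finally have sq: "?I\<^sup>2 \<le> (ennreal (36 * A * B))\<^sup>2" .
    show ?thesis by (rule ennreal_power2_le_imp_le[OF sq]) (use A0 B0 in simp)
  qed
  have "(\<integral>\<^sup>+x. ennreal ((chaos (Suc n) c x) ^ 4) \<partial>row_law (Suc n))
      \<le> (\<integral>\<^sup>+x. ennreal ((?Y x) ^ 4 + 8 * (?Y x)\<^sup>2 * (?L x)\<^sup>2 + 9 * (?L x) ^ 4) \<partial>row_law n)"
    unfolding nn_integral_row_law_Suc[OF m] chaos_Suc_upd by (intro nn_integral_mono nn_integral_affine_quartic)
  also have "\<dots> = (\<integral>\<^sup>+x. ennreal ((?Y x) ^ 4) + 8 * ennreal ((?Y x)\<^sup>2 * (?L x)\<^sup>2) + 9 * ennreal ((?L x) ^ 4) \<partial>row_law n)"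
    by (intro nn_integral_cong) (simp add: ennreal_plus ennreal_mult mult_ac)
  also have "\<dots> = (\<integral>\<^sup>+x. ennreal ((?Y x) ^ 4) \<partial>row_law n)
      + 8 * (\<integral>\<^sup>+x. ennreal ((?Y x)\<^sup>2 * (?L x)\<^sup>2) \<partial>row_law n) + 9 * (\<integral>\<^sup>+x. ennreal ((?L x) ^ 4) \<partial>row_law n)"
    by (simp add: nn_integral_add nn_integral_cmult)
  also have "\<dots> \<le> ennreal (144 * A\<^sup>2) + 8 * ennreal (36 * A * B) + 9 * ennreal (9 * B\<^sup>2)"
    using Suc cs nn_integral_linform_quartic[of n "c n"] unfolding A_def B_def
    by (intro add_mono mult_left_mono) auto
  also have "\<dots> = ennreal (144 * A\<^sup>2) + ennreal 8 * ennreal (36 * A * B) + ennreal 9 * ennreal (9 * B\<^sup>2)"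
    by simp
  also have "\<dots> = ennreal (144 * A\<^sup>2 + 8 * (36 * A * B) + 9 * (9 * B\<^sup>2))"
    using A0 B0 by (subst ennreal_mult[symmetric], simp, simp)+ (simp add: ennreal_plus[symmetric] del: ennreal_plus)
  also have "\<dots> \<le> ennreal (144 * (A + B)\<^sup>2)"
    using A0 B0 by (intro ennreal_leI) (simp add: power2_sum)
  finally show ?case by (simp add: chaos_var_def A_def B_def)
qed

end

subsection \<open>Small ball probability\<close>

text \<open>The diagonal of a Toeplitz matrix is constant, so the diagonal part is a multiple of the
  energy, which has mean n; it therefore cannot average out.\<close>

lemma qform_toeplitz_split:
  assumes "0 < n" "toeplitz n M" "sym_matrix n M"
  shows "qform n M x = M 0 0 * (\<Sum>i<n. (x i)\<^sup>2) + chaos n (\<lambda>k i. 2 * M k i) x"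
proof -
  have "qform n M x = (\<Sum>k<n. x k * M k k * x k) + 2 * (\<Sum>k<n. \<Sum>i<k. x k * M k i * x i)"
    unfolding qform_def using assms(3) by (intro sum_symmetric_split) (simp add: sym_matrix_def mult_ac)
  also have "(\<Sum>k<n. x k * M k k * x k) = M 0 0 * (\<Sum>i<n. (x i)\<^sup>2)"
    unfolding sum_distrib_left
  proof (intro sum.cong refl)
    fix k assume "k \<in> {..<n}"
    then have "M k k = M 0 0" using toeplitz_shift[OF assms(2), of 0 k 0] by simp
    then show "x k * M k k * x k = M 0 0 * (x k)\<^sup>2" by (simp add: power2_eq_square)
  qed
  also have "2 * (\<Sum>k<n. \<Sum>i<k. x k * M k i * x i) = chaos n (\<lambda>k i. 2 * M k i) x"
    by (simp add: chaos_def linform_def sum_distrib_left mult_ac)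
  finally show ?thesis .
qed

text \<open>The right-hand side is what the second moment of the form will be shown to dominate: n^2
  comes from the squared mean of the energy, and the off-diagonal entries have slack because 2 M k i
  is squared.\<close>

lemma frob_norm_toeplitz_le:
  assumes "0 < n" "toeplitz n M" "sym_matrix n M"
  shows "(frob_norm n M)\<^sup>2 \<le> (M 0 0)\<^sup>2 * (real n)\<^sup>2 + chaos_var n (\<lambda>k i. 2 * M k i)"
proof -
  have "(frob_norm n M)\<^sup>2 = (\<Sum>i<n. \<Sum>k<n. (M i k)\<^sup>2)"
    unfolding frob_norm_def by (simp add: sum_nonneg)
  also have "\<dots> = (\<Sum>k<n. (M k k)\<^sup>2) + 2 * (\<Sum>k<n. \<Sum>i<k. (M k i)\<^sup>2)"
    using assms(3) by (intro sum_symmetric_split) (simp add: sym_matrix_def)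
  also have "(\<Sum>k<n. (M k k)\<^sup>2) = (\<Sum>k<n. (M 0 0)\<^sup>2)"
  proof (intro sum.cong refl)
    fix k assume "k \<in> {..<n}"
    then have "M k k = M 0 0" using toeplitz_shift[OF assms(2), of 0 k 0] by simp
    then show "(M k k)\<^sup>2 = (M 0 0)\<^sup>2" by simp
  qed
  also have "\<dots> = (M 0 0)\<^sup>2 * real n" by simp
  also have "\<dots> \<le> (M 0 0)\<^sup>2 * (real n)\<^sup>2"
    using assms(1) by (intro mult_left_mono) (auto simp: power2_eq_square)
  also have "2 * (\<Sum>k<n. \<Sum>i<k. (M k i)\<^sup>2) \<le> chaos_var n (\<lambda>k i. 2 * M k i)"
    unfolding chaos_var_def sum_distrib_left by (intro sum_mono) (simp add: power_mult_distrib)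
  finally show ?thesis by simp
qed

text \<open>With u = X^2 / W, the indicator of u \<ge> 1/4 dominates the concave quadratic k u - k/4
  - (k u)^2 / 4, and taking means gives the claim. In this form a lower bound \<open>W\<close> for
  the second moment suffices.\<close>

lemma (in prob_space) paley_zygmund:
  fixes X :: "'a \<Rightarrow> real"
  assumes X: "random_variable borel X"
    and i2: "integrable M (\<lambda>x. (X x)\<^sup>2)" and i4: "integrable M (\<lambda>x. (X x) ^ 4)"
    and W: "0 < W" "W \<le> expectation (\<lambda>x. (X x)\<^sup>2)"
    and C: "0 < C" "expectation (\<lambda>x. (X x) ^ 4) \<le> C * W\<^sup>2"
  shows "9 / (16 * C) \<le> prob {x \<in> space M. W / 4 \<le> (X x)\<^sup>2}"
proof -
  \<comment> \<open>Maximises 3 k / 4 - C k^2 / 4, with maximum 9 / (16 C).\<close>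
  define k where "k = 3 / (2 * C)"
  have k: "0 < k" using C by (simp add: k_def)
  let ?A = "{x \<in> space M. W / 4 \<le> (X x)\<^sup>2}"
  have A: "?A \<in> events" using X by measurable
  let ?g = "\<lambda>x. (k / W) * (X x)\<^sup>2 - k / 4 - (k\<^sup>2 / (4 * W\<^sup>2)) * (X x) ^ 4"
  have g: "?g x \<le> indicator ?A x" if "x \<in> space M" for x
  proof -
    define u where "u = (X x)\<^sup>2 / W"
    have u0: "0 \<le> u" using W by (simp add: u_def)
    have gu: "?g x = k * u - k / 4 - (k * u)\<^sup>2 / 4"
      using W by (simp add: u_def power_divide power_mult_distrib)
    show ?thesis
    proof (cases "x \<in> ?A")
      case True
      have "0 \<le> (k * u / 2 - 1)\<^sup>2" by simp
      also have "\<dots> = (k * u)\<^sup>2 / 4 - k * u + 1" by (simp add: power2_diff power_divide)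
      finally have "k * u - (k * u)\<^sup>2 / 4 \<le> 1" by linarith
      then show ?thesis using True k unfolding gu by simp
    next
      case False
      then have "u < 1 / 4" using W that by (simp add: u_def field_simps)
      then have "k * u \<le> k * (1 / 4)" using k by (intro mult_left_mono) auto
      then have "k * u - k / 4 \<le> 0" by simp
      moreover have "0 \<le> (k * u)\<^sup>2 / 4" by simp
      ultimately have "?g x \<le> 0" unfolding gu by linarith
      then show ?thesis by (rule order_trans) simp
    qed
  qed
  have gi: "integrable M ?g" using i2 i4 by simp
  have "9 / (16 * C) = k - k / 4 - (k\<^sup>2 / 4) * C"
    using C by (simp add: k_def field_simps power2_eq_square)
  also have "\<dots> \<le> (k / W) * expectation (\<lambda>x. (X x)\<^sup>2) - k / 4 - (k\<^sup>2 / (4 * W\<^sup>2)) * expectation (\<lambda>x. (X x) ^ 4)"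
  proof -
    have "k = (k / W) * W" using W by simp
    also have "\<dots> \<le> (k / W) * expectation (\<lambda>x. (X x)\<^sup>2)" using k W by (intro mult_left_mono) auto
    finally have 1: "k \<le> (k / W) * expectation (\<lambda>x. (X x)\<^sup>2)" .
    have "(k\<^sup>2 / (4 * W\<^sup>2)) * expectation (\<lambda>x. (X x) ^ 4) \<le> (k\<^sup>2 / (4 * W\<^sup>2)) * (C * W\<^sup>2)"
      using C by (intro mult_left_mono) auto
    also have "\<dots> = (k\<^sup>2 / 4) * C" using W by simp
    finally show ?thesis using 1 by linarith
  qed
  also have "\<dots> = expectation ?g" using i2 i4 by (simp add: prob_space)
  also have "\<dots> \<le> expectation (indicator ?A)"
    using A by (intro Bochner_Integration.integral_mono[OF gi _ g] integrable_real_indicator) (simp_all add: emeasure_eq_measure)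
  also have "\<dots> = prob ?A" using A by simp
  finally show ?thesis .
qed

section \<open>Moments of the energy and the small ball estimate\<close>

context unit_subgaussian
begin

text \<open>The fourth power of the energy contains eighth powers of the entries; they are dominated
  by the exponential moment of x^2 / K^2.\<close>

lemma integrable_8: "integrable D (\<lambda>x. x ^ 8)"
proof (rule Bochner_Integration.integrable_bound)
  show "integrable D (\<lambda>x. (256 * K ^ 8) * exp (x\<^sup>2 / K\<^sup>2))" using integrable_exp by simp
  show "AE x in D. norm (x ^ 8) \<le> norm ((256 * K ^ 8) * exp (x\<^sup>2 / K\<^sup>2))"
  proof (intro AE_I2)
    fix x
    have "(x\<^sup>2 / K\<^sup>2) ^ 4 \<le> 256 * exp (x\<^sup>2 / K\<^sup>2)" by (rule power4_le_exp) simp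
    then have "K ^ 8 * (x\<^sup>2 / K\<^sup>2) ^ 4 \<le> K ^ 8 * (256 * exp (x\<^sup>2 / K\<^sup>2))"
      by (intro mult_left_mono) auto
    moreover have "K ^ 8 * (x\<^sup>2 / K\<^sup>2) ^ 4 = x ^ 8"
      using K_pos by (simp add: power_divide power_mult[symmetric])
    moreover have "\<bar>x ^ 8\<bar> = x ^ 8" by (intro abs_of_nonneg zero_le_even_power) simp
    ultimately show "norm (x ^ 8) \<le> norm ((256 * K ^ 8) * exp (x\<^sup>2 / K\<^sup>2))"
      using K_pos by (simp add: abs_mult mult_ac)
  qed
qed measurable

lemma integrable_power:
  assumes "k \<le> 8"
  shows "integrable D (\<lambda>x. x ^ k)"
proof (rule Bochner_Integration.integrable_bound)
  show "integrable D (\<lambda>x. 1 + x ^ 8)" using integrable_8 by simp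
  show "AE x in D. norm (x ^ k) \<le> norm (1 + x ^ 8)"
  proof (intro AE_I2)
    fix x :: real
    have x8: "\<bar>x\<bar> ^ 8 = x ^ 8" by (rule power_even_abs) simp
    have "\<bar>x\<bar> ^ k \<le> 1 + \<bar>x\<bar> ^ 8"
    proof (cases "\<bar>x\<bar> \<le> 1")
      case True
      then have "\<bar>x\<bar> ^ k \<le> 1" by (intro power_le_one) auto
      then show ?thesis by (simp add: add_increasing2)
    next
      case False
      then have "\<bar>x\<bar> ^ k \<le> \<bar>x\<bar> ^ 8" using assms by (intro power_increasing) auto
      then show ?thesis by simp
    qed
    also have "\<dots> = norm (1 + x ^ 8)" unfolding x8[symmetric] by simp
    finally show "norm (x ^ k) \<le> norm (1 + x ^ 8)" by (simp add: power_abs)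
  qed
qed measurable

text \<open>Written as a product over all coordinates with exponents \<open>e\<close>, the monomial
  has a coordinate of exponent exactly 1: k if it differs from i, otherwise j. Its mean is a factor
  of the integral and is 0.\<close>

lemma mixed_moment:
  assumes "i < n" "k < n" "j < n" "j \<noteq> k"
  shows "integrable (row_law n) (\<lambda>x. (x i)\<^sup>2 * (x k * x j))"
    and "(\<integral>x. (x i)\<^sup>2 * (x k * x j) \<partial>row_law n) = 0"
proof -
  define e :: "nat \<Rightarrow> nat" where "e p = (if p = i then 2 else 0) + ((if p = k then 1 else 0) + (if p = j then 1 else 0))" for p
  have e8: "e p \<le> 8" for p by (simp add: e_def)
  have pw: "a ^ (if P then m else 0) = (if P then a ^ m else 1)" for a :: real and P and m :: nat by simp
  have mono: "(\<Prod>p<n. x p ^ e p) = (x i)\<^sup>2 * (x k * x j)" for x :: "nat \<Rightarrow> real"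
    unfolding e_def power_add prod.distrib pw using assms(1-3) by (simp add: prod.delta)
  have int: "integrable D (\<lambda>y. y ^ e p)" for p using e8 by (rule integrable_power)
  show "integrable (row_law n) (\<lambda>x. (x i)\<^sup>2 * (x k * x j))"
    using prod.product_integrable_prod[of "{..<n}" "\<lambda>p y. y ^ e p"] int
    by (simp add: mono row_law_def)
  have "(\<integral>x. (x i)\<^sup>2 * (x k * x j) \<partial>row_law n) = (\<Prod>p<n. \<integral>y. y ^ e p \<partial>D)"
    using prod.product_integral_prod[of "{..<n}" "\<lambda>p y. y ^ e p"] int
    by (simp add: mono row_law_def)
  also have "\<dots> = 0"
  proof (rule prod_zero)
    define p where "p = (if k = i then j else k)"
    have "e p = 1" "p < n" using assms by (auto simp: e_def p_def)
    then show "\<exists>p\<in>{..<n}. (\<integral>y. y ^ e p \<partial>D) = 0" by (intro bexI[of _ p]) (auto simp: mean_0)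
  qed simp
  finally show "(\<integral>x. (x i)\<^sup>2 * (x k * x j) \<partial>row_law n) = 0" .
qed

lemma energy_chaos_uncorrelated:
  shows "integrable (row_law n) (\<lambda>x. (\<Sum>i<n. (x i)\<^sup>2) * chaos n c x)"
    and "(\<integral>x. (\<Sum>i<n. (x i)\<^sup>2) * chaos n c x \<partial>row_law n) = 0"
proof -
  have eq: "(\<Sum>i<n. (x i)\<^sup>2) * chaos n c x = (\<Sum>i<n. \<Sum>k<n. \<Sum>j<k. c k j * ((x i)\<^sup>2 * (x k * x j)))" for x
    unfolding chaos_def linform_def
    by (subst sum_distrib_right) (intro sum.cong refl, simp add: sum_distrib_left mult_ac)
  have int: "integrable (row_law n) (\<lambda>x. c k j * ((x i)\<^sup>2 * (x k * x j)))"
    and zero: "(\<integral>x. c k j * ((x i)\<^sup>2 * (x k * x j)) \<partial>row_law n) = 0"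
    if "i \<in> {..<n}" "k \<in> {..<n}" "j \<in> {..<k}" for i k j
    using mixed_moment[of i n k j] that by simp_all
  show "integrable (row_law n) (\<lambda>x. (\<Sum>i<n. (x i)\<^sup>2) * chaos n c x)"
    unfolding eq by (intro Bochner_Integration.integrable_sum int)
  have "(\<integral>x. (\<Sum>i<n. \<Sum>k<n. \<Sum>j<k. c k j * ((x i)\<^sup>2 * (x k * x j))) \<partial>row_law n)
      = (\<Sum>i<n. \<Sum>k<n. \<Sum>j<k. (\<integral>x. c k j * ((x i)\<^sup>2 * (x k * x j)) \<partial>row_law n))"
    by (intro Bochner_Integration.integral_sum[THEN trans] sum.cong refl Bochner_Integration.integrable_sum int)
  also have "\<dots> = 0" by (intro sum.neutral ballI zero)
  finally show "(\<integral>x. (\<Sum>i<n. (x i)\<^sup>2) * chaos n c x \<partial>row_law n) = 0"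
    unfolding eq .
qed

lemma chaos_moments:
  shows "integrable (row_law n) (\<lambda>x. (chaos n c x)\<^sup>2)"
    and "(\<integral>x. (chaos n c x)\<^sup>2 \<partial>row_law n) = chaos_var n c"
    and "integrable (row_law n) (\<lambda>x. (chaos n c x) ^ 4)"
    and "(\<integral>x. (chaos n c x) ^ 4 \<partial>row_law n) \<le> 144 * (chaos_var n c)\<^sup>2"
proof -
  have [measurable]: "chaos n c \<in> borel_measurable (row_law n)" by (rule chaos_measurable) simp
  show "integrable (row_law n) (\<lambda>x. (chaos n c x)\<^sup>2)"
    by (rule integrableI_nonneg) (auto simp: nn_integral_chaos_square)
  show "(\<integral>x. (chaos n c x)\<^sup>2 \<partial>row_law n) = chaos_var n c"
    by (subst integral_eq_nn_integral) (auto simp: nn_integral_chaos_square chaos_var_nonneg)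
  show i4: "integrable (row_law n) (\<lambda>x. (chaos n c x) ^ 4)"
    by (rule integrableI_nonneg) (auto intro: le_less_trans[OF nn_integral_chaos_quartic])
  have "ennreal (\<integral>x. (chaos n c x) ^ 4 \<partial>row_law n) \<le> ennreal (144 * (chaos_var n c)\<^sup>2)"
    using nn_integral_chaos_quartic[of n c] by (subst nn_integral_eq_integral[symmetric]) (auto simp: i4)
  then show "(\<integral>x. (chaos n c x) ^ 4 \<partial>row_law n) \<le> 144 * (chaos_var n c)\<^sup>2"
    by simp
qed

definition eighth_moment :: real where "eighth_moment = (\<integral>x. x ^ 8 \<partial>D)"

lemma eighth_moment_nonneg: "0 \<le> eighth_moment"
  unfolding eighth_moment_def by (intro Bochner_Integration.integral_nonneg) simp

text \<open>The lower bound on the second moment is nonnegativity of the variance with mean n; the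
  fourth moment is bounded by the power mean inequality, so it is of the order of the squared second
  moment.\<close>

lemma energy_moments:
  fixes n :: nat
  defines "S \<equiv> \<lambda>x :: nat \<Rightarrow> real. \<Sum>i<n. (x i)\<^sup>2"
  shows "integrable (row_law n) (\<lambda>x. (S x)\<^sup>2)" "(real n)\<^sup>2 \<le> (\<integral>x. (S x)\<^sup>2 \<partial>row_law n)"
    and "integrable (row_law n) (\<lambda>x. (S x) ^ 4)" "(\<integral>x. (S x) ^ 4 \<partial>row_law n) \<le> real n ^ 4 * eighth_moment"
proof -
  interpret R: prob_space "row_law n" by (rule prob_space_row_law)
  have Sm [measurable]: "S \<in> borel_measurable (row_law n)"
    unfolding S_def by (intro borel_measurable_sum borel_measurable_power coord_measurable) auto
  have i8: "integrable (row_law n) (\<lambda>x. (x i) ^ 8)" "(\<integral>x. (x i) ^ 8 \<partial>row_law n) = eighth_moment" if "i < n" for i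
    using coord_integral[OF that integrable_8] by (auto simp: eighth_moment_def)
  have bound: "(S x) ^ 4 \<le> real n ^ 3 * (\<Sum>i<n. x i ^ 8)" for x
    using sum_power4_le[of "\<lambda>i. (x i)\<^sup>2" n] by (simp add: S_def power_mult[symmetric])
  have bi: "integrable (row_law n) (\<lambda>x. real n ^ 3 * (\<Sum>i<n. x i ^ 8))"
    using i8 by (intro integrable_mult_right Bochner_Integration.integrable_sum) auto
  show i4: "integrable (row_law n) (\<lambda>x. (S x) ^ 4)"
    using bound by (intro Bochner_Integration.integrable_bound[OF bi]) (auto intro!: AE_I2 order_trans[OF bound])
  have "(\<integral>x. (S x) ^ 4 \<partial>row_law n) \<le> (\<integral>x. real n ^ 3 * (\<Sum>i<n. x i ^ 8) \<partial>row_law n)"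
    using i4 bi bound by (intro Bochner_Integration.integral_mono)
  also have "\<dots> = real n ^ 3 * (\<Sum>i<n. eighth_moment)"
    using i8 by (simp add: Bochner_Integration.integral_sum)
  finally show "(\<integral>x. (S x) ^ 4 \<partial>row_law n) \<le> real n ^ 4 * eighth_moment"
    by (simp add: power4_eq_xxxx power3_eq_cube mult_ac)
  have i1: "integrable (row_law n) S"
    unfolding S_def using coord_integral(1)[OF _ integrable_sq] by (intro Bochner_Integration.integrable_sum) auto
  have E1: "(\<integral>x. S x \<partial>row_law n) = real n"
    unfolding S_def using coord_integral[OF _ integrable_sq]
    by (simp add: Bochner_Integration.integral_sum variance_1)
  have sq: "norm ((S x)\<^sup>2) \<le> norm (1 + (S x) ^ 4)" for x
  proof -
    have "0 \<le> ((S x)\<^sup>2 - 1)\<^sup>2" by simp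
    also have "\<dots> = (S x) ^ 4 - 2 * (S x)\<^sup>2 + 1" by (simp add: power2_diff)
    finally have "(S x)\<^sup>2 \<le> 1 + (S x) ^ 4" using zero_le_power2[of "S x"] by linarith
    then show ?thesis by simp
  qed
  show i2: "integrable (row_law n) (\<lambda>x. (S x)\<^sup>2)"
  proof (rule Bochner_Integration.integrable_bound)
    show "integrable (row_law n) (\<lambda>x. 1 + (S x) ^ 4)" using i4 by simp
  qed (measurable, rule AE_I2, rule sq)
  have "0 \<le> (\<integral>x. (S x - real n)\<^sup>2 \<partial>row_law n)" by (intro Bochner_Integration.integral_nonneg) simp
  also have "\<dots> = (\<integral>x. (S x)\<^sup>2 - (2 * real n) * S x + (real n)\<^sup>2 \<partial>row_law n)"
    by (intro Bochner_Integration.integral_cong refl) (simp add: power2_diff)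
  also have "\<dots> = (\<integral>x. (S x)\<^sup>2 \<partial>row_law n) - (2 * real n) * real n + (real n)\<^sup>2"
    using i1 i2 by (simp add: E1 R.prob_space)
  finally show "(real n)\<^sup>2 \<le> (\<integral>x. (S x)\<^sup>2 \<partial>row_law n)"
    by (simp add: power2_eq_square)
qed

text \<open>The value 9 / (16 C) of \<open>paley_zygmund\<close> with C = 8 (eighth_moment + 144);
  it depends on the law of the entries only.\<close>

definition small_ball_const :: real where "small_ball_const = 9 / (16 * (8 * (eighth_moment + 144)))"

lemma small_ball_const: "0 < small_ball_const" "small_ball_const \<le> 1"
  using eighth_moment_nonneg by (auto simp: small_ball_const_def field_simps)

text \<open>Energy and chaos are uncorrelated, so the second moment is at least \<open>W\<close>,
  and \<open>W\<close> \<ge> 1 by the Frobenius normalisation. The factor 8 in the fourth moment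
  bound comes from (a + b)^4 \<le> 8 (a^4 + b^4).\<close>

lemma qform_small_ball:
  assumes n: "0 < n" and M: "toeplitz n M" "sym_matrix n M" and norm: "frob_norm n M = 1"
  shows "small_ball_const \<le> measure (row_law n) {x \<in> space (row_law n). 1 / 2 \<le> \<bar>qform n M x\<bar>}"
proof -
  interpret R: prob_space "row_law n" by (rule prob_space_row_law)
  define h where "h = M 0 0"
  define c where "c k i = 2 * M k i" for k i
  define S where "S x = (\<Sum>i<n. (x i)\<^sup>2)" for x :: "nat \<Rightarrow> real"
  let ?X = "qform n M" and ?Y = "chaos n c"
  define W where "W = h\<^sup>2 * (real n)\<^sup>2 + chaos_var n c"
  have W1: "1 \<le> W"
    using frob_norm_toeplitz_le[OF n M] norm by (simp add: W_def h_def c_def[abs_def])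
  have X: "?X x = h * S x + ?Y x" for x
    using qform_toeplitz_split[OF n M, of x] by (simp add: S_def h_def c_def[abs_def])
  note Sm = energy_moments[of n, folded S_def] and Ym = chaos_moments[of n c]
    and SY = energy_chaos_uncorrelated[of n c, folded S_def]
  have [measurable]: "S \<in> borel_measurable (row_law n)"
    unfolding S_def by (intro borel_measurable_sum borel_measurable_power coord_measurable) auto
  have [measurable]: "?Y \<in> borel_measurable (row_law n)" by (rule chaos_measurable) simp
  have Xm [measurable]: "?X \<in> borel_measurable (row_law n)" unfolding X by measurable
  have X2: "(?X x)\<^sup>2 = h\<^sup>2 * (S x)\<^sup>2 + (2 * h) * (S x * ?Y x) + (?Y x)\<^sup>2" for x
    by (simp add: X power2_sum power_mult_distrib mult_ac)
  have i2: "integrable (row_law n) (\<lambda>x. (?X x)\<^sup>2)"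
    unfolding X2 using Sm(1) Ym(1) SY(1) by simp
  have E2: "W \<le> (\<integral>x. (?X x)\<^sup>2 \<partial>row_law n)"
  proof -
    have "(\<integral>x. (?X x)\<^sup>2 \<partial>row_law n) = h\<^sup>2 * (\<integral>x. (S x)\<^sup>2 \<partial>row_law n) + chaos_var n c"
      unfolding X2 using Sm(1) Ym(1) SY(1) by (simp add: SY(2) Ym(2))
    moreover have "h\<^sup>2 * (real n)\<^sup>2 \<le> h\<^sup>2 * (\<integral>x. (S x)\<^sup>2 \<partial>row_law n)"
      using Sm(2) by (intro mult_left_mono) auto
    ultimately show ?thesis by (simp add: W_def)
  qed
  have X4: "(?X x) ^ 4 \<le> 8 * (h ^ 4 * (S x) ^ 4 + (?Y x) ^ 4)" for x
  proof -
    have sq: "(a + b)\<^sup>2 \<le> 2 * (a\<^sup>2 + b\<^sup>2)" for a b :: real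
      using sum_squares_bound[of a b] by (simp add: power2_sum)
    have "(?X x) ^ 4 = ((?X x)\<^sup>2)\<^sup>2" by simp
    also have "\<dots> \<le> (2 * ((h * S x)\<^sup>2 + (?Y x)\<^sup>2))\<^sup>2" unfolding X by (intro power_mono sq) auto
    also have "\<dots> = 4 * ((h * S x)\<^sup>2 + (?Y x)\<^sup>2)\<^sup>2" by (rule trans[OF power_mult_distrib]) simp
    also have "\<dots> \<le> 4 * (2 * (((h * S x)\<^sup>2)\<^sup>2 + ((?Y x)\<^sup>2)\<^sup>2))" by (intro mult_left_mono sq) auto
    finally show ?thesis by (simp add: power_mult_distrib)
  qed
  have bi: "integrable (row_law n) (\<lambda>x. 8 * (h ^ 4 * (S x) ^ 4 + (?Y x) ^ 4))"
    using Sm(3) Ym(3) by simp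
  have i4: "integrable (row_law n) (\<lambda>x. (?X x) ^ 4)"
    using X4 by (intro Bochner_Integration.integrable_bound[OF bi]) (auto intro!: AE_I2 order_trans[OF X4])
  have E4: "(\<integral>x. (?X x) ^ 4 \<partial>row_law n) \<le> (8 * (eighth_moment + 144)) * W\<^sup>2"
  proof -
    have "(\<integral>x. (?X x) ^ 4 \<partial>row_law n) \<le> (\<integral>x. 8 * (h ^ 4 * (S x) ^ 4 + (?Y x) ^ 4) \<partial>row_law n)"
      using i4 bi X4 by (intro Bochner_Integration.integral_mono)
    also have "\<dots> = 8 * (h ^ 4 * (\<integral>x. (S x) ^ 4 \<partial>row_law n) + (\<integral>x. (?Y x) ^ 4 \<partial>row_law n))"
      using Sm(3) Ym(3) by simp
    also have "\<dots> \<le> 8 * (h ^ 4 * (real n ^ 4 * eighth_moment) + 144 * (chaos_var n c)\<^sup>2)"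
      using Sm(4) Ym(4) by (intro mult_left_mono add_mono) auto
    also have "\<dots> \<le> 8 * (eighth_moment * W\<^sup>2 + 144 * W\<^sup>2)"
    proof -
      have "h ^ 4 * real n ^ 4 = (h\<^sup>2 * (real n)\<^sup>2)\<^sup>2" by (simp add: power_mult_distrib)
      also have "\<dots> \<le> W\<^sup>2" unfolding W_def using chaos_var_nonneg by (intro power_mono) auto
      finally have "h ^ 4 * real n ^ 4 * eighth_moment \<le> W\<^sup>2 * eighth_moment"
        using eighth_moment_nonneg by (intro mult_right_mono)
      moreover have "(chaos_var n c)\<^sup>2 \<le> W\<^sup>2" unfolding W_def using chaos_var_nonneg by (intro power_mono) auto
      ultimately show ?thesis by (simp add: mult_ac)
    qed
    finally show ?thesis by (simp add: algebra_simps)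
  qed
  have "small_ball_const \<le> R.prob {x \<in> space (row_law n). W / 4 \<le> (?X x)\<^sup>2}"
    unfolding small_ball_const_def using W1 eighth_moment_nonneg
    by (intro R.paley_zygmund[OF Xm i2 i4 _ E2 _ E4]) auto
  also have "\<dots> \<le> R.prob {x \<in> space (row_law n). 1 / 2 \<le> \<bar>?X x\<bar>}"
  proof (intro R.finite_measure_mono subsetI)
    fix x assume "x \<in> {x \<in> space (row_law n). W / 4 \<le> (?X x)\<^sup>2}"
    then have x: "x \<in> space (row_law n)" "(1 / 2)\<^sup>2 \<le> \<bar>?X x\<bar>\<^sup>2" using W1 by (auto simp: power_divide)
    then have "1 / 2 \<le> \<bar>?X x\<bar>" by (intro power2_le_imp_le[of "1 / 2"]) auto
    with x show "x \<in> {x \<in> space (row_law n). 1 / 2 \<le> \<bar>?X x\<bar>}" by simp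
  qed measurable
  finally show ?thesis .
qed

end

subsection \<open>Maurey approximation\<close>

definition bilin :: "nat \<Rightarrow> (nat \<Rightarrow> nat \<Rightarrow> real) \<Rightarrow> (nat \<Rightarrow> real) \<Rightarrow> (nat \<Rightarrow> real) \<Rightarrow> real" where
  "bilin n M x y = (\<Sum>i<n. \<Sum>j<n. x i * M i j * y j)"

lemma bilin_commute:
  assumes "sym_matrix n M"
  shows "bilin n M x y = bilin n M y x"
  unfolding bilin_def using assms
  by (subst sum.swap) (intro sum.cong refl, simp add: sym_matrix_def mult_ac)

lemma qform_diff:
  assumes "sym_matrix n M"
  shows "qform n M (\<lambda>i. x i - y i) = qform n M x - 2 * bilin n M x y + qform n M y"
proof -
  have "qform n M (\<lambda>i. x i - y i) = qform n M x - bilin n M x y - bilin n M y x + qform n M y"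
    by (simp add: qform_def bilin_def algebra_simps sum_subtractf sum.distrib)
  then show ?thesis using bilin_commute[OF assms, of y x] by simp
qed

lemma qform_diff_single:
  assumes "sym_matrix n M" "j < n"
  shows "qform n M (\<lambda>i. x i - (if i = j then t else 0))
       = qform n M x - 2 * t * (\<Sum>i<n. x i * M i j) + t\<^sup>2 * M j j"
proof -
  have "bilin n M x (\<lambda>i. if i = j then t else 0) = (\<Sum>i<n. x i * M i j * t)"
  proof -
    have "bilin n M x (\<lambda>i. if i = j then t else 0) = (\<Sum>i<n. \<Sum>k<n. if k = j then x i * M i j * t else 0)"
      unfolding bilin_def by (intro sum.cong refl) auto
    then show ?thesis using assms(2) by simp
  qed
  moreover have "qform n M (\<lambda>i. if i = j then t else 0) = t * M j j * t"
  proof -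
    have "qform n M (\<lambda>i. if i = j then t else 0)
        = (\<Sum>i<n. \<Sum>k<n. if k = j then (if i = j then t * M j j * t else 0) else 0)"
      unfolding qform_def by (intro sum.cong refl) auto
    then show ?thesis using assms(2) by simp
  qed
  ultimately show ?thesis
    unfolding qform_diff[OF assms(1)] by (simp add: power2_eq_square sum_distrib_left mult_ac)
qed

lemma qform_scale: "qform n M (\<lambda>i. t * x i) = t\<^sup>2 * qform n M x"
  by (simp add: qform_def sum_distrib_left power2_eq_square mult_ac)

text \<open>The average of the left-hand side over the random atom with mean \<open>c\<close> satisfies the bound.\<close>

lemma maurey_step:
  fixes G :: "nat \<Rightarrow> nat \<Rightarrow> real"
  assumes psd: "psd N G" and diag: "\<And>j. j < N \<Longrightarrow> G j j \<le> b"
    and c: "(\<Sum>j<N. \<bar>c j\<bar>) \<le> \<Lambda>" and pos: "0 < \<Lambda>" "0 < N"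
  shows "\<exists>j<N. \<exists>s\<in>{-1, 0, 1 :: real}. qform N G (\<lambda>i. u i - (if i = j then \<Lambda> * s else 0))
       \<le> qform N G (\<lambda>i. u i - c i) + \<Lambda>\<^sup>2 * b"
proof -
  let ?F = "\<lambda>(j, s). qform N G (\<lambda>i. u i - (if i = j then \<Lambda> * s else 0))"
  let ?A = "{..<N} \<times> {-1, 0, 1 :: real}"
  define m where "m = Min (?F ` ?A)"
  have fin: "finite (?F ` ?A)" "?F ` ?A \<noteq> {}" using pos(2) by auto
  have m_le: "m \<le> ?F (j, s)" if "j < N" "s \<in> {-1, 0, 1}" for j s
    unfolding m_def using that by (intro Min_le[OF fin(1)] imageI) simp
  have sym: "sym_matrix N G" using psd by (simp add: psd_def)
  define g where "g j = (\<Sum>i<N. u i * G i j)" for j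
  have F: "?F (j, s) = qform N G u - 2 * (\<Lambda> * s) * g j + (\<Lambda> * s)\<^sup>2 * G j j" if "j < N" for j s
    using qform_diff_single[OF sym that, of u "\<Lambda> * s"] by (simp add: g_def)
  have b0: "0 \<le> b"
  proof -
    have "qform N G (\<lambda>i. 0 - (if i = 0 then 1 else 0)) = G 0 0"
      using qform_diff_single[OF sym pos(2), of "\<lambda>_. 0" 1] by (simp add: qform_def)
    moreover have "0 \<le> qform N G (\<lambda>i. 0 - (if i = 0 then 1 else 0))"
      using psd by (simp only: psd_def qform_def)
    ultimately show ?thesis using diag[OF pos(2)] by linarith
  qed
  \<comment> \<open>The random atom takes the index j with sign sgn (c j) with probability |c j| /
    \<Lambda>; the missing mass 1 - P goes to the zero atom, which is why s = 0 is allowed. The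
    minimum m is at most the average.\<close>
  define P where "P = (\<Sum>j<N. \<bar>c j\<bar>) / \<Lambda>"
  have P: "P \<le> 1" using c pos by (simp add: P_def)
  have each: "\<bar>c j\<bar> / \<Lambda> * m \<le> \<bar>c j\<bar> / \<Lambda> * (qform N G u + \<Lambda>\<^sup>2 * b) - 2 * (c j * g j)" if j: "j < N" for j
  proof -
    have s: "sgn (c j) \<in> {-1, 0, 1}" by (simp add: sgn_if)
    have "m \<le> qform N G u - 2 * (\<Lambda> * sgn (c j)) * g j + (\<Lambda> * sgn (c j))\<^sup>2 * G j j"
      using m_le[OF j s] F[OF j] by simp
    also have "(\<Lambda> * sgn (c j))\<^sup>2 * G j j \<le> \<Lambda>\<^sup>2 * b"
      using diag[OF j] b0 by (auto simp: sgn_if power_mult_distrib intro: mult_left_mono)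
    finally have "m \<le> qform N G u + \<Lambda>\<^sup>2 * b - 2 * (\<Lambda> * sgn (c j)) * g j" by simp
    then have "\<bar>c j\<bar> / \<Lambda> * m \<le> \<bar>c j\<bar> / \<Lambda> * (qform N G u + \<Lambda>\<^sup>2 * b - 2 * (\<Lambda> * sgn (c j)) * g j)"
      using pos by (intro mult_left_mono) auto
    also have "\<dots> = \<bar>c j\<bar> / \<Lambda> * (qform N G u + \<Lambda>\<^sup>2 * b) - 2 * ((\<bar>c j\<bar> * sgn (c j)) * g j)"
      using pos by (simp add: field_simps)
    also have "\<bar>c j\<bar> * sgn (c j) = c j" by (simp add: abs_mult_sgn)
    finally show ?thesis .
  qed
  have "P * m = (\<Sum>j<N. \<bar>c j\<bar> / \<Lambda> * m)"
    by (simp add: P_def sum_divide_distrib sum_distrib_right)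
  also have "\<dots> \<le> (\<Sum>j<N. \<bar>c j\<bar> / \<Lambda> * (qform N G u + \<Lambda>\<^sup>2 * b) - 2 * (c j * g j))"
    using each by (intro sum_mono) simp
  also have "\<dots> = P * (qform N G u + \<Lambda>\<^sup>2 * b) - 2 * bilin N G u c"
  proof -
    have "bilin N G u c = (\<Sum>j<N. c j * g j)"
      unfolding bilin_def g_def sum_distrib_left by (subst sum.swap) (simp add: mult_ac)
    then show ?thesis
      by (simp add: P_def sum_subtractf sum_distrib_left[symmetric] sum_distrib_right[symmetric] sum_divide_distrib[symmetric])
  qed
  finally have 1: "P * m \<le> P * qform N G u + P * (\<Lambda>\<^sup>2 * b) - 2 * bilin N G u c"
    by (simp add: distrib_left)
  have "m \<le> qform N G u" using m_le[OF pos(2), of 0] F[OF pos(2), of 0] by simp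
  then have 2: "(1 - P) * m \<le> (1 - P) * qform N G u" using P by (intro mult_left_mono) auto
  have 3: "P * (\<Lambda>\<^sup>2 * b) \<le> 1 * (\<Lambda>\<^sup>2 * b)" using P b0 by (intro mult_right_mono) auto
  \<comment> \<open>Averaging leaves the form at u, minus twice the mixed term, plus \<Lambda>^2 b;
    the form at u - c has the extra term \<open>qform N G c\<close>, which only helps.\<close>
  have "0 \<le> qform N G c" using psd by (simp only: psd_def qform_def)
  moreover have "m = P * m + (1 - P) * m" "qform N G u = P * qform N G u + (1 - P) * qform N G u"
    by (simp_all add: left_diff_distrib)
  ultimately have "m \<le> qform N G (\<lambda>i. u i - c i) + \<Lambda>\<^sup>2 * b"
    unfolding qform_diff[OF sym] using 1 2 3 by linarith
  moreover have "m \<in> ?F ` ?A" unfolding m_def by (rule Min_in[OF fin])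
  then obtain j s where "m = ?F (j, s)" "j < N" "s \<in> {-1, 0, 1}"
    by blast
  ultimately show ?thesis by auto
qed

definition maurey_sum :: "real \<Rightarrow> (nat \<times> real) list \<Rightarrow> nat \<Rightarrow> real" where
  "maurey_sum \<Lambda> J i = (\<Sum>(j, s)\<leftarrow>J. if i = j then \<Lambda> * s else 0)"

text \<open>A greedy choice in place of random sampling: each round adds one copy of c and subtracts
  one atom, and the form of the difference grows by at most \<Lambda>^2 b. Growth is linear in q,
  while rescaling will divide by q^2.\<close>

lemma maurey_list:
  fixes G :: "nat \<Rightarrow> nat \<Rightarrow> real"
  assumes "psd N G" "\<And>j. j < N \<Longrightarrow> G j j \<le> b" "(\<Sum>j<N. \<bar>c j\<bar>) \<le> \<Lambda>" "0 < \<Lambda>" "0 < N"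
  shows "\<exists>J. set J \<subseteq> {..<N} \<times> {-1, 0, 1} \<and> length J = q \<and>
     qform N G (\<lambda>i. real q * c i - maurey_sum \<Lambda> J i) \<le> real q * (\<Lambda>\<^sup>2 * b)"
proof (induction q)
  case 0
  show ?case by (intro exI[of _ "[]"]) (simp add: maurey_sum_def qform_def)
next
  case (Suc q)
  then obtain J where J: "set J \<subseteq> {..<N} \<times> {-1, 0, 1}" "length J = q"
    "qform N G (\<lambda>i. real q * c i - maurey_sum \<Lambda> J i) \<le> real q * (\<Lambda>\<^sup>2 * b)" by blast
  define u where "u i = real (Suc q) * c i - maurey_sum \<Lambda> J i" for i
  obtain j s where js: "j < N" "s \<in> {-1, 0, 1 :: real}"
    "qform N G (\<lambda>i. u i - (if i = j then \<Lambda> * s else 0)) \<le> qform N G (\<lambda>i. u i - c i) + \<Lambda>\<^sup>2 * b"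
    using maurey_step[OF assms, of u] by blast
  have "(\<lambda>i. u i - c i) = (\<lambda>i. real q * c i - maurey_sum \<Lambda> J i)"
    by (simp add: u_def fun_eq_iff algebra_simps)
  moreover have "(\<lambda>i. u i - (if i = j then \<Lambda> * s else 0))
      = (\<lambda>i. real (Suc q) * c i - maurey_sum \<Lambda> ((j, s) # J) i)"
    by (simp add: u_def maurey_sum_def fun_eq_iff)
  ultimately have "qform N G (\<lambda>i. real (Suc q) * c i - maurey_sum \<Lambda> ((j, s) # J) i) \<le> real (Suc q) * (\<Lambda>\<^sup>2 * b)"
    using js(3) J(3) by (simp add: distrib_right)
  then show ?case using J js by (intro exI[of _ "(j, s) # J"]) auto
qed

text \<open>The order of quantifiers matters: \<open>T\<close> is fixed before \<open>G\<close> and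
  \<open>c\<close>, so \<open>G\<close> may be built from the random rows. A point is given by q
  atoms, each with N positions and 3 signs.\<close>

lemma maurey_net:
  fixes \<Lambda> :: real
  assumes "0 < \<Lambda>" "0 < N" "0 < q"
  obtains T :: "(nat \<Rightarrow> real) set" where "finite T" "card T \<le> (3 * N) ^ q"
    "\<And>G b c. psd N G \<Longrightarrow> (\<And>j. j < N \<Longrightarrow> G j j \<le> b) \<Longrightarrow> (\<Sum>j<N. \<bar>c j\<bar>) \<le> \<Lambda> \<Longrightarrow>
       \<exists>d\<in>T. qform N G (\<lambda>i. c i - d i) \<le> \<Lambda>\<^sup>2 * b / real q"
proof
  let ?A = "{..<N} \<times> {-1, 0, 1 :: real}"
  let ?L = "{J. set J \<subseteq> ?A \<and> length J = q}"
  let ?T = "(\<lambda>J i. maurey_sum \<Lambda> J i / real q) ` ?L"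
  have A: "finite ?A" "card ?A = 3 * N" by (simp_all add: card_cartesian_product)
  have L: "finite ?L" "card ?L = (3 * N) ^ q"
    using finite_lists_length_eq[OF A(1), of q] card_lists_length_eq[OF A(1), of q] unfolding A(2) by blast+
  show "finite ?T" using L by simp
  show "card ?T \<le> (3 * N) ^ q" using card_image_le[OF L(1)] L(2) by metis
  fix G :: "nat \<Rightarrow> nat \<Rightarrow> real" and b :: real and c :: "nat \<Rightarrow> real"
  assume a: "psd N G" "\<And>j. j < N \<Longrightarrow> G j j \<le> b" "(\<Sum>j<N. \<bar>c j\<bar>) \<le> \<Lambda>"
  obtain J where J: "J \<in> ?L" "qform N G (\<lambda>i. real q * c i - maurey_sum \<Lambda> J i) \<le> real q * (\<Lambda>\<^sup>2 * b)"
    using maurey_list[OF a(1,2,3) assms(1,2), of q] by blast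
  have "(\<lambda>i. c i - maurey_sum \<Lambda> J i / real q) = (\<lambda>i. (1 / real q) * (real q * c i - maurey_sum \<Lambda> J i))"
    using assms(3) by (simp add: fun_eq_iff field_simps)
  then have "qform N G (\<lambda>i. c i - maurey_sum \<Lambda> J i / real q)
      = (1 / real q)\<^sup>2 * qform N G (\<lambda>i. real q * c i - maurey_sum \<Lambda> J i)"
    by (simp only: qform_scale)
  also have "\<dots> \<le> (1 / real q)\<^sup>2 * (real q * (\<Lambda>\<^sup>2 * b))" using J(2) by (intro mult_left_mono) auto
  also have "\<dots> = \<Lambda>\<^sup>2 * b / real q" using assms(3) by (simp add: power2_eq_square)
  finally have "qform N G (\<lambda>i. c i - maurey_sum \<Lambda> J i / real q) \<le> \<Lambda>\<^sup>2 * b / real q" .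
  then show "\<exists>d\<in>?T. qform N G (\<lambda>i. c i - d i) \<le> \<Lambda>\<^sup>2 * b / real q" by (intro bexI[OF _ imageI[OF J(1)]])
qed

subsection \<open>Independence of the sample rows\<close>

lemma (in product_prob_space) indep_vars_coordinates:
  assumes "I \<noteq> {}"
  shows "prob_space.indep_vars (PiM I M) M (\<lambda>i \<omega>. \<omega> i) I"
proof -
  interpret P: prob_space "PiM I M" by (intro prob_space_PiM M.prob_space_axioms)
  have "distr (PiM I M) (PiM I M) (\<lambda>\<omega>. \<lambda>i\<in>I. \<omega> i) = distr (PiM I M) (PiM I M) (\<lambda>\<omega>. \<omega>)"
    by (intro distr_cong refl) (auto simp: space_PiM PiE_def extensional_restrict)
  also have "\<dots> = PiM I M" by simp
  also have "\<dots> = PiM I (\<lambda>i. distr (PiM I M) (M i) (\<lambda>\<omega>. \<omega> i))"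
    by (intro PiM_cong refl distr_PiM_component[symmetric] M.prob_space_axioms)
  finally show ?thesis
    using assms by (subst P.indep_vars_iff_distr_eq_PiM') auto
qed

context unit_subgaussian
begin

text \<open>The restriction makes the row extensional, hence a point of \<open>row_law n\<close>;
  the forms read only indices below n.\<close>

definition sample_row :: "nat \<Rightarrow> nat \<Rightarrow> (nat \<times> nat \<Rightarrow> real) \<Rightarrow> nat \<Rightarrow> real" where
  "sample_row n k \<omega> = (\<lambda>j\<in>{..<n}. \<omega> (k, j))"

lemma prob_space_sample_space: "prob_space (sample_space D m n)"
  unfolding sample_space_def by (intro prob_space_PiM prob_space_axioms)

lemma sample_row_measurable:
  "k < m \<Longrightarrow> sample_row n k \<in> measurable (sample_space D m n) (row_law n)"
  unfolding sample_row_def sample_space_def row_law_def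
  by (intro measurable_restrict measurable_component_singleton) auto

lemma distr_sample_row:
  assumes "k < m"
  shows "distr (sample_space D m n) (row_law n) (sample_row n k) = row_law n"
  unfolding sample_row_def[abs_def] sample_space_def row_law_def using assms
  by (intro distr_PiM_reindex[where f = "\<lambda>j. (k, j)" and M = "\<lambda>_. D", simplified] prob_space_axioms) (auto simp: inj_on_def)

text \<open>Different rows read disjoint blocks {k} x {..<n} of independent coordinates.\<close>

lemma indep_sample_rows:
  fixes f :: "(nat \<Rightarrow> real) \<Rightarrow> real"
  assumes f: "f \<in> borel_measurable (row_law n)" and "0 < m" "0 < n"
  shows "prob_space.indep_vars (sample_space D m n) (\<lambda>_. borel) (\<lambda>k \<omega>. f (sample_row n k \<omega>)) {..<m}"
proof -
  let ?I = "{..<m} \<times> {..<n}"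
  interpret PP: product_prob_space "\<lambda>_ :: nat \<times> nat. D" ?I ..
  interpret S: prob_space "sample_space D m n" by (rule prob_space_sample_space)
  have "S.indep_vars (\<lambda>_. D) (\<lambda>i \<omega>. \<omega> i) ?I"
    unfolding sample_space_def using assms(2,3) by (intro PP.indep_vars_coordinates) auto
  then have ind: "S.indep_vars (\<lambda>k. PiM ({k} \<times> {..<n}) (\<lambda>_. D))
      (\<lambda>k \<omega>. restrict (\<lambda>i. \<omega> i) ({k} \<times> {..<n})) {..<m}"
    by (intro S.indep_vars_restrict[where K = "\<lambda>k. {k} \<times> {..<n}"]) (auto simp: disjoint_family_on_def)
  have h: "(\<lambda>z. f (\<lambda>j\<in>{..<n}. z (k, j))) \<in> borel_measurable (PiM ({k} \<times> {..<n}) (\<lambda>_. D))" for k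
    by (rule measurable_compose[OF _ f, unfolded row_law_def])
       (auto intro!: measurable_restrict measurable_component_singleton)
  have "S.indep_vars (\<lambda>_. borel)
      (\<lambda>k \<omega>. (\<lambda>z. f (\<lambda>j\<in>{..<n}. z (k, j))) (restrict (\<lambda>i. \<omega> i) ({k} \<times> {..<n}))) {..<m}"
    by (rule S.indep_vars_compose2[OF ind h])
  moreover have "(\<lambda>j\<in>{..<n}. restrict (\<lambda>i. \<omega> i) ({k} \<times> {..<n}) (k, j)) = sample_row n k \<omega>" for k \<omega>
    by (auto simp: sample_row_def fun_eq_iff restrict_def)
  ultimately show ?thesis by simp
qed

lemma sample_rows_hoeffding:
  fixes f :: "(nat \<Rightarrow> real) \<Rightarrow> real"
  assumes f: "f \<in> borel_measurable (row_law n)" and range: "\<And>x. 0 \<le> f x \<and> f x \<le> 1 / 2"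
    and pos: "0 < m" "0 < n" "0 \<le> \<delta>"
  shows "measure (sample_space D m n) {\<omega> \<in> space (sample_space D m n).
      (\<Sum>k<m. f (sample_row n k \<omega>)) \<le> real m * (\<integral>x. f x \<partial>row_law n) - real m * \<delta>} \<le> exp (- 8 * real m * \<delta>\<^sup>2)"
proof -
  interpret S: prob_space "sample_space D m n" by (rule prob_space_sample_space)
  have E: "S.expectation (\<lambda>\<omega>. f (sample_row n k \<omega>)) = (\<integral>x. f x \<partial>row_law n)" if "k < m" for k
    using integral_distr[OF sample_row_measurable[OF that] f] distr_sample_row[OF that] by simp
  interpret H: Hoeffding_ineq "sample_space D m n" "{..<m}" "\<lambda>k \<omega>. f (sample_row n k \<omega>)"
      "\<lambda>_. 0" "\<lambda>_. 1 / 2" "\<Sum>k<m. S.expectation (\<lambda>\<omega>. f (sample_row n k \<omega>))"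
  proof unfold_locales
    show "S.indep_vars (\<lambda>_. borel) (\<lambda>k \<omega>. f (sample_row n k \<omega>)) {..<m}"
      by (rule indep_sample_rows[OF f pos(1,2)])
    show "AE \<omega> in sample_space D m n. f (sample_row n k \<omega>) \<in> {0..1 / 2}" for k
      by (rule AE_I2) (simp only: atLeastAtMost_iff range)
  qed simp_all
  have "S.prob {\<omega> \<in> space (sample_space D m n). (\<Sum>k<m. f (sample_row n k \<omega>))
      \<le> (\<Sum>k<m. S.expectation (\<lambda>\<omega>. f (sample_row n k \<omega>))) - real m * \<delta>}
      \<le> exp (- 2 * (real m * \<delta>)\<^sup>2 / (\<Sum>k<m. (1 / 2 - 0)\<^sup>2))"
    using pos by (intro H.Hoeffding_ineq_le) auto
  \<comment> \<open>The m ranges have length 1/2, so their squares sum to m / 4.\<close>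
  also have "- 2 * (real m * \<delta>)\<^sup>2 / (\<Sum>k<m. (1 / 2 - 0)\<^sup>2) = - 8 * real m * \<delta>\<^sup>2"
    using pos by (simp add: power2_eq_square field_simps)
  finally show ?thesis by (simp add: E)
qed

end

subsection \<open>Uniform lower bound over the cone\<close>

lemma qform_cong: "(\<And>i. i < n \<Longrightarrow> x i = y i) \<Longrightarrow> qform n M x = qform n M y"
  unfolding qform_def by (intro sum.cong refl) simp

text \<open>Defined for arbitrary coefficients because net points are such; for the coefficients
  symbol_test / (2 n) of a symmetric Toeplitz matrix it is the quadratic form.\<close>

definition symbol_comb :: "nat \<Rightarrow> (nat \<Rightarrow> real) \<Rightarrow> (nat \<Rightarrow> real) \<Rightarrow> real" where
  "symbol_comb n d x = (\<Sum>j<2 * n. d j * autocorr n j x)"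

definition tame :: "nat \<Rightarrow> real \<Rightarrow> (nat \<Rightarrow> real) \<Rightarrow> bool" where
  "tame n B x \<longleftrightarrow> (\<forall>j<2 * n. \<bar>autocorr n j x\<bar> \<le> B)"

text \<open>Samples that are not tame are discarded; this is harmless for a lower bound and makes every
  atom of the Maurey approximation bounded.\<close>

definition clipped :: "nat \<Rightarrow> real \<Rightarrow> (nat \<Rightarrow> real) \<Rightarrow> (nat \<Rightarrow> real) \<Rightarrow> real" where
  "clipped n B d x = (if tame n B x then min \<bar>symbol_comb n d x\<bar> (1 / 2) else 0)"

definition gram :: "nat \<Rightarrow> real \<Rightarrow> nat \<Rightarrow> nat \<Rightarrow> (nat \<Rightarrow> real) \<Rightarrow> real" where
  "gram n B i j x = (if tame n B x then autocorr n i x * autocorr n j x else 0)"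

lemma clipped_range: "0 \<le> clipped n B d x \<and> clipped n B d x \<le> 1 / 2"
  by (auto simp: clipped_def min_def)

lemma clipped_le: "clipped n B d x \<le> \<bar>symbol_comb n d x\<bar>"
  by (simp add: clipped_def)

lemma qform_gram:
  "(\<Sum>i<2 * n. \<Sum>j<2 * n. v i * gram n B i j x * v j) = (if tame n B x then (symbol_comb n v x)\<^sup>2 else 0)"
proof (cases "tame n B x")
  case True
  then show ?thesis
    by (simp add: gram_def symbol_comb_def power2_eq_square sum_product mult_ac)
qed (simp add: gram_def)

text \<open>Truncation at 1/2 is 1-Lipschitz, and |u| \<le> \<delta>/2 + u^2 / (2 \<delta>) passes
  from absolute values to the quadratic form that Maurey's method controls.\<close>

lemma clipped_diff_le:
  assumes "0 < \<delta>"
  shows "\<bar>clipped n B c x - clipped n B d x\<bar>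
       \<le> \<delta> / 2 + (\<Sum>i<2 * n. \<Sum>j<2 * n. (c i - d i) * gram n B i j x * (c j - d j)) / (2 * \<delta>)"
proof (cases "tame n B x")
  case True
  define u where "u = symbol_comb n (\<lambda>i. c i - d i) x"
  have u: "u = symbol_comb n c x - symbol_comb n d x"
    by (simp add: u_def symbol_comb_def left_diff_distrib sum_subtractf)
  have "\<bar>clipped n B c x - clipped n B d x\<bar> \<le> \<bar>u\<bar>"
    using True by (auto simp: clipped_def u min_def abs_if split: if_splits)
  also have "\<dots> \<le> \<delta> / 2 + u\<^sup>2 / (2 * \<delta>)"
  proof -
    have "0 \<le> (\<delta> - \<bar>u\<bar>)\<^sup>2 / (2 * \<delta>)" using assms by simp
    also have "\<dots> = \<delta> / 2 + u\<^sup>2 / (2 * \<delta>) - \<bar>u\<bar>"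
      using assms by (simp add: power2_diff field_simps power2_eq_square[of \<delta>])
    finally show ?thesis by simp
  qed
  also have "u\<^sup>2 = (\<Sum>i<2 * n. \<Sum>j<2 * n. (c i - d i) * gram n B i j x * (c j - d j))"
    using True by (simp add: qform_gram u_def)
  finally show ?thesis .
next
  case False
  then show ?thesis using assms by (simp add: qform_gram clipped_def)
qed

context unit_subgaussian
begin

lemma tame_measurable [measurable]: "Measurable.pred (row_law n) (tame n B)"
proof -
  have [measurable]: "autocorr n j \<in> borel_measurable (row_law n)" for j by (rule autocorr_measurable)
  show ?thesis unfolding tame_def[abs_def] by measurable
qed

lemma symbol_comb_measurable [measurable]: "symbol_comb n d \<in> borel_measurable (row_law n)"
  unfolding symbol_comb_def[abs_def]
  by (intro borel_measurable_sum borel_measurable_times borel_measurable_const autocorr_measurable)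

lemma clipped_measurable [measurable]: "clipped n B d \<in> borel_measurable (row_law n)"
  unfolding clipped_def[abs_def] by measurable

lemma integrable_clipped: "integrable (row_law n) (clipped n B d)"
proof -
  interpret R: prob_space "row_law n" by (rule prob_space_row_law)
  show ?thesis
    using clipped_range by (intro R.integrable_const_bound[where B = "1 / 2"] AE_I2 clipped_measurable) auto
qed

lemma gram_bounds:
  assumes "i < 2 * n" "j < 2 * n" "0 \<le> B"
  shows "\<bar>gram n B i j x\<bar> \<le> B\<^sup>2"
  using assms by (auto simp: gram_def tame_def abs_mult power2_eq_square intro!: mult_mono)

lemma integrable_gram:
  assumes "i < 2 * n" "j < 2 * n" "0 \<le> B"
  shows "integrable (row_law n) (gram n B i j)"
proof -
  interpret R: prob_space "row_law n" by (rule prob_space_row_law)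
  have [measurable]: "autocorr n j \<in> borel_measurable (row_law n)" for j by (rule autocorr_measurable)
  have "gram n B i j \<in> borel_measurable (row_law n)" unfolding gram_def[abs_def] by measurable
  then show ?thesis
    using gram_bounds[OF assms] by (intro R.integrable_const_bound[where B = "B\<^sup>2"] AE_I2) auto
qed

text \<open>At least half of the small ball probability survives the removal of the rows that are
  not tame, and there the clipped value is exactly 1/2.\<close>

lemma clipped_mean_ge:
  assumes n: "0 < n" and M: "toeplitz n M" "sym_matrix n M" "frob_norm n M = 1"
    and tame: "measure (row_law n) {x \<in> space (row_law n). \<not> tame n B x} \<le> small_ball_const / 2"
  shows "small_ball_const / 4 \<le> (\<integral>x. clipped n B (\<lambda>j. symbol_test n M j / (2 * real n)) x \<partial>row_law n)"
proof -
  interpret R: prob_space "row_law n" by (rule prob_space_row_law)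
  let ?c = "\<lambda>j. symbol_test n M j / (2 * real n)"
  have X: "symbol_comb n ?c x = qform n M x" for x
    using qform_toeplitz_eq[OF n M(1,2), of x] by (simp add: symbol_comb_def)
  let ?A = "{x \<in> space (row_law n). 1 / 2 \<le> \<bar>symbol_comb n ?c x\<bar>}"
  let ?B = "{x \<in> space (row_law n). \<not> tame n B x}"
  have m: "?A \<in> sets (row_law n)" "?B \<in> sets (row_law n)" by measurable
  have "small_ball_const \<le> R.prob ?A" using qform_small_ball[OF n M] by (simp only: X)
  also have "\<dots> \<le> R.prob ((?A - ?B) \<union> ?B)" using m by (intro R.finite_measure_mono) auto
  also have "\<dots> \<le> R.prob (?A - ?B) + R.prob ?B" using m by (intro measure_Un_le) auto
  finally have P: "small_ball_const / 2 \<le> R.prob (?A - ?B)" using tame by linarith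
  have "small_ball_const / 4 \<le> 1 / 2 * R.prob (?A - ?B)" using P by simp
  also have "\<dots> = (\<integral>x. 1 / 2 * indicator (?A - ?B) x \<partial>row_law n)" using m by simp
  also have "\<dots> \<le> (\<integral>x. clipped n B ?c x \<partial>row_law n)"
  proof (rule Bochner_Integration.integral_mono)
    show "integrable (row_law n) (\<lambda>x. 1 / 2 * indicator (?A - ?B) x :: real)"
      using m by (intro integrable_mult_right integrable_real_indicator) (auto simp: R.emeasure_eq_measure)
    show "integrable (row_law n) (clipped n B ?c)" by (rule integrable_clipped)
    show "1 / 2 * indicator (?A - ?B) x \<le> clipped n B ?c x" if "x \<in> space (row_law n)" for x
      using clipped_range[of n B ?c x] that by (auto simp: clipped_def indicator_def)
  qed
  finally show ?thesis .
qed

text \<open>The Gram matrix adds the population and the empirical second moments, so that one net point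
  approximates \<open>c\<close> for both measures at once.\<close>

lemma clipped_net:
  fixes xs :: "nat \<Rightarrow> nat \<Rightarrow> real"
  assumes net: "\<And>G b c. psd (2 * n) G \<Longrightarrow> (\<And>j. j < 2 * n \<Longrightarrow> G j j \<le> b) \<Longrightarrow> (\<Sum>j<2 * n. \<bar>c j\<bar>) \<le> \<Lambda> \<Longrightarrow>
       \<exists>d\<in>T. qform (2 * n) G (\<lambda>i. c i - d i) \<le> \<Lambda>\<^sup>2 * b / real q"
    and c: "(\<Sum>j<2 * n. \<bar>c j\<bar>) \<le> \<Lambda>" and pos: "0 < \<delta>" "0 \<le> B" "0 < m" "0 < q"
    and q: "\<Lambda>\<^sup>2 * B\<^sup>2 / \<delta>\<^sup>2 \<le> real q"
  obtains d where "d \<in> T"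
    "\<bar>(\<integral>x. clipped n B c x \<partial>row_law n) - (\<integral>x. clipped n B d x \<partial>row_law n)\<bar>
      + (\<Sum>k<m. \<bar>clipped n B c (xs k) - clipped n B d (xs k)\<bar>) / real m \<le> 2 * \<delta>"
proof -
  interpret R: prob_space "row_law n" by (rule prob_space_row_law)
  let ?N = "2 * n"
  define G where "G i j = (\<integral>x. gram n B i j x \<partial>row_law n) + (\<Sum>k<m. gram n B i j (xs k)) / real m" for i j
  have G: "qform ?N G v = (\<integral>x. (\<Sum>i<?N. \<Sum>j<?N. v i * gram n B i j x * v j) \<partial>row_law n)
      + (\<Sum>k<m. \<Sum>i<?N. \<Sum>j<?N. v i * gram n B i j (xs k) * v j) / real m" for v
  proof -
    have int: "integrable (row_law n) (\<lambda>x. v i * gram n B i j x * v j)" if "i \<in> {..<?N}" "j \<in> {..<?N}" for i j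
      using integrable_gram[of i n j B] that pos(2) by simp
    have "(\<integral>x. (\<Sum>i<?N. \<Sum>j<?N. v i * gram n B i j x * v j) \<partial>row_law n)
        = (\<Sum>i<?N. \<Sum>j<?N. \<integral>x. v i * gram n B i j x * v j \<partial>row_law n)"
      by (intro Bochner_Integration.integral_sum[THEN trans] sum.cong refl Bochner_Integration.integrable_sum int)
    also have "\<dots> = (\<Sum>i<?N. \<Sum>j<?N. v i * (\<integral>x. gram n B i j x \<partial>row_law n) * v j)" by simp
    finally have 1: "(\<integral>x. (\<Sum>i<?N. \<Sum>j<?N. v i * gram n B i j x * v j) \<partial>row_law n)
        = (\<Sum>i<?N. \<Sum>j<?N. v i * (\<integral>x. gram n B i j x \<partial>row_law n) * v j)" .
    have "(\<Sum>k<m. \<Sum>i<?N. \<Sum>j<?N. v i * gram n B i j (xs k) * v j) / real m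
        = (\<Sum>i<?N. \<Sum>j<?N. \<Sum>k<m. v i * gram n B i j (xs k) * v j / real m)"
      unfolding sum_divide_distrib by (rule sum_swap3)
    also have "\<dots> = (\<Sum>i<?N. \<Sum>j<?N. v i * ((\<Sum>k<m. gram n B i j (xs k)) / real m) * v j)"
      by (simp add: sum_divide_distrib sum_distrib_left sum_distrib_right)
    finally have 2: "(\<Sum>k<m. \<Sum>i<?N. \<Sum>j<?N. v i * gram n B i j (xs k) * v j) / real m
        = (\<Sum>i<?N. \<Sum>j<?N. v i * ((\<Sum>k<m. gram n B i j (xs k)) / real m) * v j)" .
    show ?thesis unfolding 1 2 qform_def G_def sum.distrib[symmetric]
      by (intro sum.cong refl) (simp add: distrib_left distrib_right)
  qed
  have "psd ?N G"
    unfolding psd_def sym_matrix_def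
  proof (intro conjI allI impI)
    have "gram n B i j = gram n B j i" for i j by (simp add: gram_def fun_eq_iff mult.commute)
    then show "G i j = G j i" for i j by (simp add: G_def)
    fix v :: "nat \<Rightarrow> real"
    have "0 \<le> qform ?N G v"
      unfolding G qform_gram
      by (intro add_nonneg_nonneg Bochner_Integration.integral_nonneg divide_nonneg_nonneg sum_nonneg) auto
    then show "0 \<le> (\<Sum>i<?N. \<Sum>j<?N. v i * G i j * v j)" by (simp add: qform_def)
  qed
  \<comment> \<open>Each of the two averages contributes at most B^2, since untame rows enter as
    0.\<close>
  moreover have "G j j \<le> 2 * B\<^sup>2" if j: "j < ?N" for j
  proof -
    have b: "gram n B j j x \<le> B\<^sup>2" for x using gram_bounds[OF j j pos(2), of x] by linarith
    have "(\<integral>x. gram n B j j x \<partial>row_law n) \<le> (\<integral>x. B\<^sup>2 \<partial>row_law n)"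
      using b by (intro Bochner_Integration.integral_mono integrable_gram[OF j j pos(2)]) auto
    then have "(\<integral>x. gram n B j j x \<partial>row_law n) \<le> B\<^sup>2" by (simp add: R.prob_space)
    moreover have "(\<Sum>k<m. gram n B j j (xs k)) \<le> (\<Sum>k<m. B\<^sup>2)" using b by (intro sum_mono)
    then have "(\<Sum>k<m. gram n B j j (xs k)) / real m \<le> B\<^sup>2"
      using pos(3) by (simp add: divide_le_eq mult.commute)
    ultimately show ?thesis by (simp add: G_def)
  qed
  ultimately obtain d where d: "d \<in> T" "qform ?N G (\<lambda>i. c i - d i) \<le> \<Lambda>\<^sup>2 * (2 * B\<^sup>2) / real q"
    using net[OF _ _ c] by blast
  have "\<Lambda>\<^sup>2 * B\<^sup>2 \<le> real q * \<delta>\<^sup>2" using q pos(1) by (simp add: divide_le_eq)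
  then have "\<Lambda>\<^sup>2 * (2 * B\<^sup>2) / real q \<le> 2 * \<delta>\<^sup>2" using pos(4) by (simp add: divide_le_eq mult_ac)
  then have Q: "qform ?N G (\<lambda>i. c i - d i) \<le> 2 * \<delta>\<^sup>2" using d(2) by linarith
  let ?g = "\<lambda>x. \<Sum>i<?N. \<Sum>j<?N. (c i - d i) * gram n B i j x * (c j - d j)"
  have gi: "integrable (row_law n) ?g"
    using integrable_gram[of _ n _ B] pos(2)
    by (intro Bochner_Integration.integrable_sum integrable_mult_left integrable_mult_right) auto
  have "\<bar>(\<integral>x. clipped n B c x \<partial>row_law n) - (\<integral>x. clipped n B d x \<partial>row_law n)\<bar>
      = \<bar>\<integral>x. clipped n B c x - clipped n B d x \<partial>row_law n\<bar>"
    by (simp add: integrable_clipped)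
  also have "\<dots> \<le> (\<integral>x. \<bar>clipped n B c x - clipped n B d x\<bar> \<partial>row_law n)"
    by (rule integral_abs_bound)
  also have "\<dots> \<le> (\<integral>x. \<delta> / 2 + ?g x / (2 * \<delta>) \<partial>row_law n)"
    using gi by (intro Bochner_Integration.integral_mono clipped_diff_le[OF pos(1)])
      (auto intro!: integrable_abs Bochner_Integration.integrable_diff integrable_clipped)
  also have "\<dots> = \<delta> / 2 + (\<integral>x. ?g x \<partial>row_law n) / (2 * \<delta>)"
    using gi by (simp add: R.prob_space)
  finally have 1: "\<bar>(\<integral>x. clipped n B c x \<partial>row_law n) - (\<integral>x. clipped n B d x \<partial>row_law n)\<bar>
      \<le> \<delta> / 2 + (\<integral>x. ?g x \<partial>row_law n) / (2 * \<delta>)" .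
  have "(\<Sum>k<m. \<bar>clipped n B c (xs k) - clipped n B d (xs k)\<bar>) / real m
      \<le> (\<Sum>k<m. \<delta> / 2 + ?g (xs k) / (2 * \<delta>)) / real m"
    by (intro divide_right_mono sum_mono clipped_diff_le[OF pos(1)]) simp
  also have "\<dots> = \<delta> / 2 + ((\<Sum>k<m. ?g (xs k)) / real m) / (2 * \<delta>)"
    using pos(3) by (simp add: sum.distrib add_divide_distrib sum_divide_distrib[symmetric])
  finally have 2: "(\<Sum>k<m. \<bar>clipped n B c (xs k) - clipped n B d (xs k)\<bar>) / real m
      \<le> \<delta> / 2 + ((\<Sum>k<m. ?g (xs k)) / real m) / (2 * \<delta>)" .
  \<comment> \<open>The two constants \<delta>/2 use up one \<delta>; the choice of q makes the
    combined quadratic terms cost at most one more.\<close>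
  have "(\<integral>x. ?g x \<partial>row_law n) / (2 * \<delta>) + ((\<Sum>k<m. ?g (xs k)) / real m) / (2 * \<delta>)
      = qform ?N G (\<lambda>i. c i - d i) / (2 * \<delta>)"
    unfolding G by (rule add_divide_distrib[symmetric])
  also have "\<dots> \<le> 2 * \<delta>\<^sup>2 / (2 * \<delta>)" using Q pos(1) by (intro divide_right_mono) auto
  also have "\<dots> = \<delta>" using pos(1) by (simp add: power2_eq_square)
  finally have "\<bar>(\<integral>x. clipped n B c x \<partial>row_law n) - (\<integral>x. clipped n B d x \<partial>row_law n)\<bar>
      + (\<Sum>k<m. \<bar>clipped n B c (xs k) - clipped n B d (xs k)\<bar>) / real m \<le> 2 * \<delta>"
    using 1 2 by linarith
  then show thesis using that[OF d(1)] by blast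
qed

text \<open>Budget in units of \<delta>: the clipped mean is at least 6, Hoeffding at the net point
  loses 1, and the two approximations together lose 2, which leaves 3. This fixes \<delta> as 1/24
  of the small ball constant.\<close>

lemma qform_rows_lower_bound:
  fixes n m q :: nat and \<Lambda> B \<delta> :: real
  assumes n: "0 < n" and m: "0 < m" and pos: "0 < \<Lambda>" "0 \<le> B" "0 < q"
    and \<delta>: "\<delta> = small_ball_const / 24"
    and tame: "measure (row_law n) {x \<in> space (row_law n). \<not> tame n B x} \<le> small_ball_const / 2"
    and q: "\<Lambda>\<^sup>2 * B\<^sup>2 / \<delta>\<^sup>2 \<le> real q"
  obtains E where "E \<in> sets (sample_space D m n)"
    "1 - real ((6 * n) ^ q) * exp (- 8 * real m * \<delta>\<^sup>2) \<le> measure (sample_space D m n) E"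
    "\<And>\<omega> M. \<omega> \<in> E \<Longrightarrow> toeplitz n M \<Longrightarrow> sym_matrix n M \<Longrightarrow> frob_norm n M = 1 \<Longrightarrow>
       (\<Sum>j<2 * n. \<bar>symbol_test n M j\<bar>) \<le> 2 * real n * \<Lambda> \<Longrightarrow>
       real m * (small_ball_const / 8) \<le> (\<Sum>k<m. \<bar>qform n M (\<lambda>j. \<omega> (k, j))\<bar>)"
proof -
  interpret S: prob_space "sample_space D m n" by (rule prob_space_sample_space)
  let ?S = "sample_space D m n"
  have d0: "0 < \<delta>" using small_ball_const by (simp add: \<delta>)
  obtain T where T: "finite T" "card T \<le> (3 * (2 * n)) ^ q"
    "\<And>G b c. psd (2 * n) G \<Longrightarrow> (\<And>j. j < 2 * n \<Longrightarrow> G j j \<le> b) \<Longrightarrow> (\<Sum>j<2 * n. \<bar>c j\<bar>) \<le> \<Lambda> \<Longrightarrow>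
       \<exists>d\<in>T. qform (2 * n) G (\<lambda>i. c i - d i) \<le> \<Lambda>\<^sup>2 * b / real q"
    using maurey_net[of \<Lambda> "2 * n" q] pos n by auto
  define bad where "bad d = {\<omega> \<in> space ?S. (\<Sum>k<m. clipped n B d (sample_row n k \<omega>))
      \<le> real m * (\<integral>x. clipped n B d x \<partial>row_law n) - real m * \<delta>}" for d
  have badm: "bad d \<in> sets ?S" for d
    unfolding bad_def
    by (intro borel_measurable_le borel_measurable_sum borel_measurable_const
          measurable_compose[OF sample_row_measurable clipped_measurable]) auto
  have badp: "measure ?S (bad d) \<le> exp (- 8 * real m * \<delta>\<^sup>2)" for d
    unfolding bad_def using m n d0 by (intro sample_rows_hoeffding clipped_measurable clipped_range) auto
  define E where "E = space ?S - (\<Union>d\<in>T. bad d)"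
  have U: "(\<Union>d\<in>T. bad d) \<in> sets ?S" using badm T(1) by auto
  have Em: "E \<in> sets ?S" unfolding E_def using U by auto
  have "measure ?S (\<Union>d\<in>T. bad d) \<le> (\<Sum>d\<in>T. measure ?S (bad d))"
    using T(1) badm by (intro measure_UNION_le) auto
  also have "\<dots> \<le> (\<Sum>d\<in>T. exp (- 8 * real m * \<delta>\<^sup>2))" by (intro sum_mono badp)
  also have "\<dots> = real (card T) * exp (- 8 * real m * \<delta>\<^sup>2)" by simp
  also have "\<dots> \<le> real ((6 * n) ^ q) * exp (- 8 * real m * \<delta>\<^sup>2)"
    using T(2) by (intro mult_right_mono of_nat_mono) auto
  finally have "measure ?S (\<Union>d\<in>T. bad d) \<le> real ((6 * n) ^ q) * exp (- 8 * real m * \<delta>\<^sup>2)" .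
  then have Ep: "1 - real ((6 * n) ^ q) * exp (- 8 * real m * \<delta>\<^sup>2) \<le> measure ?S E"
    unfolding E_def using S.prob_compl[OF U] by simp
  show thesis
  proof (rule that[OF Em Ep])
    fix \<omega> M
    assume \<omega>: "\<omega> \<in> E" and M: "toeplitz n M" "sym_matrix n M" "frob_norm n M = 1"
      and L: "(\<Sum>j<2 * n. \<bar>symbol_test n M j\<bar>) \<le> 2 * real n * \<Lambda>"
    define c where "c j = symbol_test n M j / (2 * real n)" for j
    define xs where "xs k = sample_row n k \<omega>" for k
    let ?I = "\<lambda>d. \<integral>x. clipped n B d x \<partial>row_law n"
    have cL: "(\<Sum>j<2 * n. \<bar>c j\<bar>) \<le> \<Lambda>"
      using L n by (simp add: c_def sum_divide_distrib[symmetric] divide_le_eq mult.commute)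
    obtain d where d: "d \<in> T"
      "\<bar>?I c - ?I d\<bar> + (\<Sum>k<m. \<bar>clipped n B c (xs k) - clipped n B d (xs k)\<bar>) / real m \<le> 2 * \<delta>"
      using clipped_net[OF T(3) cL d0 pos(2) m pos(3) q, of xs] by blast
    have "\<omega> \<notin> bad d" "\<omega> \<in> space ?S" using \<omega> d(1) by (auto simp: E_def)
    then have h: "real m * ?I d - real m * \<delta> < (\<Sum>k<m. clipped n B d (xs k))"
      by (simp add: bad_def xs_def)
    have "6 * \<delta> \<le> ?I c"
      using clipped_mean_ge[OF n M tame] by (simp add: \<delta> c_def[abs_def])
    have "(\<Sum>k<m. clipped n B d (xs k)) - (\<Sum>k<m. clipped n B c (xs k))
        \<le> (\<Sum>k<m. \<bar>clipped n B c (xs k) - clipped n B d (xs k)\<bar>)"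
      unfolding sum_subtractf[symmetric] by (intro sum_mono) linarith
    also have "\<dots> \<le> real m * (2 * \<delta> - \<bar>?I c - ?I d\<bar>)"
      using d(2) m by (simp add: field_simps)
    finally have "(\<Sum>k<m. clipped n B d (xs k)) - real m * (2 * \<delta> - \<bar>?I c - ?I d\<bar>) \<le> (\<Sum>k<m. clipped n B c (xs k))"
      by linarith
    moreover have "real m * (3 * \<delta>) \<le> real m * ?I d - real m * \<delta> - real m * (2 * \<delta> - \<bar>?I c - ?I d\<bar>)"
    proof -
      have "3 * \<delta> \<le> ?I d - \<delta> - (2 * \<delta> - \<bar>?I c - ?I d\<bar>)" using \<open>6 * \<delta> \<le> ?I c\<close> by linarith
      then have "real m * (3 * \<delta>) \<le> real m * (?I d - \<delta> - (2 * \<delta> - \<bar>?I c - ?I d\<bar>))"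
        by (intro mult_left_mono) auto
      then show ?thesis by (simp only: right_diff_distrib)
    qed
    ultimately have "real m * (3 * \<delta>) \<le> (\<Sum>k<m. clipped n B c (xs k))" using h by linarith
    also have "\<dots> \<le> (\<Sum>k<m. \<bar>qform n M (\<lambda>j. \<omega> (k, j))\<bar>)"
    proof (intro sum_mono)
      fix k
      have "clipped n B c (xs k) \<le> \<bar>symbol_comb n c (xs k)\<bar>" by (rule clipped_le)
      also have "symbol_comb n c (xs k) = qform n M (xs k)"
        using qform_toeplitz_eq[OF n M(1,2)] by (simp add: symbol_comb_def c_def)
      also have "\<dots> = qform n M (\<lambda>j. \<omega> (k, j))"
        by (rule qform_cong) (simp add: xs_def sample_row_def)
      finally show "clipped n B c (xs k) \<le> \<bar>qform n M (\<lambda>j. \<omega> (k, j))\<bar>" .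
    qed
    finally show "real m * (small_ball_const / 8) \<le> (\<Sum>k<m. \<bar>qform n M (\<lambda>j. \<omega> (k, j))\<bar>)"
      by (simp add: \<delta>)
  qed
qed

end

subsection \<open>Recovery\<close>

lemma vnorm_eq_L2_set: "vnorm m v = L2_set v {..<m}"
  by (simp add: vnorm_def L2_set_def)

lemma meas_op_eq_qform: "meas_op n a M k = qform n M (a k)"
  by (simp add: meas_op_def qform_def)

text \<open>The cone condition and the lower bound are homogeneous, so the error is first scaled to
  Frobenius norm one. \<Sigma> is itself feasible, which gives the trace inequality; the 2 in the
  constant counts the residuals of \<Sigma> and of the minimizer.\<close>

lemma trace_min_error_bound:
  fixes \<kappa> :: real
  assumes n: "0 < n" and m: "0 < m" and \<kappa>: "0 < \<kappa>"
    and lower: "\<And>M. toeplitz n M \<Longrightarrow> sym_matrix n M \<Longrightarrow> frob_norm n M = 1 \<Longrightarrow>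
       (\<Sum>j<2 * n. \<bar>symbol_test n M j\<bar>) \<le> 2 * real n * (6 * sqrt (real r)) \<Longrightarrow>
       real m * \<kappa> \<le> (\<Sum>k<m. \<bar>qform n M (a k)\<bar>)"
    and \<Sigma>: "psd n \<Sigma>" "toeplitz n \<Sigma>" "mrank n \<Sigma> \<le> r" and \<eta>: "vnorm m \<eta> \<le> eps"
    and Sh: "trace_min n m a (\<lambda>k. meas_op n a \<Sigma> k + \<eta> k) eps Sh"
  shows "frob_norm n (\<lambda>i j. Sh i j - \<Sigma> i j) \<le> 2 / \<kappa> * eps / sqrt (real m)"
proof -
  define H where "H i j = Sh i j - \<Sigma> i j" for i j
  define F where "F = frob_norm n H"
  have Shp: "psd n Sh" "toeplitz n Sh"
    and feas: "vnorm m (\<lambda>k. meas_op n a \<Sigma> k + \<eta> k - meas_op n a Sh k) \<le> eps"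
    and min: "\<And>M. psd n M \<Longrightarrow> vnorm m (\<lambda>k. meas_op n a \<Sigma> k + \<eta> k - meas_op n a M k) \<le> eps \<Longrightarrow>
        toeplitz n M \<Longrightarrow> mtrace n Sh \<le> mtrace n M"
    using Sh by (auto simp: trace_min_def)
  have tr: "mtrace n Sh \<le> mtrace n \<Sigma>" using min[OF \<Sigma>(1) _ \<Sigma>(2)] \<eta> by simp
  have sym: "sym_matrix n \<Sigma>" using \<Sigma>(1) by (simp add: psd_def)
  have Ht: "toeplitz n H" using Shp(2) \<Sigma>(2) by (simp add: toeplitz_def H_def)
  have Hs: "sym_matrix n H" using Shp(1) sym by (simp add: psd_def sym_matrix_def H_def)
  have eps: "0 \<le> eps" using \<eta> by (rule order_trans[rotated]) (simp add: vnorm_def sum_nonneg)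
  have F0: "0 \<le> F" by (simp add: F_def frob_norm_def sum_nonneg)
  have "F \<le> 2 / \<kappa> * eps / sqrt (real m)"
  proof (cases "F = 0")
    case True
    then show ?thesis using \<kappa> eps by simp
  next
    case False
    then have F: "0 < F" using F0 by simp
    define M where "M i j = H i j / F" for i j
    have Mt: "toeplitz n M" using Ht by (simp add: toeplitz_def M_def)
    have Ms: "sym_matrix n M" using Hs by (simp add: sym_matrix_def M_def)
    have "frob_norm n M = frob_norm n H / F"
      using F by (simp add: frob_norm_def M_def power_divide sum_divide_distrib[symmetric] real_sqrt_divide)
    then have M1: "frob_norm n M = 1" using F by (simp add: F_def)
    have symb: "symbol_test n M j = symbol_test n H j / F" for j
      by (simp add: symbol_test_def M_def sum_divide_distrib)
    have "(\<Sum>j<2 * n. \<bar>symbol_test n M j\<bar>) = (\<Sum>j<2 * n. \<bar>symbol_test n H j\<bar>) / F"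
      using F by (simp add: symb sum_divide_distrib)
    also have "\<dots> \<le> 2 * real n * (6 * sqrt (real r))"
      using sum_abs_symbol_test_le[OF sym Shp(1) tr \<Sigma>(3)] F
      by (simp add: divide_le_eq F_def H_def[abs_def] mult_ac)
    finally have "real m * \<kappa> \<le> (\<Sum>k<m. \<bar>qform n M (a k)\<bar>)" by (rule lower[OF Mt Ms M1])
    also have "\<dots> = (\<Sum>k<m. \<bar>qform n H (a k)\<bar>) / F"
    proof -
      have "qform n M x = qform n H x / F" for x by (simp add: qform_def M_def sum_divide_distrib)
      then show ?thesis using F by (simp add: sum_divide_distrib)
    qed
    finally have 1: "real m * \<kappa> * F \<le> (\<Sum>k<m. \<bar>qform n H (a k)\<bar>)"
      using F by (simp add: le_divide_eq)
    have 2: "(\<Sum>k<m. \<bar>qform n H (a k)\<bar>) \<le> vnorm m (\<lambda>k. qform n H (a k)) * sqrt (real m)"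
      using sum_mult_le_sqrt[of "\<lambda>k. qform n H (a k)" "\<lambda>_. 1" "{..<m}"] by (simp add: vnorm_def)
    have 3: "vnorm m (\<lambda>k. qform n H (a k)) \<le> 2 * eps"
    proof -
      have q: "qform n H (a k) = \<eta> k + - (meas_op n a \<Sigma> k + \<eta> k - meas_op n a Sh k)" for k
        by (simp add: meas_op_eq_qform qform_def H_def algebra_simps sum_subtractf)
      have "vnorm m (\<lambda>k. qform n H (a k))
          \<le> vnorm m \<eta> + vnorm m (\<lambda>k. - (meas_op n a \<Sigma> k + \<eta> k - meas_op n a Sh k))"
        unfolding vnorm_eq_L2_set q by (rule L2_set_triangle_ineq)
      also have "vnorm m (\<lambda>k. - (meas_op n a \<Sigma> k + \<eta> k - meas_op n a Sh k))
          = vnorm m (\<lambda>k. meas_op n a \<Sigma> k + \<eta> k - meas_op n a Sh k)"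
        unfolding vnorm_def by (simp only: power2_minus)
      finally show ?thesis using \<eta> feas by linarith
    qed
    have "(F * \<kappa> * sqrt (real m)) * sqrt (real m) = real m * \<kappa> * F"
      by (simp add: mult_ac)
    also have "\<dots> \<le> 2 * eps * sqrt (real m)"
      using 1 2 mult_right_mono[OF 3, of "sqrt (real m)"] by simp
    finally have "F * \<kappa> * sqrt (real m) \<le> 2 * eps" using m by (simp add: mult_le_cancel_right)
    then show ?thesis using \<kappa> m by (simp add: field_simps)
  qed
  then show ?thesis by (simp add: F_def H_def[abs_def])
qed

section \<open>Choice of constants and exceptional cases\<close>

lemma one_add_ln_le:
  assumes "2 \<le> n"
  shows "1 + ln (real n) \<le> 3 * ln (real n)"
proof -
  have "1 / 2 \<le> ln (2 :: real)" using ln2_ge_two_thirds by linarith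
  also have "\<dots> \<le> ln (real n)" using assms by simp
  finally show ?thesis by linarith
qed

context unit_subgaussian
begin

text \<open>Serves rank 0, where the cone condition says that the symbol vanishes: then the form
  would vanish everywhere, against the small ball estimate.\<close>

lemma sum_abs_symbol_test_pos:
  assumes "0 < n" "toeplitz n M" "sym_matrix n M" "frob_norm n M = 1"
  shows "0 < (\<Sum>j<2 * n. \<bar>symbol_test n M j\<bar>)"
proof (rule ccontr)
  assume "\<not> ?thesis"
  then have "(\<Sum>j<2 * n. \<bar>symbol_test n M j\<bar>) = 0" by (intro antisym) (auto intro: sum_nonneg)
  then have "symbol_test n M j = 0" if "j < 2 * n" for j
    using that by (simp add: sum_nonneg_eq_0_iff)
  then have "qform n M x = 0" for x using qform_toeplitz_eq[OF assms(1-3), of x] by simp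
  then show False using qform_small_ball[OF assms] small_ball_const(1) by simp
qed

lemma sample_rows_lower_bound:
  obtains c0 where "0 < c0"
    "\<And>n m r. 2 \<le> n \<Longrightarrow> 0 < r \<Longrightarrow> c0 * real r * ln (real n) ^ 10 < real m \<Longrightarrow>
      \<exists>E \<in> sets (sample_space D m n). 1 - 1 / (real n)\<^sup>2 \<le> measure (sample_space D m n) E \<and>
        (\<forall>\<omega>\<in>E. \<forall>M. toeplitz n M \<longrightarrow> sym_matrix n M \<longrightarrow> frob_norm n M = 1 \<longrightarrow>
           (\<Sum>j<2 * n. \<bar>symbol_test n M j\<bar>) \<le> 2 * real n * (6 * sqrt (real r)) \<longrightarrow>
           real m * (small_ball_const / 8) \<le> (\<Sum>k<m. \<bar>qform n M (\<lambda>j. \<omega> (k, j))\<bar>))"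
proof -
  obtain B where B: "0 < B" "\<And>n. 0 < n \<Longrightarrow> measure (row_law n) {x \<in> space (row_law n).
      \<exists>j<2 * n. B * (1 + ln (real n))\<^sup>2 < \<bar>autocorr n j x\<bar>} \<le> small_ball_const / 2"
    using autocorr_bounded_whp[of "small_ball_const / 2"] small_ball_const by auto
  define \<delta> where "\<delta> = small_ball_const / 24"
  have d0: "0 < \<delta>" using small_ball_const by (simp add: \<delta>_def)
  define A where "A = 36 * B\<^sup>2 / \<delta>\<^sup>2 + 1"
  have A1: "1 \<le> A" by (simp add: A_def)
  \<comment> \<open>5 A bounds the logarithm of the net size and 2 accounts for the target
    probability 1 / n^2; 3^10 converts 1 + ln n to ln n, and 8 \<delta>^2 is the Hoeffding exponent
    per row.\<close>
  define c0 where "c0 = (5 * A + 2) * 3 ^ 10 / (8 * \<delta>\<^sup>2)"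
  have "0 < c0" using A1 d0 by (simp add: c0_def)
  moreover have "\<exists>E \<in> sets (sample_space D m n). 1 - 1 / (real n)\<^sup>2 \<le> measure (sample_space D m n) E \<and>
        (\<forall>\<omega>\<in>E. \<forall>M. toeplitz n M \<longrightarrow> sym_matrix n M \<longrightarrow> frob_norm n M = 1 \<longrightarrow>
           (\<Sum>j<2 * n. \<bar>symbol_test n M j\<bar>) \<le> 2 * real n * (6 * sqrt (real r)) \<longrightarrow>
           real m * (small_ball_const / 8) \<le> (\<Sum>k<m. \<bar>qform n M (\<lambda>j. \<omega> (k, j))\<bar>))"
    if n: "2 \<le> n" and r: "0 < r" and m: "c0 * real r * ln (real n) ^ 10 < real m" for n m r :: nat
  proof -
    define ell where "ell = 1 + ln (real n)"
    have ln0: "0 < ln (real n)" using n by simp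
    have l1: "1 \<le> ell" using ln0 by (simp add: ell_def)
    define \<Lambda> where "\<Lambda> = 6 * sqrt (real r)"
    have \<Lambda>: "0 < \<Lambda>" "\<Lambda>\<^sup>2 = 36 * real r" using r by (auto simp: \<Lambda>_def power_mult_distrib)
    define Bn where "Bn = B * ell\<^sup>2"
    define t where "t = \<Lambda>\<^sup>2 * Bn\<^sup>2 / \<delta>\<^sup>2"
    define q where "q = nat \<lceil>t\<rceil>"
    have t: "t = (36 * B\<^sup>2 / \<delta>\<^sup>2) * (real r * ell ^ 4)"
      by (simp add: t_def \<Lambda>(2) Bn_def power_mult_distrib mult_ac)
    have t0: "0 < t" unfolding t using B(1) d0 r l1 by simp
    have qt: "t \<le> real q" "real q \<le> t + 1" and q0: "0 < q"
      using t0 by (auto simp: q_def)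
    have rl: "1 \<le> real r * ell ^ 4" using r l1 mult_mono[of 1 "real r" 1 "ell ^ 4"] by simp
    have qA: "real q \<le> A * (real r * ell ^ 4)"
      using qt(2) rl by (simp add: t A_def distrib_right)
    have m0: "0 < m"
    proof -
      have "0 \<le> c0 * real r * ln (real n) ^ 10" using \<open>0 < c0\<close> ln0 by simp
      then show ?thesis using m by (cases m) auto
    qed
    have tame: "measure (row_law n) {x \<in> space (row_law n). \<not> tame n Bn x} \<le> small_ball_const / 2"
      using B(2)[of n] n by (simp add: tame_def Bn_def ell_def not_le)
    obtain E where E: "E \<in> sets (sample_space D m n)"
      "1 - real ((6 * n) ^ q) * exp (- 8 * real m * \<delta>\<^sup>2) \<le> measure (sample_space D m n) E"
      "\<And>\<omega> M. \<omega> \<in> E \<Longrightarrow> toeplitz n M \<Longrightarrow> sym_matrix n M \<Longrightarrow> frob_norm n M = 1 \<Longrightarrow>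
       (\<Sum>j<2 * n. \<bar>symbol_test n M j\<bar>) \<le> 2 * real n * \<Lambda> \<Longrightarrow>
       real m * (small_ball_const / 8) \<le> (\<Sum>k<m. \<bar>qform n M (\<lambda>j. \<omega> (k, j))\<bar>)"
      using qform_rows_lower_bound[of n m \<Lambda> Bn q \<delta>] n m0 \<Lambda>(1) B(1) q0 tame qt(1)
      by (auto simp: \<delta>_def Bn_def t_def)
    have "real ((6 * n) ^ q) * exp (- 8 * real m * \<delta>\<^sup>2) \<le> 1 / (real n)\<^sup>2"
    proof -
      have "ln (6 * real n) \<le> 5 * ell"
      proof -
        have "ln (6 * real n) = ln 6 + ln (real n)" using n by (simp add: ln_mult)
        also have "ln 6 \<le> (5 :: real)" using ln_le_minus_one[of "6 :: real"] by simp
        finally show ?thesis using ln0 by (simp add: ell_def)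
      qed
      then have "real q * ln (6 * real n) \<le> (A * (real r * ell ^ 4)) * (5 * ell)"
        using qA n by (intro mult_mono) auto
      moreover have "2 * ln (real n) \<le> 2 * (real r * ell ^ 5)"
      proof -
        have "ell * 1 \<le> ell * (real r * ell ^ 4)" using rl l1 by (intro mult_left_mono) auto
        then show ?thesis by (simp add: ell_def[symmetric] eval_nat_numeral mult_ac) (simp add: ell_def)
      qed
      ultimately have "real q * ln (6 * real n) + 2 * ln (real n) \<le> (5 * A + 2) * (real r * ell ^ 5)"
        by (simp add: eval_nat_numeral algebra_simps)
      also have "\<dots> \<le> (5 * A + 2) * (real r * (3 ^ 10 * ln (real n) ^ 10))"
      \<comment> \<open>Four powers of ell stem from the square of the symbol bound and one from ln
        (6 n); ell \<ge> 1 raises them to the tenth power, and ell \<le> 3 ln n for n \<ge>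
        2.\<close>
      proof (intro mult_left_mono)
        have "ell ^ 5 \<le> ell ^ 10" using l1 by (intro power_increasing) auto
        also have "\<dots> \<le> (3 * ln (real n)) ^ 10"
          using one_add_ln_le[OF n] l1 unfolding ell_def by (intro power_mono) auto
        finally show "ell ^ 5 \<le> 3 ^ 10 * ln (real n) ^ 10" by (simp only: power_mult_distrib)
      qed (use A1 in auto)
      also have "\<dots> = 8 * \<delta>\<^sup>2 * (c0 * real r * ln (real n) ^ 10)"
        using d0 by (simp add: c0_def)
      also have "\<dots> \<le> 8 * \<delta>\<^sup>2 * real m" using m by (intro mult_left_mono) auto
      finally have le: "real q * ln (6 * real n) - 8 * real m * \<delta>\<^sup>2 \<le> - (2 * ln (real n))"
        by (simp add: mult_ac)
      have "real ((6 * n) ^ q) * exp (- 8 * real m * \<delta>\<^sup>2) = exp (real q * ln (6 * real n) - 8 * real m * \<delta>\<^sup>2)"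
        using n by (simp add: exp_diff exp_minus exp_of_nat_mult divide_inverse)
      also have "\<dots> \<le> exp (- (2 * ln (real n)))" using le by simp
      also have "\<dots> = 1 / (real n)\<^sup>2"
        using n by (simp add: exp_minus exp_double inverse_eq_divide)
      finally show ?thesis .
    qed
    then have "1 - 1 / (real n)\<^sup>2 \<le> measure (sample_space D m n) E" using E(2) by linarith
    then show ?thesis using E(1,3) unfolding \<Lambda>_def by blast
  qed
  ultimately show thesis using that by blast
qed

end

theorem theorem2:
  fixes D :: "real measure"
  assumes "prob_space D"
    and "sets D = sets borel"
    and "subgaussian D"
    and "integrable D (\<lambda>x. x)" and "(\<integral>x. x \<partial>D) = 0"
    and "integrable D (\<lambda>x. x\<^sup>2)" and "(\<integral>x. x\<^sup>2 \<partial>D) = 1"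
    and "integrable D (\<lambda>x. x ^ 4)"
    and "(\<integral>x. x ^ 4 \<partial>D) > 1"
    and "(\<integral>x. x ^ 4 \<partial>D) \<le> 3"
  shows "\<exists>c0>0. \<exists>C2>0. \<forall>n m r :: nat.
     real m > c0 * real r * (ln (real n)) ^ 10 \<longrightarrow>
     (\<exists>E \<in> sets (sample_space D m n).
        measure (sample_space D m n) E \<ge> 1 - 1 / (real n)\<^sup>2 \<and>
        (\<forall>\<omega>\<in>E. let a = (\<lambda>k j. \<omega> (k, j)) in
           \<forall>\<Sigma> eps2 \<eta> Sh.
             psd n \<Sigma> \<and> toeplitz n \<Sigma> \<and> mrank n \<Sigma> \<le> r \<and> eps2 \<ge> 0 \<and>
             vnorm m \<eta> \<le> eps2 \<and>
             trace_min n m a (\<lambda>k. meas_op n a \<Sigma> k + \<eta> k) eps2 Sh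
             \<longrightarrow> frob_norm n (\<lambda>i j. Sh i j - \<Sigma> i j) \<le> C2 * eps2 / sqrt (real m)))"
proof -
  interpret prob_space D by fact
  obtain K where K: "0 < K" "integrable D (\<lambda>x. exp (x\<^sup>2 / K\<^sup>2))" "(\<integral>x. exp (x\<^sup>2 / K\<^sup>2) \<partial>D) \<le> 2"
    using assms(3) by (auto simp: subgaussian_def)
  interpret U: unit_subgaussian D K
    by unfold_locales (use assms K in auto)
  obtain c0 where c0: "0 < c0"
    and lower: "\<And>n m r. 2 \<le> n \<Longrightarrow> 0 < r \<Longrightarrow> c0 * real r * ln (real n) ^ 10 < real m \<Longrightarrow>
      \<exists>E \<in> sets (sample_space D m n). 1 - 1 / (real n)\<^sup>2 \<le> measure (sample_space D m n) E \<and>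
        (\<forall>\<omega>\<in>E. \<forall>M. toeplitz n M \<longrightarrow> sym_matrix n M \<longrightarrow> frob_norm n M = 1 \<longrightarrow>
           (\<Sum>j<2 * n. \<bar>symbol_test n M j\<bar>) \<le> 2 * real n * (6 * sqrt (real r)) \<longrightarrow>
           real m * (U.small_ball_const / 8) \<le> (\<Sum>k<m. \<bar>qform n M (\<lambda>j. \<omega> (k, j))\<bar>))"
    using U.sample_rows_lower_bound by blast
  define \<kappa> where "\<kappa> = U.small_ball_const / 8"
  have \<kappa>: "0 < \<kappa>" using U.small_ball_const by (simp add: \<kappa>_def)
  have "\<exists>E \<in> sets (sample_space D m n).
        measure (sample_space D m n) E \<ge> 1 - 1 / (real n)\<^sup>2 \<and>
        (\<forall>\<omega>\<in>E. let a = (\<lambda>k j. \<omega> (k, j)) in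
           \<forall>\<Sigma> eps2 \<eta> Sh.
             psd n \<Sigma> \<and> toeplitz n \<Sigma> \<and> mrank n \<Sigma> \<le> r \<and> eps2 \<ge> 0 \<and>
             vnorm m \<eta> \<le> eps2 \<and>
             trace_min n m a (\<lambda>k. meas_op n a \<Sigma> k + \<eta> k) eps2 Sh
             \<longrightarrow> frob_norm n (\<lambda>i j. Sh i j - \<Sigma> i j) \<le> 2 / \<kappa> * eps2 / sqrt (real m))"
    if m: "real m > c0 * real r * ln (real n) ^ 10" for n m r :: nat
  proof -
    interpret S: prob_space "sample_space D m n" by (rule U.prob_space_sample_space)
    consider "n = 0" | "n = 1" | "2 \<le> n" by linarith
    then show ?thesis
    proof cases
      \<comment> \<open>For n = 0 the convention 1 / 0 = 0 requires probability 1, which the whole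
        space has; the norm of the empty matrix is 0.\<close>
      case 1
      then show ?thesis
        using \<kappa> by (intro bexI[of _ "space (sample_space D m n)"]) (auto simp: prob_space.prob_space[OF U.prob_space_sample_space] frob_norm_def Let_def)
    next
      case 2
      \<comment> \<open>For n = 1 the required probability is 0, so the empty event serves.\<close>
      then show ?thesis by (intro bexI[of _ "{}"]) auto
    next
      case 3
      then have n: "0 < n" by simp
      have "0 \<le> ln (real n)" using n by simp
      then have "0 \<le> c0 * real r * ln (real n) ^ 10" using c0 by simp
      then have m0: "0 < m" using m by (cases m) auto
      have "\<exists>E \<in> sets (sample_space D m n). 1 - 1 / (real n)\<^sup>2 \<le> measure (sample_space D m n) E \<and>
        (\<forall>\<omega>\<in>E. \<forall>M. toeplitz n M \<longrightarrow> sym_matrix n M \<longrightarrow> frob_norm n M = 1 \<longrightarrow>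
           (\<Sum>j<2 * n. \<bar>symbol_test n M j\<bar>) \<le> 2 * real n * (6 * sqrt (real r)) \<longrightarrow>
           real m * \<kappa> \<le> (\<Sum>k<m. \<bar>qform n M (\<lambda>j. \<omega> (k, j))\<bar>))"
      proof (cases "r = 0")
        case True
        \<comment> \<open>For r = 0 the cone contains no matrix of norm one, so the lower bound
          holds vacuously on the whole space.\<close>
        have "\<not> (\<Sum>j<2 * n. \<bar>symbol_test n M j\<bar>) \<le> 2 * real n * (6 * sqrt (real r))"
          if "toeplitz n M" "sym_matrix n M" "frob_norm n M = 1" for M
          using U.sum_abs_symbol_test_pos[OF n that] True by simp
        then show ?thesis
          by (intro bexI[of _ "space (sample_space D m n)"]) (auto simp: S.prob_space)
      next
        case False
        then show ?thesis using lower[OF 3 _ m] by (simp add: \<kappa>_def)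
      qed
      then obtain E where E: "E \<in> sets (sample_space D m n)"
        "1 - 1 / (real n)\<^sup>2 \<le> measure (sample_space D m n) E"
        and low: "\<And>\<omega> M. \<omega> \<in> E \<Longrightarrow> toeplitz n M \<Longrightarrow> sym_matrix n M \<Longrightarrow> frob_norm n M = 1 \<Longrightarrow>
          (\<Sum>j<2 * n. \<bar>symbol_test n M j\<bar>) \<le> 2 * real n * (6 * sqrt (real r)) \<Longrightarrow>
          real m * \<kappa> \<le> (\<Sum>k<m. \<bar>qform n M (\<lambda>j. \<omega> (k, j))\<bar>)"
        by blast
      show ?thesis
        unfolding Let_def
      proof (intro bexI[OF _ E(1)] conjI ballI allI impI, rule E(2), elim conjE)
        fix \<omega> \<Sigma> eps2 \<eta> Sh
        assume "\<omega> \<in> E" "psd n \<Sigma>" "toeplitz n \<Sigma>" "mrank n \<Sigma> \<le> r" "vnorm m \<eta> \<le> eps2"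
          "trace_min n m (\<lambda>k j. \<omega> (k, j)) (\<lambda>k. meas_op n (\<lambda>k j. \<omega> (k, j)) \<Sigma> k + \<eta> k) eps2 Sh"
        then show "frob_norm n (\<lambda>i j. Sh i j - \<Sigma> i j) \<le> 2 / \<kappa> * eps2 / sqrt (real m)"
          using low by (intro trace_min_error_bound[OF n m0 \<kappa>, where r = r]) auto
      qed
    qed
  qed
  moreover have "0 < 2 / \<kappa>" using \<kappa> by simp
  ultimately show ?thesis using c0 by blast
qed

end
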